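(* Let $\mu\ne0$ be a non-negative Radon measure on $\mathbb{R}$ satisfying the Brinck condition, and let $\mathbf{H}_\mu$ be the operator generated by the form $\mathbf{a}_\mu$. Assume that the negative part of the spectrum of $\mathbf{H}_\mu$ is discrete. Let $(\lambda_n)_{n\in\mathbb{N}}$, $\mathbb{N}=\{1,2,\dots\}$, be the non-decreasing sequence of negative eigenvalues of $\mathbf{H}_\mu$ (counting multiplicities), with the convention that $\lambda_{m+1}=\lambda_{m+2}=\dots=\Lambda:=\inf\sigma_{ess}(\mathbf{H}_\mu)$ if there are only $m$ eigenvalues below the lowest point $\Lambda$ of the essential spectrum. Let $\alpha=(\pi^2+\frac34)^{-1}$ and $\beta=2$. Then, for each $n\in\mathbb{N}$, $$\sup\left\{-\lambda<0:\ \mathcal{L}(\{x:q^*_\beta(x)\ge\lambda/4\})\le\frac{n-1}{\sqrt{\|q^*_\beta\|_\infty}}\right\}\ \le\ \lambda_n\ \le\ \inf\left\{-\lambda<0:\ \mathcal{L}(\{x:q^*_\alpha(x)\ge4\lambda\})\ge\frac{n}{\sqrt\lambda}\right\}.$$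
   Context: $\mathcal{L}$ is Lebesgue measure on $\mathbb{R}$; $\Delta_x(d)=[x-\frac d2,x+\frac d2]$. A Radon measure here is a positive Borel measure on $\mathbb{R}$, finite on compact sets (and regular). The Brinck condition: there is $C>0$ with $\mu([x,x+1])<C$ for all $x\in\mathbb{R}$. For $\alpha>0$ the Otelbaev function of $\mu$ is $$q^*_\alpha(x)=\inf\left\{\tfrac1{d^2}:\ d>0,\ \mu(\Delta_x(d))<\tfrac1{\alpha d}\right\};$$ $\|\cdot\|_\infty$ is the supremum norm. The form is $\mathbf{a}_\mu(f,g)=\int_{\mathbb{R}}f'\overline{g'}\,dx-\int_{\mathbb{R}}f\overline{g}\,d\mu$ on $\{f\in H^1(\mathbb{R}):\int|f|^2d\mu<\infty\}$; under the Brinck condition it is densely defined, symmetric, lower semibounded and closed in $L^2(\mathbb{R})$, and $\mathbf{H}_\mu$ is the self-adjoint operator associated with it. The negative spectrum is discrete if the spectrum in $(-\infty,0)$ consists of isolated eigenvalues of finite multiplicity. The infimum of the empty set is $+\infty$. *)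

theory Defs
  imports "HOL-Analysis.Analysis" "HOL-Library.Function_Algebras"
begin

section \<open>Square-integrable functions and the first-order Sobolev space\<close>

text \<open>
  Elements of the complex Hilbert space \<open>L\<^sup>2(\<real>)\<close> are handled through Borel measurable
  representatives; equality in \<open>L\<^sup>2(\<real>)\<close> is equality almost everywhere.
\<close>

definition L2 :: "(real \<Rightarrow> complex) set" where
  "L2 = {f \<in> borel_measurable lborel. integrable lborel (\<lambda>x. (cmod (f x))\<^sup>2)}"

definition L2_inner :: "(real \<Rightarrow> complex) \<Rightarrow> (real \<Rightarrow> complex) \<Rightarrow> complex" where
  "L2_inner f g = (LINT x|lborel. f x * cnj (g x))"

definition L2_norm :: "(real \<Rightarrow> complex) \<Rightarrow> real" where
  "L2_norm f = sqrt (LINT x|lborel. (cmod (f x))\<^sup>2)"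

text \<open>
  An element of \<open>H\<^sup>1(\<real>)\<close> is represented by its unique continuous representative, which is the
  one that has to be integrated against a measure with atoms.  It is locally absolutely continuous:
  \<open>f\<close> is an indefinite integral of its derivative \<open>g\<close>, and \<open>g\<close> is determined up to null sets.
\<close>

definition has_L2_derivative :: "(real \<Rightarrow> complex) \<Rightarrow> (real \<Rightarrow> complex) \<Rightarrow> bool" where
  "has_L2_derivative f g \<longleftrightarrow>
     g \<in> L2 \<and> (\<forall>a b. a \<le> b \<longrightarrow> f b - f a = (LINT x:{a..b}|lborel. g x))"

definition H1 :: "(real \<Rightarrow> complex) set" where
  "H1 = {f \<in> L2. \<exists>g. has_L2_derivative f g}"

definition H1_deriv :: "(real \<Rightarrow> complex) \<Rightarrow> real \<Rightarrow> complex" where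
  "H1_deriv f = (SOME g. has_L2_derivative f g)"

section \<open>Measures\<close>

text \<open>
  Regularity is not listed: every Borel measure on \<open>\<real>\<close> that is finite on compact sets is regular.
\<close>

definition radon_measure :: "real measure \<Rightarrow> bool" where
  "radon_measure \<mu> \<longleftrightarrow> sets \<mu> = sets borel \<and> (\<forall>K. compact K \<longrightarrow> emeasure \<mu> K < \<infinity>)"

definition brinck :: "real measure \<Rightarrow> bool" where
  "brinck \<mu> \<longleftrightarrow> (\<exists>C::real. 0 < C \<and> (\<forall>x. emeasure \<mu> {x..x + 1} < ennreal C))"

text \<open>
  The infimum is taken in \<open>ereal\<close>, so that of the empty set is \<open>\<infinity>\<close>.  For a Radon measure the sets
  \<open>{x. c \<le> otelbaev \<alpha> \<mu> x}\<close> are closed, hence Borel.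
\<close>

definition otelbaev :: "real \<Rightarrow> real measure \<Rightarrow> real \<Rightarrow> ereal" where
  "otelbaev \<alpha> \<mu> x =
     Inf {ereal (1 / d\<^sup>2) | d. 0 < d \<and> emeasure \<mu> {x - d/2..x + d/2} < ennreal (1 / (\<alpha> * d))}"

text \<open>
  Under the Brinck condition the Otelbaev function is bounded, and it is positive if \<open>\<mu> \<noteq> 0\<close>;
  hence its supremum norm is a positive real and is not affected by \<open>real_of_ereal\<close>.
\<close>

definition sup_norm :: "(real \<Rightarrow> ereal) \<Rightarrow> ereal" where
  "sup_norm q = (SUP x. \<bar>q x\<bar>)"

section \<open>Operators in \<open>L\<^sup>2(\<real>)\<close> and their spectra\<close>

text \<open>
  An operator is given by its graph.  In a pair \<open>(f, h)\<close> the function \<open>h\<close> ranges over all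
  representatives of the image of \<open>f\<close>, whereas every class in the domain is meant to be represented
  by exactly one \<open>f\<close>, as is the case for operators whose domain consists of continuous functions.
\<close>

type_synonym L2_operator = "((real \<Rightarrow> complex) \<times> (real \<Rightarrow> complex)) set"

text \<open>The operator associated with a form \<open>a\<close> with domain \<open>D\<close> (first representation theorem).\<close>

definition form_operator ::
  "(real \<Rightarrow> complex) set \<Rightarrow> ((real \<Rightarrow> complex) \<Rightarrow> (real \<Rightarrow> complex) \<Rightarrow> complex) \<Rightarrow> L2_operator" where
  "form_operator D a = {(f, h). f \<in> D \<and> h \<in> L2 \<and> (\<forall>g\<in>D. a f g = L2_inner h g)}"

definition resolvent_set :: "L2_operator \<Rightarrow> complex set" where
  "resolvent_set A = {z.
     (\<forall>h\<in>L2. \<exists>!f. \<exists>u. (f, u) \<in> A \<and> (AE x in lborel. u x - z * f x = h x)) \<and>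
     (\<exists>C. \<forall>(f, u)\<in>A. L2_norm f \<le> C * L2_norm (\<lambda>x. u x - z * f x))}"

definition op_spectrum :: "L2_operator \<Rightarrow> complex set" where
  "op_spectrum A = - resolvent_set A"

definition op_eigenspace :: "L2_operator \<Rightarrow> complex \<Rightarrow> (real \<Rightarrow> complex) set" where
  "op_eigenspace A z = {f. (f, \<lambda>x. z * f x) \<in> A}"

definition op_eigenvalue :: "L2_operator \<Rightarrow> complex \<Rightarrow> bool" where
  "op_eigenvalue A z \<longleftrightarrow> (\<exists>f\<in>op_eigenspace A z. f \<noteq> (\<lambda>_. 0))"

global_interpretation cfun: vector_space "\<lambda>(c::complex) (f::real \<Rightarrow> complex) x. c * f x"
  by unfold_locales (auto simp: fun_eq_iff algebra_simps)

text \<open>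
  \<open>cfun.dim\<close> is the cardinality of a basis and is meaningful only in finite dimension, whence the
  separate notion of finite multiplicity.
\<close>

definition finite_multiplicity :: "L2_operator \<Rightarrow> complex \<Rightarrow> bool" where
  "finite_multiplicity A z \<longleftrightarrow> (\<exists>B. finite B \<and> op_eigenspace A z \<subseteq> cfun.span B)"

definition eigen_multiplicity :: "L2_operator \<Rightarrow> complex \<Rightarrow> nat" where
  "eigen_multiplicity A z = cfun.dim (op_eigenspace A z)"

definition discrete_spectrum :: "L2_operator \<Rightarrow> complex set" where
  "discrete_spectrum A =
     {z. z isolated_in op_spectrum A \<and> op_eigenvalue A z \<and> finite_multiplicity A z}"

definition essential_spectrum :: "L2_operator \<Rightarrow> complex set" where
  "essential_spectrum A = op_spectrum A - discrete_spectrum A"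

definition inf_essential_spectrum :: "L2_operator \<Rightarrow> ereal" where
  "inf_essential_spectrum A =
     Inf {ereal t | t. complex_of_real t \<in> essential_spectrum A}"

definition negative_spectrum_discrete :: "L2_operator \<Rightarrow> bool" where
  "negative_spectrum_discrete A \<longleftrightarrow>
     (\<forall>t<0. complex_of_real t \<in> op_spectrum A \<longrightarrow> complex_of_real t \<in> discrete_spectrum A)"

text \<open>
  The non-decreasing sequence of negative eigenvalues, each repeated according to its multiplicity,
  and continued by the infimum of the essential spectrum if there are only finitely many of them.
  Sequences are indexed by \<open>n \<ge> 1\<close>; the value at \<open>0\<close> is irrelevant.
\<close>

definition negative_eigenvalue_sequence :: "L2_operator \<Rightarrow> (nat \<Rightarrow> ereal) \<Rightarrow> bool" where
  "negative_eigenvalue_sequence A lam \<longleftrightarrow>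
     mono_on {1..} lam \<and>
     (\<forall>t<0. op_eigenvalue A (complex_of_real t) \<longrightarrow>
        finite {n. 1 \<le> n \<and> lam n = ereal t} \<and>
        card {n. 1 \<le> n \<and> lam n = ereal t} = eigen_multiplicity A (complex_of_real t)) \<and>
     (\<forall>n\<ge>1. (\<exists>t<0. op_eigenvalue A (complex_of_real t) \<and> lam n = ereal t) \<or>
              lam n = inf_essential_spectrum A)"

section \<open>The operator with potential \<open>- \<mu>\<close>\<close>

definition form_domain :: "real measure \<Rightarrow> (real \<Rightarrow> complex) set" where
  "form_domain \<mu> = {f \<in> H1. integrable \<mu> (\<lambda>x. (cmod (f x))\<^sup>2)}"

definition mu_form ::
  "real measure \<Rightarrow> (real \<Rightarrow> complex) \<Rightarrow> (real \<Rightarrow> complex) \<Rightarrow> complex" where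
  "mu_form \<mu> f g =
     (LINT x|lborel. H1_deriv f x * cnj (H1_deriv g x)) - (LINT x|\<mu>. f x * cnj (g x))"

definition H_op :: "real measure \<Rightarrow> L2_operator" where
  "H_op \<mu> = form_operator (form_domain \<mu>) (mu_form \<mu>)"

end

theory Submission
  imports Defs
begin

text \<open>
  For the lower estimate fix \<open>l > 0\<close>, put \<open>h = 1 / sqrt l\<close>, let \<open>e\<close> be slightly smaller than
  \<open>1 / sqrt Q\<close> with \<open>Q\<close> the supremum of the Otelbaev function, and cut the line into half-open
  intervals: starting from \<open>a\<close>, take \<open>[a, a + h)\<close> if its \<open>\<mu>\<close>-mass is at most \<open>1 / (2h)\<close> and
  \<open>[a, a + e)\<close> otherwise.  On each interval the form is at least \<open>- l \<parallel>f\<parallel>\<^sup>2\<close>, provided that \<open>f\<close>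
  vanishes at the left end points of the short ones; these are disjoint subsets of
  \<open>{x. q x \<ge> l / 4}\<close> of length \<open>e\<close>, so there are at most \<open>n - 1\<close> of them, and these \<open>n - 1\<close> linear
  conditions can be met in the span of \<open>n\<close> eigenfunctions.

  For the upper estimate, \<open>n\<close> trapezoidal functions with disjoint supports, centred at points of
  \<open>{x. q x \<ge> 4l}\<close> at mutual distances at least \<open>1 / sqrt l\<close>, span a space on which the form is at
  most \<open>- l \<parallel>f\<parallel>\<^sup>2\<close>.  If there were fewer than \<open>n\<close> eigenvalues up to \<open>- l\<close>, some function of that space
  would be orthogonal to all their eigenfunctions; the infimum \<open>m \<le> - l\<close> of the quotient of the form
  on that orthogonal complement would be a point of the spectrum, hence isolated, and iterating
  \<open>K = \<delta> (H - m + \<delta>)\<^sup>-\<^sup>1\<close> on an almost minimizing function would produce a new eigenfunction.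
\<close>

section \<open>The Hilbert space of square-integrable functions\<close>

text \<open>Spectral information enters through real points \<open>s\<close> of the resolvent set:
  there the weak equation for \<open>H - s\<close> is uniquely solvable, with a norm bound. Whatever
  concerns an isolated point \<open>m\<close> is built from this and Cauchy-Schwarz inequalities.
  The guiding picture: no spectrum in \<open>(m, m + 2 \<delta>)\<close> means
  \<open>t^2 >= 2 \<delta> t\<close> for every spectral value \<open>t\<close> of
  \<open>H - m\<close>; hence on the orthogonal complement, where \<open>t >= 0\<close>,
  \<open>K\<close> takes the value 1 for \<open>t = 0\<close> and at most 1/3 otherwise, and its
  powers filter out the eigencomponent. The number 2 in \<beta> stems from the bound of
  \<open>|f(x)|^2\<close> by \<open>2 d\<close> times the integral of \<open>|f'|^2\<close> plus
  \<open>2 / d\<close> times that of \<open>|f|^2\<close> on an interval of length \<open>d\<close>: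
  a mass of at most \<open>1 / (2 d)\<close> turns this into the form with
  \<open>l = 1 / d^2\<close>. The number \<alpha> enters through \<open>pi > 3\<close>; trapezoids
  then have room to spare.\<close>

lemma quadratic_nonneg_imp:
  fixes z :: complex
  assumes nonneg: "\<And>c::complex. 0 \<le> A + 2 * Re (cnj c * z) + (cmod c)\<^sup>2 * B"
    and B: "0 \<le> B"
  shows "(cmod z)\<^sup>2 \<le> A * B"
proof -
  have A: "0 \<le> A" using nonneg[of 0] by simp
  \<comment> \<open>Only multiples \<open>c = t * z\<close> with real \<open>t\<close> are tried:
    they align the cross term with \<open>z\<close>. For \<open>B > 0\<close> the choice
    \<open>t = -1 / B\<close> gives the claim; for \<open>B = 0\<close> an expression affine in
    \<open>t\<close> stays nonnegative only if \<open>z = 0\<close>.\<close>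
  have zz: "Re (cnj (of_real t * z) * z) = t * (cmod z)\<^sup>2" for t
    unfolding cmod_power2 by (simp add: algebra_simps power2_eq_square)
  have sq: "(cmod (of_real t * z))\<^sup>2 = t\<^sup>2 * (cmod z)\<^sup>2" for t
    by (simp add: norm_mult power_mult_distrib)
  have N: "0 \<le> A + 2 * (t * (cmod z)\<^sup>2) + t\<^sup>2 * (cmod z)\<^sup>2 * B" for t
    using nonneg[of "of_real t * z"] unfolding zz sq .
  define w where "w = (cmod z)\<^sup>2"
  have w: "w \<ge> 0" by (simp add: w_def)
  consider "B > 0" | "B \<le> 0" by linarith
  then show ?thesis
  proof cases
    case 1
    have "0 \<le> A - w / B"
      using N[of "-1 / B"] 1 by (simp add: w_def power2_eq_square)
    then show ?thesis using 1 unfolding w_def[symmetric] by (simp add: field_simps)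
  next
    case 2
    then have "B = 0" using B by simp
    have "w = 0"
    proof (rule ccontr)
      assume "w \<noteq> 0"
      then have "2 * (- (A + 1) / (2 * w) * w) = - (A + 1)" by simp
      then show False using N[of "- (A + 1) / (2 * w)"] \<open>B = 0\<close> by (simp add: w_def)
    qed
    then show ?thesis using \<open>B = 0\<close> by (simp add: w_def)
  qed
qed

text \<open>The measure is a parameter because the same bilinear calculus is applied to
  \<open>lborel\<close>, for the Hilbert space, and to \<open>\<mu>\<close>, for the potential term
  of the form.\<close>

definition sq_integrable :: "real measure \<Rightarrow> (real \<Rightarrow> complex) set" where
  "sq_integrable M = {f \<in> borel_measurable M. integrable M (\<lambda>x. (cmod (f x))\<^sup>2)}"

lemma L2_eq_sq_integrable: "L2 = sq_integrable lborel"
  by (simp add: L2_def sq_integrable_def)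

text \<open>One operation covers sums, differences and scalar multiples, so that each closure or
  linearity property is stated once; a subspace is a set containing 0 and closed under
  \<open>axpy\<close>.\<close>

definition axpy :: "(real \<Rightarrow> complex) \<Rightarrow> complex \<Rightarrow> (real \<Rightarrow> complex) \<Rightarrow> real \<Rightarrow> complex" where
  "axpy f c g = (\<lambda>x. f x + c * g x)"

lemma sq_integrable_mult:
  assumes "f \<in> sq_integrable M" "g \<in> sq_integrable M"
  shows "integrable M (\<lambda>x. f x * cnj (g x))"
proof (rule Bochner_Integration.integrable_bound)
  show "integrable M (\<lambda>x. (cmod (f x))\<^sup>2 + (cmod (g x))\<^sup>2)"
    using assms by (auto simp: sq_integrable_def)
  have "cnj \<in> borel_measurable borel"
    by (intro borel_measurable_continuous_onI continuous_intros)
  then show "(\<lambda>x. f x * cnj (g x)) \<in> borel_measurable M"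
    using assms by (auto simp: sq_integrable_def intro!: borel_measurable_times
      intro: measurable_compose[where g = cnj])
  show "AE x in M. norm (f x * cnj (g x)) \<le> norm ((cmod (f x))\<^sup>2 + (cmod (g x))\<^sup>2)"
  proof (intro AE_I2)
    fix x
    have "2 * (cmod (f x) * cmod (g x)) \<le> (cmod (f x))\<^sup>2 + (cmod (g x))\<^sup>2"
      using sum_squares_bound[of "cmod (f x)" "cmod (g x)"] by simp
    moreover have "0 \<le> cmod (f x) * cmod (g x)" by simp
    ultimately show "norm (f x * cnj (g x)) \<le> norm ((cmod (f x))\<^sup>2 + (cmod (g x))\<^sup>2)"
      unfolding norm_mult complex_mod_cnj real_norm_def by linarith
  qed
qed

lemma sq_integrable_axpy:
  assumes "f \<in> sq_integrable M" "g \<in> sq_integrable M"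
  shows "axpy f c g \<in> sq_integrable M"
proof -
  have m[measurable]: "f \<in> borel_measurable M" "g \<in> borel_measurable M"
    using assms by (auto simp: sq_integrable_def)
  have "integrable M (\<lambda>x. (cmod (f x + c * g x))\<^sup>2)"
  proof (rule Bochner_Integration.integrable_bound)
    show "integrable M (\<lambda>x. 2 * (cmod (f x))\<^sup>2 + 2 * (cmod c)\<^sup>2 * (cmod (g x))\<^sup>2)"
      using assms by (auto simp: sq_integrable_def)
    show "(\<lambda>x. (cmod (f x + c * g x))\<^sup>2) \<in> borel_measurable M" by measurable
    show "AE x in M. norm ((cmod (f x + c * g x))\<^sup>2)
        \<le> norm (2 * (cmod (f x))\<^sup>2 + 2 * (cmod c)\<^sup>2 * (cmod (g x))\<^sup>2)"
    proof (intro AE_I2)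
      fix x
      have "cmod (f x + c * g x) \<le> cmod (f x) + cmod (c * g x)" by (rule norm_triangle_ineq)
      then have "(cmod (f x + c * g x))\<^sup>2 \<le> (cmod (f x) + cmod (c * g x))\<^sup>2"
        by (intro power_mono) auto
      also have "\<dots> \<le> 2 * (cmod (f x))\<^sup>2 + 2 * (cmod (c * g x))\<^sup>2"
        using sum_squares_bound[of "cmod (f x)" "cmod (c * g x)"] by (simp add: power2_sum)
      finally show "norm ((cmod (f x + c * g x))\<^sup>2)
        \<le> norm (2 * (cmod (f x))\<^sup>2 + 2 * (cmod c)\<^sup>2 * (cmod (g x))\<^sup>2)"
        by (simp add: norm_mult power_mult_distrib)
    qed
  qed
  then show ?thesis by (simp add: sq_integrable_def axpy_def)
qed

lemma zero_sq_integrable: "(\<lambda>_. 0) \<in> sq_integrable M"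
  by (simp add: sq_integrable_def)

lemma integral_mult_axpy:
  assumes "f \<in> sq_integrable M" "g \<in> sq_integrable M" "h \<in> sq_integrable M"
  shows "(LINT x|M. axpy f c g x * cnj (h x)) = (LINT x|M. f x * cnj (h x)) + c * (LINT x|M. g x * cnj (h x))"
proof -
  have "(LINT x|M. axpy f c g x * cnj (h x)) = (LINT x|M. f x * cnj (h x) + c * (g x * cnj (h x)))"
    by (simp add: axpy_def algebra_simps)
  also have "\<dots> = (LINT x|M. f x * cnj (h x)) + (LINT x|M. c * (g x * cnj (h x)))"
    using assms by (intro Bochner_Integration.integral_add integrable_mult_right sq_integrable_mult)
  finally show ?thesis by simp
qed

lemma integral_mult_cnj_commute: 
  "(LINT x|M. g x * cnj (f x)) = cnj (LINT x|M. f x * cnj (g x :: complex))"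
  by (subst Bochner_Integration.integral_cnj[symmetric]) (simp add: mult.commute)

lemma integral_mult_cnj_self:
  "(LINT x|M. f x * cnj (f x)) = complex_of_real (LINT x|M. (cmod (f x))\<^sup>2)"
  by (subst integral_complex_of_real[symmetric]) (simp add: complex_norm_square del: of_real_power)

lemmas L2_axpy = sq_integrable_axpy[of _ lborel, folded L2_eq_sq_integrable]
lemmas zero_L2 = zero_sq_integrable[of lborel, folded L2_eq_sq_integrable]
lemmas L2_inner_axpy = integral_mult_axpy[of _ lborel, folded L2_eq_sq_integrable L2_inner_def]

lemma L2_inner_commute: "L2_inner g f = cnj (L2_inner f g)"
  unfolding L2_inner_def by (rule integral_mult_cnj_commute)

lemma L2_inner_axpy_right:
  assumes "f \<in> L2" "g \<in> L2" "h \<in> L2"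
  shows "L2_inner h (axpy f c g) = L2_inner h f + cnj c * L2_inner h g"
  using L2_inner_axpy[OF assms, of c] L2_inner_commute
  by (metis complex_cnj_add complex_cnj_mult)

lemma L2_inner_zero [simp]: "L2_inner (\<lambda>_. 0) g = 0" "L2_inner g (\<lambda>_. 0) = 0"
  by (simp_all add: L2_inner_def)

definition L2_sq :: "(real \<Rightarrow> complex) \<Rightarrow> real" where
  "L2_sq f = (LINT x|lborel. (cmod (f x))\<^sup>2)"

lemma L2_inner_self: "L2_inner f f = of_real (L2_sq f)"
  unfolding L2_inner_def L2_sq_def by (rule integral_mult_cnj_self)

lemma L2_sq_nonneg [simp]: "0 \<le> L2_sq f"
  by (simp add: L2_sq_def)

lemma L2_norm_sq: "L2_norm f = sqrt (L2_sq f)"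
  by (simp add: L2_norm_def L2_sq_def)

lemma L2_sq_axpy:
  assumes "f \<in> L2" "g \<in> L2"
  shows "L2_sq (axpy f c g) = L2_sq f + 2 * Re (cnj c * L2_inner f g) + (cmod c)\<^sup>2 * L2_sq g"
proof -
  have "L2_inner (axpy f c g) (axpy f c g) =
      L2_inner f f + (cnj c * L2_inner f g + cnj (cnj c * L2_inner f g)) + (c * cnj c) * L2_inner g g"
    using assms by (simp add: L2_inner_axpy L2_inner_axpy_right L2_axpy algebra_simps
      L2_inner_commute[of g f])
  then have "Re (L2_inner (axpy f c g) (axpy f c g)) =
      Re (L2_inner f f) + 2 * Re (cnj c * L2_inner f g) + Re ((c * cnj c) * L2_inner g g)"
    by (simp del: complex_cnj_mult)
  then show ?thesis
    unfolding L2_inner_self cmod_power2 by (simp add: algebra_simps power2_eq_square)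
qed

lemma L2_Cauchy_Schwarz:
  assumes "f \<in> L2" "g \<in> L2"
  shows "(cmod (L2_inner f g))\<^sup>2 \<le> L2_sq f * L2_sq g"
  by (rule quadratic_nonneg_imp) (use L2_sq_axpy[OF assms] L2_sq_nonneg in metis)+

lemma L2_norm_axpy:
  assumes "f \<in> L2" "g \<in> L2"
  shows "L2_norm (axpy f c g) \<le> L2_norm f + cmod c * L2_norm g"
proof -
  have "cmod (L2_inner f g) \<le> L2_norm f * L2_norm g"
    using real_sqrt_le_mono[OF L2_Cauchy_Schwarz[OF assms]]
    by (simp add: L2_norm_sq real_sqrt_mult)
  then have "cmod c * cmod (L2_inner f g) \<le> cmod c * (L2_norm f * L2_norm g)"
    by (intro mult_left_mono) auto
  moreover have "Re (cnj c * L2_inner f g) \<le> cmod c * cmod (L2_inner f g)"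
    using complex_Re_le_cmod[of "cnj c * L2_inner f g"] by (simp add: norm_mult)
  ultimately have "L2_sq (axpy f c g) \<le> (L2_norm f + cmod c * L2_norm g)\<^sup>2"
    unfolding L2_sq_axpy[OF assms] power2_sum
    by (simp add: L2_norm_sq power_mult_distrib mult.left_commute mult.assoc)
  then show ?thesis
    unfolding L2_norm_sq[of "axpy f c g"]
    by (intro real_le_lsqrt) (auto simp: L2_norm_sq)
qed

lemma nn_integral_cmod_sq:
  assumes "f \<in> L2"
  shows "(\<integral>\<^sup>+x. ennreal ((cmod (f x))\<^sup>2) \<partial>lborel) = ennreal (L2_sq f)"
  using assms unfolding L2_sq_def L2_def by (intro nn_integral_eq_integral) auto

lemma L2I_nn_integral:
  assumes [measurable]: "f \<in> borel_measurable lborel"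
    and "(\<integral>\<^sup>+x. ennreal ((cmod (f x))\<^sup>2) \<partial>lborel) \<le> ennreal C" "0 \<le> C"
  shows "f \<in> L2" "L2_sq f \<le> C"
proof -
  have "(\<integral>\<^sup>+x. ennreal ((cmod (f x))\<^sup>2) \<partial>lborel) < \<infinity>"
    using assms(2) by (metis ennreal_less_top infinity_ennreal_def order_le_less_trans)
  then show f: "f \<in> L2" by (auto simp: L2_def intro!: integrableI_nonneg)
  show "L2_sq f \<le> C" using nn_integral_cmod_sq[OF f] assms(2,3) by simp
qed

text \<open>The completeness of \<open>L\<^sup>2\<close> is needed for rapidly converging sequences only.\<close>

lemma L2_geometric_limit:
  assumes f: "\<And>n. f n \<in> L2"
    and step: "\<And>n. L2_norm (axpy (f (Suc n)) (-1) (f n)) \<le> C * (1/2)^n"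
  shows "\<exists>p\<in>L2. (\<lambda>n. L2_norm (axpy p (-1) (f n))) \<longlonglongrightarrow> 0"
proof -
  have [measurable]: "f n \<in> borel_measurable lborel" for n using f[of n] by (auto simp: L2_def)
  define u where "u n = axpy (f (Suc n)) (-1) (f n)" for n
  have u: "u n \<in> L2" for n by (simp add: u_def f L2_axpy)
  then have [measurable]: "u n \<in> borel_measurable lborel" for n by (auto simp: L2_def)
  have C: "0 \<le> C" using step[of 0] by (simp add: L2_norm_sq) (meson L2_sq_nonneg order_trans real_sqrt_ge_0_iff)
  have usq: "L2_sq (u n) \<le> C\<^sup>2 * (1/4)^n" for n
  proof -
    have "(L2_norm (u n))\<^sup>2 \<le> (C * (1/2)^n)\<^sup>2"
      using step[of n] by (intro power_mono) (auto simp: u_def L2_norm_sq)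
    also have "(C * (1/2)^n)\<^sup>2 = C\<^sup>2 * (1/4)^n"
      by (simp add: power_mult_distrib power_divide power2_eq_square flip: power_mult_distrib)
    finally show ?thesis by (simp add: L2_norm_sq)
  qed
  have dist: "L2_norm (axpy (f (n + k)) (-1) (f n)) \<le> C * (\<Sum>j<k. (1/2)^(n+j))" for n k
  proof (induction k)
    case 0
    have "axpy (f n) (-1) (f n) = (\<lambda>_. 0)" by (auto simp: axpy_def)
    then show ?case by (simp add: L2_norm_sq L2_sq_def)
  next
    case (Suc k)
    have "axpy (f (n + Suc k)) (-1) (f n) = axpy (axpy (f (n + k)) (-1) (f n)) 1 (u (n + k))"
      by (auto simp: axpy_def u_def)
    then have "L2_norm (axpy (f (n + Suc k)) (-1) (f n)) 
        \<le> L2_norm (axpy (f (n + k)) (-1) (f n)) + L2_norm (u (n + k))"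
      using L2_norm_axpy[of "axpy (f (n + k)) (-1) (f n)" "u (n + k)" 1] f u by (simp add: L2_axpy)
    then show ?case using Suc step[of "n+k"] by (simp add: u_def algebra_simps)
  qed
  have geo: "(\<Sum>j<k. (1/2::real)^(n+j)) \<le> 2 * (1/2)^n" for n k
  proof -
    have "(\<Sum>j<k. (1/2::real)^j) \<le> 2"
      unfolding sum_gp_strict by simp
    then show ?thesis by (simp add: power_add flip: sum_distrib_left)
  qed
  have distsq: "L2_sq (axpy (f (n + k)) (-1) (f n)) \<le> (2 * C * (1/2)^n)\<^sup>2" for n k
  proof -
    have "L2_norm (axpy (f (n + k)) (-1) (f n)) \<le> 2 * C * (1/2)^n"
      using dist[of n k] mult_left_mono[OF geo[of n k] C] by linarith
    then have "(L2_norm (axpy (f (n + k)) (-1) (f n)))\<^sup>2 \<le> (2 * C * (1/2)^n)\<^sup>2"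
      by (intro power_mono) (auto simp: L2_norm_sq)
    then show ?thesis by (simp add: L2_norm_sq)
  qed
  \<comment> \<open>The weights \<open>2^n\<close> turn finiteness of this sum at almost every point
    into \<open>|u n x| <= 2^(-n/2)\<close> for large \<open>n\<close>, a summable bound; so the
    telescoping sum converges there.\<close>
  have "(\<integral>\<^sup>+x. (\<Sum>n. ennreal (2^n * (cmod (u n x))\<^sup>2)) \<partial>lborel) 
      = (\<Sum>n. \<integral>\<^sup>+x. ennreal (2^n * (cmod (u n x))\<^sup>2) \<partial>lborel)"
    by (rule nn_integral_suminf) measurable
  also have "\<dots> = (\<Sum>n. ennreal (2^n * L2_sq (u n)))"
    by (simp add: ennreal_mult nn_integral_cmult nn_integral_cmod_sq[OF u])
  also have "\<dots> \<le> (\<Sum>n. ennreal (C\<^sup>2 * (1/2)^n))"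
  proof (intro suminf_le ennreal_leI)
    fix n
    have "2^n * L2_sq (u n) \<le> 2^n * (C\<^sup>2 * (1/4)^n)" by (intro mult_left_mono usq) simp
    also have "\<dots> = C\<^sup>2 * (2 * (1/4))^n" unfolding power_mult_distrib by simp
    finally show "2^n * L2_sq (u n) \<le> C\<^sup>2 * (1/2)^n" by simp
  qed auto
  also have "\<dots> = ennreal (\<Sum>n. C\<^sup>2 * (1/2)^n)"
    by (intro suminf_ennreal2) (auto intro!: summable_mult)
  finally have "(\<integral>\<^sup>+x. (\<Sum>n. ennreal (2^n * (cmod (u n x))\<^sup>2)) \<partial>lborel) \<noteq> \<infinity>"
    by (metis ennreal_neq_top infinity_ennreal_def neq_top_trans)
  then have "AE x in lborel. (\<Sum>n. ennreal (2^n * (cmod (u n x))\<^sup>2)) \<noteq> \<infinity>"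
    by (intro nn_integral_PInf_AE) auto
  then have conv: "AE x in lborel. (\<lambda>n. f n x) \<longlonglongrightarrow> lim (\<lambda>n. f n x)"
  proof eventually_elim
    case (elim x)
    have sm: "summable (\<lambda>n. 2^n * (cmod (u n x))\<^sup>2)"
      using elim by (intro summable_suminf_not_top) auto
    then have "(\<lambda>n. 2^n * (cmod (u n x))\<^sup>2) \<longlonglongrightarrow> 0" by (rule summable_LIMSEQ_zero)
    then have "eventually (\<lambda>n. 2^n * (cmod (u n x))\<^sup>2 < 1) sequentially"
      by (rule order_tendstoD) simp
    then have ev: "eventually (\<lambda>n. norm (u n x) \<le> (sqrt (1/2))^n) sequentially"
    proof eventually_elim
      case (elim n)
      then have "(cmod (u n x))\<^sup>2 \<le> (1/2)^n" by (simp add: field_simps power_divide)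
      then have "cmod (u n x) \<le> sqrt ((1/2)^n)" by (rule real_le_rsqrt)
      then show ?case by (simp add: real_sqrt_power)
    qed
    have "summable (\<lambda>n. u n x)"
      by (rule summable_comparison_test_ev[OF ev]) (auto intro!: summable_geometric)
    then have "convergent (\<lambda>n. \<Sum>k<n. u k x)" by (simp add: summable_iff_convergent)
    moreover have "(\<Sum>k<n. u k x) = f n x - f 0 x" for n
      by (induction n) (auto simp: u_def axpy_def)
    ultimately have "convergent (\<lambda>n. f n x - f 0 x)" by simp
    then have "convergent (\<lambda>n. (f n x - f 0 x) + f 0 x)"
      by (intro convergent_add convergent_const)
    then show ?case by (simp add: convergent_LIMSEQ_iff)
  qed
  define p where "p x = lim (\<lambda>n. f n x)" for x
  have [measurable]: "p \<in> borel_measurable lborel"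
    unfolding p_def by (rule borel_measurable_lim_metric) simp
  \<comment> \<open>Fatou's lemma passes the tail bound \<open>distsq\<close> on to the pointwise
    limit.\<close>
  have bound: "(\<integral>\<^sup>+x. ennreal ((cmod (axpy p (-1) (f n) x))\<^sup>2) \<partial>lborel) \<le> ennreal ((2 * C * (1/2)^n)\<^sup>2)" for n
  proof -
    have "(\<integral>\<^sup>+x. ennreal ((cmod (axpy p (-1) (f n) x))\<^sup>2) \<partial>lborel) 
        = (\<integral>\<^sup>+x. liminf (\<lambda>k. ennreal ((cmod (axpy (f (n + k)) (-1) (f n) x))\<^sup>2)) \<partial>lborel)"
    proof (rule nn_integral_cong_AE, use conv in eventually_elim)
      case (elim x)
      then have "(\<lambda>k. f (n + k) x) \<longlonglongrightarrow> p x" 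
        using LIMSEQ_ignore_initial_segment[of "\<lambda>n. f n x" _ n] by (simp add: p_def add.commute)
      then have "(\<lambda>k. ennreal ((cmod (axpy (f (n + k)) (-1) (f n) x))\<^sup>2)) 
          \<longlonglongrightarrow> ennreal ((cmod (axpy p (-1) (f n) x))\<^sup>2)"
        unfolding axpy_def by (intro tendsto_ennrealI tendsto_intros)
      then show ?case by (metis lim_imp_Liminf sequentially_bot)
    qed
    also have "\<dots> \<le> liminf (\<lambda>k. \<integral>\<^sup>+x. ennreal ((cmod (axpy (f (n + k)) (-1) (f n) x))\<^sup>2) \<partial>lborel)"
      by (rule nn_integral_liminf) (simp add: axpy_def)
    also have "\<dots> \<le> liminf (\<lambda>k::nat. ennreal ((2 * C * (1/2)^n)\<^sup>2))"
      by (intro Liminf_mono always_eventually allI)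
        (simp add: nn_integral_cmod_sq L2_axpy f distsq)
    finally show ?thesis by (simp add: Liminf_const)
  qed
  have mm: "axpy p (-1) (f n) \<in> borel_measurable lborel" for n by (simp add: axpy_def)
  have d: "axpy p (-1) (f n) \<in> L2" "L2_sq (axpy p (-1) (f n)) \<le> (2 * C * (1/2)^n)\<^sup>2" for n
    using L2I_nn_integral[OF mm bound] by auto
  have "p = axpy (axpy p (-1) (f 0)) 1 (f 0)" by (auto simp: axpy_def)
  then have "p \<in> L2" using L2_axpy[OF d(1)[of 0] f[of 0], of 1] by simp
  moreover have "(\<lambda>n. L2_norm (axpy p (-1) (f n))) \<longlonglongrightarrow> 0"
  proof (rule tendsto_sandwich)
    show "\<forall>\<^sub>F n in sequentially. 0 \<le> L2_norm (axpy p (-1) (f n))" by (simp add: L2_norm_sq)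
    show "\<forall>\<^sub>F n in sequentially. L2_norm (axpy p (-1) (f n)) \<le> 2 * C * (1/2)^n"
      using d(2) C by (intro always_eventually allI) (simp add: L2_norm_sq real_le_lsqrt)
    show "(\<lambda>n. 2 * C * (1/2)^n) \<longlonglongrightarrow> 0"
      by (rule tendsto_mult_right_zero) (simp add: LIMSEQ_power_zero)
  qed simp
  ultimately show ?thesis by blast
qed

section \<open>Operators of semibounded forms\<close>

lemma L2_inner_cong_AE:
  assumes "f \<in> L2" "f' \<in> L2" "g \<in> L2" "AE x in lborel. f x = f' x"
  shows "L2_inner f g = L2_inner f' g"
  unfolding L2_inner_def
proof (rule integral_cong_AE)
  show "(\<lambda>x. f x * cnj (g x)) \<in> borel_measurable lborel" "(\<lambda>x. f' x * cnj (g x)) \<in> borel_measurable lborel"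
    using assms sq_integrable_mult[of _ lborel] by (auto simp: L2_eq_sq_integrable)
  show "AE x in lborel. f x * cnj (g x) = f' x * cnj (g x)"
    using assms(4) by eventually_elim simp
qed

lemma L2_inner_le_norms:
  assumes "f \<in> L2" "g \<in> L2"
  shows "cmod (L2_inner f g) \<le> L2_norm f * L2_norm g"
  using real_sqrt_le_mono[OF L2_Cauchy_Schwarz[OF assms]] by (simp add: L2_norm_sq real_sqrt_mult)

lemma L2_norm_nonneg [simp]: "0 \<le> L2_norm f"
  by (simp add: L2_norm_sq)

lemma L2_norm_power2 [simp]: "(L2_norm f)\<^sup>2 = L2_sq f"
  by (simp add: L2_norm_sq)

lemma scale_L2: "f \<in> L2 \<Longrightarrow> (\<lambda>x. c * f x) \<in> L2"
  using L2_axpy[OF zero_L2, of f c] by (simp add: axpy_def)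

lemma L2_inner_scale:
  assumes "f \<in> L2" "g \<in> L2"
  shows "L2_inner (\<lambda>x. c * f x) g = c * L2_inner f g"
  using L2_inner_axpy[OF zero_L2 assms, of c] by (simp add: axpy_def)

definition orth :: "(real \<Rightarrow> complex) set \<Rightarrow> (real \<Rightarrow> complex) set" where
  "orth E = {f \<in> L2. \<forall>e\<in>E. L2_inner f e = 0}"

lemma orth_axpy: "E \<subseteq> L2 \<Longrightarrow> f \<in> orth E \<Longrightarrow> g \<in> orth E \<Longrightarrow> axpy f c g \<in> orth E"
  by (auto simp: orth_def L2_axpy L2_inner_axpy subset_iff)

text \<open>\<open>D_definite\<close> makes \<open>D\<close> a set of representatives: members that
  agree almost everywhere coincide. The uniqueness clause in \<open>resolvent_set\<close> and linear
  independence of eigenfunctions rest on this.\<close>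

locale semibounded_form =
  fixes D :: "(real \<Rightarrow> complex) set" and a :: "(real \<Rightarrow> complex) \<Rightarrow> (real \<Rightarrow> complex) \<Rightarrow> complex"
  assumes D_L2: "f \<in> D \<Longrightarrow> f \<in> L2"
    and zero_D: "(\<lambda>_. 0) \<in> D"
    and axpy_D: "f \<in> D \<Longrightarrow> g \<in> D \<Longrightarrow> axpy f c g \<in> D"
    and a_axpy: "f \<in> D \<Longrightarrow> g \<in> D \<Longrightarrow> h \<in> D \<Longrightarrow> a (axpy f c g) h = a f h + c * a g h"
    and a_commute: "f \<in> D \<Longrightarrow> g \<in> D \<Longrightarrow> a g f = cnj (a f g)"
    and D_definite: "f \<in> D \<Longrightarrow> L2_sq f = 0 \<Longrightarrow> f = (\<lambda>_. 0)"
    and semibounded: "\<exists>C. \<forall>f\<in>D. C * L2_sq f \<le> Re (a f f)"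
begin

abbreviation "H \<equiv> form_operator D a"

definition shifted :: "real \<Rightarrow> (real \<Rightarrow> complex) \<Rightarrow> (real \<Rightarrow> complex) \<Rightarrow> complex" where
  "shifted s f g = a f g - of_real s * L2_inner f g"

lemma shifted_axpy:
  "f \<in> D \<Longrightarrow> g \<in> D \<Longrightarrow> h \<in> D \<Longrightarrow> shifted s (axpy f c g) h = shifted s f h + c * shifted s g h"
  by (simp add: shifted_def a_axpy L2_inner_axpy D_L2 algebra_simps)

lemma shifted_commute: "f \<in> D \<Longrightarrow> g \<in> D \<Longrightarrow> shifted s g f = cnj (shifted s f g)"
  by (simp add: shifted_def a_commute[of f g] L2_inner_commute[of g f])

lemma shifted_axpy_right:
  "f \<in> D \<Longrightarrow> g \<in> D \<Longrightarrow> h \<in> D \<Longrightarrow> shifted s h (axpy f c g) = shifted s h f + cnj c * shifted s h g"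
  using shifted_axpy[of f g h s c] shifted_commute axpy_D
  by (metis complex_cnj_add complex_cnj_mult)

lemma Re_shifted_self: "f \<in> D \<Longrightarrow> Re (shifted s f f) = Re (a f f) - s * L2_sq f"
  by (simp add: shifted_def L2_inner_self)

lemma shifted_quadratic:
  assumes "f \<in> D" "g \<in> D"
  shows "Re (shifted s (axpy f c g) (axpy f c g)) =
    Re (shifted s f f) + 2 * Re (cnj c * shifted s f g) + (cmod c)\<^sup>2 * Re (shifted s g g)"
proof -
  have "shifted s (axpy f c g) (axpy f c g) =
      shifted s f f + (cnj c * shifted s f g + cnj (cnj c * shifted s f g)) + (c * cnj c) * shifted s g g"
    using assms by (simp add: shifted_axpy shifted_axpy_right axpy_D algebra_simps
      shifted_commute[of f g])
  moreover have "c * cnj c = of_real ((cmod c)\<^sup>2)" by (rule complex_norm_square[symmetric])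
  ultimately have "shifted s (axpy f c g) (axpy f c g) =
      shifted s f f + (cnj c * shifted s f g + cnj (cnj c * shifted s f g)) + of_real ((cmod c)\<^sup>2) * shifted s g g"
    by simp
  then show ?thesis by (simp del: complex_cnj_mult of_real_power)
qed

text \<open>Nonnegativity is asked on a subspace \<open>V\<close> because it will be known on an
  orthogonal complement of eigenfunctions and may fail on all of \<open>D\<close>.\<close>

lemma shifted_Cauchy_Schwarz:
  assumes V: "V \<subseteq> D" "\<And>f g c. f \<in> V \<Longrightarrow> g \<in> V \<Longrightarrow> axpy f c g \<in> V"
    and nonneg: "\<And>f. f \<in> V \<Longrightarrow> 0 \<le> Re (shifted s f f)"
    and "f \<in> V" "g \<in> V"
  shows "(cmod (shifted s f g))\<^sup>2 \<le> Re (shifted s f f) * Re (shifted s g g)"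
proof (rule quadratic_nonneg_imp)
  fix c
  have "0 \<le> Re (shifted s (axpy f c g) (axpy f c g))"
    using assms by blast
  then show "0 \<le> Re (shifted s f f) + 2 * Re (cnj c * shifted s f g) + (cmod c)\<^sup>2 * Re (shifted s g g)"
    by (subst (asm) shifted_quadratic) (use V(1) \<open>f \<in> V\<close> \<open>g \<in> V\<close> in auto)
qed (use nonneg \<open>g \<in> V\<close> in blast)

text \<open>The weak form of \<open>(H - s) f = h\<close>.\<close>

definition sol :: "real \<Rightarrow> (real \<Rightarrow> complex) \<Rightarrow> (real \<Rightarrow> complex) \<Rightarrow> bool" where
  "sol s f h \<longleftrightarrow> f \<in> D \<and> h \<in> L2 \<and> (\<forall>g\<in>D. shifted s f g = L2_inner h g)"

abbreviation regular :: "real \<Rightarrow> bool" where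
  "regular s \<equiv> complex_of_real s \<in> resolvent_set H"

lemma solD: "sol s f h \<Longrightarrow> f \<in> D" "sol s f h \<Longrightarrow> f \<in> L2" "sol s f h \<Longrightarrow> h \<in> L2"
  "sol s f h \<Longrightarrow> g \<in> D \<Longrightarrow> shifted s f g = L2_inner h g"
  by (auto simp: sol_def D_L2)

lemma sol_axpy: "sol s f h \<Longrightarrow> sol s f' h' \<Longrightarrow> sol s (axpy f c f') (axpy h c h')"
  by (simp add: sol_def axpy_D L2_axpy shifted_axpy L2_inner_axpy D_L2)

text \<open>This is \<open>(H - r) f = (H - s) f + (s - r) f\<close>; it carries solutions from one
  spectral parameter to another, regular or not.\<close>

lemma sol_shift: "sol s f h \<Longrightarrow> sol r f (axpy h (of_real (s - r)) f)"
  by (auto simp: sol_def L2_axpy L2_inner_axpy D_L2 shifted_def algebra_simps)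

lemma regular_solvable:
  assumes "regular s" "h \<in> L2"
  shows "\<exists>f. sol s f h"
proof -
  obtain f u where fu: "(f, u) \<in> H" and ae: "AE x in lborel. u x - of_real s * f x = h x"
    using assms unfolding resolvent_set_def by blast
  then have f: "f \<in> D" "u \<in> L2" and au: "\<And>g. g \<in> D \<Longrightarrow> a f g = L2_inner u g"
    by (auto simp: form_operator_def)
  have "shifted s f g = L2_inner h g" if "g \<in> D" for g
  proof -
    have "L2_inner u g = L2_inner (axpy h (of_real s) f) g"
    proof (rule L2_inner_cong_AE)
      show "AE x in lborel. u x = axpy h (of_real s) f x"
        using ae by eventually_elim (auto simp: axpy_def algebra_simps)
    qed (use f assms(2) that in \<open>auto simp: L2_axpy D_L2\<close>)
    then show ?thesis using f assms that by (simp add: shifted_def au L2_inner_axpy D_L2)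
  qed
  then show ?thesis using f assms by (auto simp: sol_def)
qed

lemma regular_bound:
  assumes "regular s"
  shows "\<exists>C>0. \<forall>f h. sol s f h \<longrightarrow> L2_norm f \<le> C * L2_norm h"
proof -
  obtain C where C: "\<And>f u. (f, u) \<in> H \<Longrightarrow> L2_norm f \<le> C * L2_norm (\<lambda>x. u x - of_real s * f x)"
    using assms unfolding resolvent_set_def by blast
  have "L2_norm f \<le> (\<bar>C\<bar> + 1) * L2_norm h" if fh: "sol s f h" for f h
  proof -
    have "(f, axpy h (of_real s) f) \<in> H"
      using fh by (auto simp: form_operator_def sol_def L2_axpy D_L2 L2_inner_axpy shifted_def algebra_simps)
    from C[OF this] have "L2_norm f \<le> C * L2_norm h" by (simp add: axpy_def)
    also have "\<dots> \<le> (\<bar>C\<bar> + 1) * L2_norm h" by (intro mult_right_mono) auto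
    finally show ?thesis .
  qed
  then show ?thesis by (intro exI[of _ "\<bar>C\<bar> + 1"]) auto
qed

lemma eigenspace_iff_sol: "f \<in> op_eigenspace H (of_real t) \<longleftrightarrow> sol t f (\<lambda>_. 0)"
  by (auto simp: op_eigenspace_def form_operator_def sol_def zero_L2 shifted_def L2_inner_scale
    D_L2 scale_L2)

lemma not_regular_eigen:
  assumes "sol t f (\<lambda>_. 0)" "f \<noteq> (\<lambda>_. 0)"
  shows "\<not> regular t"
proof
  assume "regular t"
  then obtain C where "L2_norm f \<le> C * L2_norm (\<lambda>_. 0)" using regular_bound assms by blast
  then have "L2_sq f = 0" using L2_sq_nonneg[of f] by (simp add: L2_norm_sq L2_sq_def[of "\<lambda>_. 0"])
  then show False using assms solD(1) D_definite by blast
qed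

lemma sol_unique:
  assumes "regular s" "sol s f h" "sol s f' h"
  shows "f = f'"
proof (rule ccontr)
  assume "f \<noteq> f'"
  then have "axpy f (-1) f' \<noteq> (\<lambda>_. 0)" by (auto simp: axpy_def fun_eq_iff)
  moreover have "axpy h (-1) h = (\<lambda>_. 0)" by (auto simp: axpy_def)
  ultimately show False using sol_axpy[OF assms(2,3), of "-1"] not_regular_eigen assms(1) by metis
qed

section \<open>The bottom of the form on the orthogonal complement of eigenfunctions\<close>

definition eigenvectors :: "(real \<Rightarrow> complex) set \<Rightarrow> bool" where
  "eigenvectors E \<longleftrightarrow> (\<forall>e\<in>E. \<exists>t. sol t e (\<lambda>_. 0))"

lemma eigenvectors_L2: "eigenvectors E \<Longrightarrow> E \<subseteq> L2"
  by (auto simp: eigenvectors_def dest: solD)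

text \<open>Pairing with an eigenfunction \<open>e\<close> for \<open>t\<close> gives
  \<open>(t - s) <f, e> = <h, e> = 0\<close> by symmetry of the form, and \<open>t\<close> differs
  from the regular point \<open>s\<close>. Resolvents can therefore be used inside
  \<open>orth E\<close>.\<close>

lemma sol_orth:
  assumes "eigenvectors E" "regular s" "sol s f h" "h \<in> orth E"
  shows "f \<in> orth E"
proof -
  have "L2_inner f e = 0" if eE: "e \<in> E" for e
  proof (cases "e = (\<lambda>_. 0)")
    case False
    obtain t where t: "sol t e (\<lambda>_. 0)" using assms(1) eE unfolding eigenvectors_def by blast
    then have "t \<noteq> s" using not_regular_eigen False assms by blast
    have "shifted t e f = 0" using solD(4)[OF t solD(1)[OF assms(3)]] by simp
    then have "shifted t f e = 0" using shifted_commute[of e f t] solD t assms by simp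
    moreover have "shifted s f e = 0"
      using solD(4)[OF assms(3) solD(1)[OF t]] assms(4) that by (simp add: orth_def)
    ultimately have "(of_real t - of_real s) * L2_inner f e = 0"
      by (simp add: shifted_def algebra_simps)
    then show ?thesis using \<open>t \<noteq> s\<close> by (simp flip: of_real_diff)
  qed simp
  then show ?thesis using assms solD by (auto simp: orth_def)
qed

text \<open>If \<open>m\<close> were regular, the \<open>g\<close> with \<open>(H - m) g = f\<close>
  would satisfy \<open>||f||^4 <= shifted m g g * shifted m f f\<close>. The first factor is at most
  \<open>C ||f||^2\<close> by the resolvent bound \<open>C\<close>, and an almost minimizing
  \<open>f\<close> makes the second smaller than \<open>||f||^2 / C\<close>.\<close>

lemma bottom_not_regular:
  assumes E: "eigenvectors E"
    and nonneg: "\<And>f. f \<in> D \<inter> orth E \<Longrightarrow> 0 \<le> Re (shifted m f f)"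
    and approx: "\<And>\<epsilon>. 0 < \<epsilon> \<Longrightarrow> \<exists>f\<in>D \<inter> orth E. 0 < L2_sq f \<and> Re (shifted m f f) < \<epsilon> * L2_sq f"
  shows "\<not> regular m"
proof
  assume r: "regular m"
  obtain C where C: "C > 0" "\<And>f h. sol m f h \<Longrightarrow> L2_norm f \<le> C * L2_norm h"
    using regular_bound[OF r] by blast
  obtain f where f: "f \<in> D \<inter> orth E" "0 < L2_sq f" "Re (shifted m f f) < 1 / C * L2_sq f"
    using approx[of "1 / C"] C by auto
  obtain g where g: "sol m g f" using regular_solvable[OF r] f D_L2 by blast
  have gX: "g \<in> D \<inter> orth E" using sol_orth[OF E r g] f solD g by blast
  have gf: "shifted m g f = of_real (L2_sq f)" using solD(4)[OF g] f by (simp add: L2_inner_self)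
  have "Re (shifted m g g) \<le> cmod (L2_inner f g)"
    using solD(4)[OF g] gX by (simp add: complex_Re_le_cmod)
  also have "\<dots> \<le> L2_norm f * L2_norm g" using f gX D_L2 by (intro L2_inner_le_norms) auto
  also have "\<dots> \<le> L2_norm f * (C * L2_norm f)" by (intro mult_left_mono C g) auto
  also have "\<dots> = C * L2_sq f" by (simp add: L2_norm_sq)
  finally have gg: "Re (shifted m g g) \<le> C * L2_sq f" .
  have "(cmod (shifted m g f))\<^sup>2 \<le> Re (shifted m g g) * Re (shifted m f f)"
    by (rule shifted_Cauchy_Schwarz[of "D \<inter> orth E"])
      (use f gX nonneg orth_axpy[OF eigenvectors_L2[OF E]] axpy_D in auto)
  also have "\<dots> \<le> (C * L2_sq f) * Re (shifted m f f)"
    using gg nonneg f by (intro mult_right_mono) auto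
  also have "\<dots> < (C * L2_sq f) * (1 / C * L2_sq f)"
    using f C by (intro mult_strict_left_mono) auto
  also have "\<dots> = (L2_sq f)\<^sup>2" using C by (simp add: power2_eq_square)
  finally show False using gf by simp
qed

text \<open>
  A punctured neighbourhood of \<open>m\<close> that is free of spectrum keeps \<open>\<parallel>(H - m - \<delta>) f\<parallel> \<ge> \<delta> \<parallel>f\<parallel>\<close>:
  if the infimum \<open>\<eta>\<close> of the quotient were smaller than \<open>\<delta>\<close>, one of the points \<open>m + \<delta> \<plusminus> \<eta>\<close> would
  belong to the spectrum.
\<close>

lemma spectral_gap:
  assumes reg: "\<And>s. m < s \<Longrightarrow> s < m + 2 * \<delta> \<Longrightarrow> regular s"
    and "0 < \<delta>"
    and fk: "sol (m + \<delta>) f k"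
  shows "\<delta> * L2_norm f \<le> L2_norm k"
proof (cases "L2_sq f = 0")
  case True
  then show ?thesis by (simp add: L2_norm_sq)
next
  case False
  define s where "s = m + \<delta>"
  \<comment> \<open>\<open>S\<close> holds the quotients of \<open>||(H - s) f||^2\<close> and
    \<open>||f||^2\<close>, so that \<open>\<eta>\<close> plays the distance from \<open>s\<close>
    to the spectrum. If it were below \<open>\<delta>\<close>, both \<open>s + \<eta>\<close> and
    \<open>s - \<eta>\<close> would be regular.\<close>
  define S where "S = {L2_sq k / L2_sq f | f k. sol s f k \<and> L2_sq f \<noteq> 0}"
  have S0: "S \<noteq> {}" using fk False by (auto simp: S_def s_def)
  have bdd: "bdd_below S" by (intro bdd_belowI[of _ 0]) (auto simp: S_def)
  define \<eta> where "\<eta> = sqrt (Inf S)"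
  have InfS: "Inf S \<ge> 0" using S0 by (intro cInf_greatest) (auto simp: S_def)
  then have eta2: "\<eta>\<^sup>2 = Inf S" by (simp add: \<eta>_def)
  have low: "\<eta>\<^sup>2 * L2_sq f \<le> L2_sq k" if "sol s f k" for f k
  proof (cases "L2_sq f = 0")
    case False
    then have "Inf S \<le> L2_sq k / L2_sq f" using that bdd by (intro cInf_lower) (auto simp: S_def)
    moreover have "L2_sq f > 0" using False L2_sq_nonneg[of f] by linarith
    ultimately show ?thesis by (simp add: eta2 field_simps)
  qed simp
  have "\<delta> \<le> \<eta>"
  proof (rule ccontr)
    assume "\<not> \<delta> \<le> \<eta>"
    then have lt: "\<eta> < \<delta>" by simp
    have eta0: "0 \<le> \<eta>" using InfS by (simp add: \<eta>_def)
    have r1: "regular (s + \<eta>)" by (rule reg) (use lt eta0 in \<open>simp_all add: s_def\<close>)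
    have r2: "regular (s - \<eta>)" by (rule reg) (use lt eta0 in \<open>simp_all add: s_def\<close>)
    obtain C1 where C1: "C1 > 0" "\<And>f h. sol (s + \<eta>) f h \<Longrightarrow> L2_norm f \<le> C1 * L2_norm h"
      using regular_bound[OF r1] by blast
    obtain C2 where C2: "C2 > 0" "\<And>f h. sol (s - \<eta>) f h \<Longrightarrow> L2_norm f \<le> C2 * L2_norm h"
      using regular_bound[OF r2] by blast
    \<comment> \<open>The tolerance is the reciprocal of the bound \<open>C1 * C2\<close> for the
      inverse of \<open>(H - s)^2 - \<eta>^2\<close>, which makes the final inequality
      strict.\<close>
    define \<theta> where "\<theta> = 1 / (C1 * C2)"
    have \<theta>: "\<theta> > 0" using C1 C2 by (simp add: \<theta>_def)
    have "\<exists>x\<in>S. x < \<eta>\<^sup>2 + \<theta>"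
      using cInf_lessD[OF S0, of "\<eta>\<^sup>2 + \<theta>"] \<theta> eta2 by auto
    then obtain f k where f: "sol s f k" "L2_sq f \<noteq> 0" "L2_sq k / L2_sq f < \<eta>\<^sup>2 + \<theta>"
      by (auto simp: S_def)
    have F: "L2_sq f > 0" using f(2) L2_sq_nonneg[of f] by linarith
    have kf: "L2_sq k - \<eta>\<^sup>2 * L2_sq f < \<theta> * L2_sq f" using f(3) F by (simp add: field_simps)
    \<comment> \<open>Two resolvents in succession: \<open>g\<close> solves
      \<open>((H - s)^2 - \<eta>^2) g = f\<close>, and \<open>v\<close> is
      \<open>(H - s) g\<close>.\<close>
    obtain w where w: "sol (s + \<eta>) w f" using regular_solvable[OF r1] solD f by blast
    obtain g where g: "sol (s - \<eta>) g w" using regular_solvable[OF r2] solD w by blast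
    define v where "v = axpy w (of_real (- \<eta>)) g"
    have gv: "sol s g v" using sol_shift[OF g, of s] by (simp add: v_def)
    have L2: "f \<in> L2" "k \<in> L2" "w \<in> L2" "g \<in> L2" "v \<in> L2" "v \<in> D"
      using f w g gv solD axpy_D by (auto simp: v_def)
    \<comment> \<open>The equation for \<open>g\<close> in weak form: one factor
      \<open>H - s\<close> is moved to the test function \<open>\<phi>\<close>, whose image is
      \<open>\<kappa>\<close>.\<close>
    have key: "L2_inner v \<kappa> - of_real (\<eta>\<^sup>2) * L2_inner g \<phi> = L2_inner f \<phi>" if "sol s \<phi> \<kappa>" for \<phi> \<kappa>
    proof -
      have \<phi>: "\<phi> \<in> D" "\<phi> \<in> L2" using that solD by auto
      have "L2_inner v \<kappa> = cnj (shifted s \<phi> v)"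
        using solD(4)[OF that] L2 by (subst L2_inner_commute) simp
      also have "\<dots> = shifted s v \<phi>" using shifted_commute[of \<phi> v s] \<phi> L2 by simp
      also have "\<dots> = shifted s w \<phi> - of_real \<eta> * shifted s g \<phi>"
        using \<phi> w g solD by (simp add: v_def shifted_axpy)
      also have "shifted s w \<phi> = L2_inner f \<phi> + of_real \<eta> * L2_inner w \<phi>"
        using solD(4)[OF w \<phi>(1)] by (simp add: shifted_def algebra_simps)
      also have "shifted s g \<phi> = L2_inner w \<phi> - of_real \<eta> * L2_inner g \<phi>"
        using solD(4)[OF g \<phi>(1)] by (simp add: shifted_def algebra_simps)
      finally show ?thesis by (simp add: algebra_simps power2_eq_square)
    qed
    \<comment> \<open>Cauchy-Schwarz for the form \<open>||(H - s) g||^2 - \<eta>^2 ||g||^2\<close>,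
      nonnegative by \<open>low\<close>, applied to the pair \<open>g\<close>,
      \<open>f\<close>.\<close>
    have "(cmod (L2_inner v k - of_real (\<eta>\<^sup>2) * L2_inner g f))\<^sup>2
        \<le> (L2_sq v - \<eta>\<^sup>2 * L2_sq g) * (L2_sq k - \<eta>\<^sup>2 * L2_sq f)"
    proof (rule quadratic_nonneg_imp)
      fix c
      have "0 \<le> L2_sq (axpy v c k) - \<eta>\<^sup>2 * L2_sq (axpy g c f)"
        using low[OF sol_axpy[OF gv f(1)], of c] by simp
      then show "0 \<le> L2_sq v - \<eta>\<^sup>2 * L2_sq g
        + 2 * Re (cnj c * (L2_inner v k - of_real (\<eta>\<^sup>2) * L2_inner g f))
        + (cmod c)\<^sup>2 * (L2_sq k - \<eta>\<^sup>2 * L2_sq f)"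
        unfolding L2_sq_axpy[OF L2(5,2)] L2_sq_axpy[OF L2(4,1)]
        by (simp add: algebra_simps del: of_real_power)
    qed (use low[OF f(1)] in simp)
    also have "L2_inner v k - of_real (\<eta>\<^sup>2) * L2_inner g f = of_real (L2_sq f)"
      using key[OF f(1)] by (simp add: L2_inner_self)
    finally have CS: "(L2_sq f)\<^sup>2 \<le> (L2_sq v - \<eta>\<^sup>2 * L2_sq g) * (L2_sq k - \<eta>\<^sup>2 * L2_sq f)" by simp
    have "L2_sq v - \<eta>\<^sup>2 * L2_sq g = Re (L2_inner f g)"
      using arg_cong[OF key[OF gv], of Re] by (simp add: L2_inner_self del: of_real_power)
    also have "\<dots> \<le> L2_norm f * L2_norm g"
      using L2_inner_le_norms[OF L2(1,4)] complex_Re_le_cmod order_trans by blast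
    also have "\<dots> \<le> L2_norm f * (C2 * (C1 * L2_norm f))"
    proof (intro mult_left_mono)
      have "L2_norm g \<le> C2 * L2_norm w" by (rule C2(2)[OF g])
      also have "\<dots> \<le> C2 * (C1 * L2_norm f)" using C2(1) C1(2)[OF w] by simp
      finally show "L2_norm g \<le> C2 * (C1 * L2_norm f)" .
    qed simp
    also have "\<dots> = C1 * C2 * L2_sq f" by (simp add: L2_norm_sq)
    finally have vg: "L2_sq v - \<eta>\<^sup>2 * L2_sq g \<le> C1 * C2 * L2_sq f" .
    have "(L2_sq f)\<^sup>2 \<le> (C1 * C2 * L2_sq f) * (L2_sq k - \<eta>\<^sup>2 * L2_sq f)"
      using CS mult_right_mono[OF vg, of "L2_sq k - \<eta>\<^sup>2 * L2_sq f"] low[OF f(1)] by linarith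
    also have "\<dots> < (C1 * C2 * L2_sq f) * (\<theta> * L2_sq f)"
      using kf F C1 C2 by (intro mult_strict_left_mono) auto
    also have "\<dots> = (L2_sq f)\<^sup>2" using C1 C2 by (simp add: \<theta>_def power2_eq_square)
    finally show False by simp
  qed
  then have "\<delta> * L2_norm f \<le> \<eta> * L2_norm f" by (intro mult_right_mono) auto
  also have "\<dots> = sqrt (\<eta>\<^sup>2 * L2_sq f)"
    using InfS by (simp add: L2_norm_sq real_sqrt_mult \<eta>_def)
  also have "\<dots> \<le> L2_norm k"
    using low[of f k] fk by (simp add: L2_norm_sq s_def)
  finally show ?thesis .
qed

text \<open>Squaring the gap estimate yields \<open>(H - m)^2 >= 2 \<delta> (H - m)\<close>, the
  shape in which the gap enters the iteration.\<close>

lemma spectral_gap_quadratic: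
  assumes reg: "\<And>s. m < s \<Longrightarrow> s < m + 2 * \<delta> \<Longrightarrow> regular s"
    and "0 < \<delta>"
    and fh: "sol m f h"
  shows "2 * \<delta> * Re (L2_inner h f) \<le> L2_sq h"
proof -
  have "sol (m + \<delta>) f (axpy h (of_real (- \<delta>)) f)" using sol_shift[OF fh, of "m + \<delta>"] by simp
  from spectral_gap[OF reg _ this] have "\<delta> * L2_norm f \<le> L2_norm (axpy h (of_real (- \<delta>)) f)"
    using assms by blast
  then have "(\<delta> * L2_norm f)\<^sup>2 \<le> (L2_norm (axpy h (of_real (- \<delta>)) f))\<^sup>2"
    using assms by (intro power_mono) auto
  also have "\<dots> = L2_sq h - 2 * \<delta> * Re (L2_inner h f) + \<delta>\<^sup>2 * L2_sq f"
    using fh solD by (simp add: L2_sq_axpy)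
  finally show ?thesis by (simp add: power_mult_distrib)
qed

text \<open>On \<open>orth E\<close> the operator \<open>K\<close> is symmetric with
  \<open>0 <= K <= 1\<close>, and the gap keeps the rest of its values away from 1. The iterates
  \<open>K^n f\<close> therefore converge geometrically to a vector fixed by \<open>K\<close>, and
  \<open>f\<close> is chosen so close to minimizing that this vector cannot vanish.\<close>

lemma isolated_bottom_eigen:
  assumes E: "eigenvectors E"
    and nonneg: "\<And>f. f \<in> D \<inter> orth E \<Longrightarrow> 0 \<le> Re (shifted m f f)"
    and approx: "\<And>\<epsilon>. 0 < \<epsilon> \<Longrightarrow> \<exists>f\<in>D \<inter> orth E. 0 < L2_sq f \<and> Re (shifted m f f) < \<epsilon> * L2_sq f"
    and \<delta>: "0 < \<delta>"
    and reg: "\<And>s. m < s \<Longrightarrow> s < m + 2 * \<delta> \<Longrightarrow> regular s" "regular (m - \<delta>)"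
  shows "\<exists>p\<in>orth E. p \<noteq> (\<lambda>_. 0) \<and> sol m p (\<lambda>_. 0)"
proof -
  have EL: "E \<subseteq> L2" by (rule eigenvectors_L2[OF E])
  define sc where "sc f = (\<lambda>x. complex_of_real \<delta> * f x)" for f :: "real \<Rightarrow> complex"
  have scL2: "sc f \<in> L2" if "f \<in> L2" for f using that by (simp add: sc_def scale_L2)
  have sc_inner: "L2_inner (sc f) g = of_real \<delta> * L2_inner f g" if "f \<in> L2" "g \<in> L2" for f g
    using that by (simp add: sc_def L2_inner_scale)
  have sc_sq: "L2_sq (sc f) = \<delta>\<^sup>2 * L2_sq f" for f
    by (simp add: L2_sq_def sc_def norm_mult power_mult_distrib)
  \<comment> \<open>\<open>K\<close> is picked pointwise; uniqueness of solutions at the regular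
    point \<open>m - \<delta>\<close> is what makes it linear.\<close>
  define K where "K f = (SOME g. sol (m - \<delta>) g (sc f))" for f
  have Ksol: "sol (m - \<delta>) (K f) (sc f)" if "f \<in> L2" for f
    unfolding K_def by (rule someI_ex[OF regular_solvable[OF reg(2) scL2[OF that]]])
  have KD: "K f \<in> D" "K f \<in> L2" if "f \<in> L2" for f using Ksol[OF that] solD by auto
  have K_axpy: "K (axpy f c g) = axpy (K f) c (K g)" if "f \<in> L2" "g \<in> L2" for f g c
  proof (rule sol_unique[OF reg(2)])
    show "sol (m - \<delta>) (K (axpy f c g)) (sc (axpy f c g))" using that by (intro Ksol L2_axpy)
    have "sc (axpy f c g) = axpy (sc f) c (sc g)" by (auto simp: sc_def axpy_def algebra_simps)
    then show "sol (m - \<delta>) (axpy (K f) c (K g)) (sc (axpy f c g))"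
      using sol_axpy[OF Ksol[OF that(1)] Ksol[OF that(2)], of c] by simp
  qed
  have orthL2: "f \<in> L2" if "f \<in> orth E" for f using that by (simp add: orth_def)
  have scorth: "sc f \<in> orth E" if "f \<in> orth E" for f
    using that EL by (auto simp: orth_def sc_inner scL2 subset_iff)
  have Korth: "K f \<in> orth E" if "f \<in> orth E" for f
    by (rule sol_orth[OF E reg(2) Ksol[OF orthL2[OF that]] scorth[OF that]])
  define X where "X f = axpy f (-1) (K f)" for f
  have XL2: "X f \<in> L2" if "f \<in> L2" for f using that by (simp add: X_def L2_axpy KD)
  have Xorth: "X f \<in> orth E" if "f \<in> orth E" for f
    using that by (simp add: X_def orth_axpy[OF EL] Korth)
  have KX: "K (X f) = X (K f)" if "f \<in> L2" for f
    using that by (simp add: X_def K_axpy KD)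
  have Kshift: "sol m (K f) (sc (X f))" if "f \<in> L2" for f
  proof -
    have "axpy (sc f) (of_real (m - \<delta> - m)) (K f) = sc (X f)"
      by (auto simp: axpy_def sc_def X_def algebra_simps)
    then show ?thesis using sol_shift[OF Ksol[OF that], of m] by simp
  qed
  have Kform: "shifted (m - \<delta>) (K f) g = of_real \<delta> * L2_inner f g" if "f \<in> L2" "g \<in> D" for f g
    using solD(4)[OF Ksol[OF that(1)] that(2)] that D_L2 by (simp add: sc_inner)
  have Ksym: "L2_inner (K f) g = L2_inner f (K g)" if "f \<in> L2" "g \<in> L2" for f g
  proof -
    have "of_real \<delta> * L2_inner f (K g) = shifted (m - \<delta>) (K f) (K g)"
      using that by (simp add: Kform KD)
    also have "\<dots> = cnj (shifted (m - \<delta>) (K g) (K f))"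
      using that shifted_commute[of "K g" "K f"] by (simp add: KD)
    also have "\<dots> = of_real \<delta> * L2_inner (K f) g"
      using that by (simp add: Kform KD L2_inner_commute[of "K f" g])
    finally show ?thesis using \<delta> by simp
  qed
  have shm: "Re (shifted (m - \<delta>) f f) = Re (shifted m f f) + \<delta> * L2_sq f" if "f \<in> D" for f
    using that by (simp add: Re_shifted_self algebra_simps)
  \<comment> \<open>In operator terms \<open>K^2 <= K\<close>: \<open>K\<close> inverts
    \<open>1 + (H - m) / \<delta>\<close>, which is at least 1 on \<open>orth E\<close>.\<close>
  have Kpos: "L2_sq (K f) \<le> Re (L2_inner f (K f))" if "f \<in> orth E" for f
  proof -
    have L: "f \<in> L2" by (rule orthL2[OF that])
    have "\<delta> * Re (L2_inner f (K f)) = Re (shifted (m - \<delta>) (K f) (K f))"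
      using L by (simp add: Kform KD)
    also have "\<dots> \<ge> \<delta> * L2_sq (K f)"
      using nonneg[of "K f"] KD[OF L] Korth[OF that] by (simp add: shm)
    finally show ?thesis using \<delta> by simp
  qed
  have Xsq: "L2_sq (X f) = L2_sq f - 2 * Re (L2_inner f (K f)) + L2_sq (K f)" if "f \<in> L2" for f
    using that unfolding X_def by (subst L2_sq_axpy) (auto simp: KD)
  have Xle: "L2_sq (X f) \<le> L2_sq f - Re (L2_inner f (K f))" if "f \<in> orth E" for f
    using Xsq[OF orthL2[OF that]] Kpos[OF that] by linarith
  have Xcontr: "L2_sq (X f) \<le> L2_sq f" if "f \<in> orth E" for f
    using Xle[OF that] Kpos[OF that] L2_sq_nonneg[of "K f"] by linarith
  have Kcontr: "L2_norm (K f) \<le> L2_norm f" if "f \<in> orth E" for f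
  proof -
    have "L2_sq (K f) \<le> L2_sq f"
      using Xle[OF that] Kpos[OF that] L2_sq_nonneg[of "X f"] by linarith
    then show ?thesis by (simp add: L2_norm_sq)
  qed
  \<comment> \<open>\<open>B\<close> is the form of \<open>K (1 - K)\<close>. Then
    \<open>B_half\<close> reads \<open>2 K (1 - K) <= (1 - K)^2\<close>; it is the gap inequality
    for \<open>(H - m) (K f) = \<delta> X f\<close>.\<close>
  define B where "B f g = L2_inner (X f) (K g)" for f g
  have B_half: "2 * Re (B f f) \<le> L2_sq (X f)" if "f \<in> orth E" for f
  proof -
    have L: "f \<in> L2" by (rule orthL2[OF that])
    have "2 * \<delta> * Re (L2_inner (sc (X f)) (K f)) \<le> L2_sq (sc (X f))"
      by (rule spectral_gap_quadratic[OF reg(1) \<delta> Kshift[OF L]])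
    then have "\<delta>\<^sup>2 * (2 * Re (B f f)) \<le> \<delta>\<^sup>2 * L2_sq (X f)"
      using L by (simp add: sc_sq sc_inner XL2 KD B_def power2_eq_square algebra_simps)
    then show ?thesis using \<delta> by simp
  qed
  have B_nonneg: "0 \<le> Re (B f f)" if "f \<in> orth E" for f
    using Kpos[OF that] orthL2[OF that]
    by (simp add: B_def X_def L2_inner_axpy KD L2_inner_self)
  have B_axpy: "Re (B (axpy f c g) (axpy f c g)) = 
      Re (B f f) + 2 * Re (cnj c * B f g) + (cmod c)\<^sup>2 * Re (B g g)" if "f \<in> L2" "g \<in> L2" for f g c
  proof -
    have Bc: "B g f = cnj (B f g)"
    proof -
      have "B g f = L2_inner g (K f) - L2_inner (K g) (K f)"
        using that by (simp add: B_def X_def L2_inner_axpy KD)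
      also have "L2_inner g (K f) = L2_inner (K g) f" using that by (simp add: Ksym)
      also have "L2_inner (K g) f - L2_inner (K g) (K f) = L2_inner (K g) (X f)"
        using that by (simp add: X_def L2_inner_axpy_right KD)
      finally show ?thesis by (simp add: B_def L2_inner_commute[of "K g"])
    qed
    have "X (axpy f c g) = axpy (X f) c (X g)"
      using that by (auto simp: X_def K_axpy) (auto simp: axpy_def algebra_simps)
    then have "B (axpy f c g) (axpy f c g) = B f f + (cnj c * B f g + cnj (cnj c * B f g)) + (c * cnj c) * B g g"
      using that by (simp add: B_def K_axpy L2_inner_axpy L2_inner_axpy_right KD XL2 L2_axpy
        algebra_simps Bc[unfolded B_def])
    moreover have "c * cnj c = of_real ((cmod c)\<^sup>2)" by (rule complex_norm_square[symmetric])
    ultimately have "B (axpy f c g) (axpy f c g) = B f f + (cnj c * B f g + cnj (cnj c * B f g)) + of_real ((cmod c)\<^sup>2) * B g g"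
      by simp
    then show ?thesis by (simp del: complex_cnj_mult of_real_power)
  qed
  \<comment> \<open>As \<open>K\<close> commutes with \<open>X\<close>, \<open>B f z\<close> equals
    \<open>||z||^2\<close>. Cauchy-Schwarz for \<open>B\<close>, with a factor 1/2 from
    \<open>B_half\<close> for each argument, gives \<open>||z||^2 <= ||X f||^2 / 4\<close>.\<close>
  have step: "L2_norm (X (K f)) \<le> 1 / 2 * L2_norm (X f)" if f: "f \<in> orth E" for f
  proof -
    define z where "z = X (K f)"
    have z: "z \<in> orth E" using f by (simp add: z_def Xorth Korth)
    have L: "f \<in> L2" "z \<in> L2" using f z orthL2 by auto
    have Bfz: "B f z = of_real (L2_sq z)"
    proof -
      have "B f z = L2_inner (K (X f)) z" using L by (simp add: B_def Ksym XL2)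
      then show ?thesis using L by (simp add: KX z_def L2_inner_self)
    qed
    have "(cmod (B f z))\<^sup>2 \<le> Re (B f f) * Re (B z z)"
    proof (rule quadratic_nonneg_imp)
      show "0 \<le> Re (B f f) + 2 * Re (cnj c * B f z) + (cmod c)\<^sup>2 * Re (B z z)" for c
        using B_nonneg[OF orth_axpy[OF EL f z, of c]] B_axpy[OF L, of c] by simp
    qed (rule B_nonneg[OF z])
    also have "\<dots> \<le> (L2_sq (X f) / 2) * (L2_sq z / 2)"
      using B_half[OF f] B_half[OF z] Xcontr[OF z] B_nonneg[OF f] B_nonneg[OF z]
      by (intro mult_mono) auto
    finally have "L2_sq z * L2_sq z \<le> L2_sq (X f) / 4 * L2_sq z"
      by (simp add: Bfz power2_eq_square)
    then have "L2_sq z \<le> L2_sq (X f) / 4"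
      using L2_sq_nonneg[of z] L2_sq_nonneg[of "X f"] by (cases "L2_sq z = 0") auto
    then have "sqrt (L2_sq z) \<le> sqrt (L2_sq (X f) / 4)" by simp
    then show ?thesis by (simp add: L2_norm_sq z_def real_sqrt_divide)
  qed
  obtain f where f: "f \<in> D" "f \<in> orth E" "0 < L2_sq f" 
      and fm: "Re (shifted m f f) < \<delta> / 24 * L2_sq f"
    using approx[of "\<delta> / 24"] \<delta> by auto
  have fL: "f \<in> L2" using f orthL2 by blast
  \<comment> \<open>The tolerance 1/24 yields \<open>24/25 ||f||^2 <= <f, K f>\<close>, hence
    \<open>||X f|| <= ||f|| / 5\<close>. Since \<open>||X (q n)||\<close> at least halves at each
    step, the total drift is at most \<open>2 ||X f|| <= 2/5 ||f||\<close>, and the limit keeps more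
    than half of the norm.\<close>
  have start: "5 * L2_norm (X f) \<le> L2_norm f"
  proof -
    define F r where "F = L2_sq f" and "r = Re (L2_inner f (K f))"
    have r0: "0 \<le> r" using Kpos[OF f(2)] L2_sq_nonneg[of "K f"] unfolding r_def by linarith
    have "(cmod (shifted (m - \<delta>) (K f) f))\<^sup>2
        \<le> Re (shifted (m - \<delta>) (K f) (K f)) * Re (shifted (m - \<delta>) f f)"
    proof (rule shifted_Cauchy_Schwarz[of "D \<inter> orth E"])
      show "0 \<le> Re (shifted (m - \<delta>) g g)" if "g \<in> D \<inter> orth E" for g
        using that nonneg[of g] \<delta> by (simp add: shm)
    qed (use f fL KD Korth axpy_D orth_axpy[OF EL] in auto)
    also have "cmod (shifted (m - \<delta>) (K f) f) = \<delta> * F"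
      using fL f \<delta> by (simp add: Kform L2_inner_self F_def norm_mult)
    also have "Re (shifted (m - \<delta>) (K f) (K f)) = \<delta> * r"
      using fL by (simp add: Kform KD r_def)
    also have "\<delta> * r * Re (shifted (m - \<delta>) f f) \<le> \<delta> * r * (25 / 24 * \<delta> * F)"
      using fm f \<delta> r0 by (intro mult_left_mono) (auto simp: shm F_def)
    finally have "(\<delta> * \<delta> * F) * F \<le> (\<delta> * \<delta> * F) * (25 / 24 * r)"
      by (simp add: power2_eq_square algebra_simps)
    then have "F \<le> 25 / 24 * r" using f \<delta> by (simp add: F_def)
    then have "25 * L2_sq (X f) \<le> F" using Xle[OF f(2)] by (simp add: F_def r_def)
    then have "sqrt (25 * L2_sq (X f)) \<le> sqrt F" by (rule real_sqrt_le_mono)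
    then show ?thesis by (simp add: real_sqrt_mult L2_norm_sq F_def)
  qed
  define q where "q n = (K ^^ n) f" for n
  have q0: "q 0 = f" and qS: "q (Suc n) = K (q n)" for n by (simp_all add: q_def)
  have qo: "q n \<in> orth E" for n by (induction n) (auto simp: q0 qS f Korth)
  have qL: "q n \<in> L2" for n using qo orthL2 by blast
  have Xq: "L2_norm (X (q n)) \<le> L2_norm (X f) * (1/2)^n" for n
  proof (induction n)
    case (Suc n)
    then show ?case using step[OF qo[of n]] by (simp add: qS)
  qed (simp add: q0)
  have "L2_norm (axpy (q (Suc n)) (-1) (q n)) = L2_norm (X (q n))" for n
    by (simp add: L2_norm_def X_def axpy_def qS norm_minus_commute)
  then obtain p where p: "p \<in> L2" and plim: "(\<lambda>n. L2_norm (axpy p (-1) (q n))) \<longlonglongrightarrow> 0"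
    using L2_geometric_limit[of q "L2_norm (X f)"] qL Xq by auto
  have po: "p \<in> orth E"
  proof -
    have "L2_inner p e = 0" if "e \<in> E" for e
    proof -
      have e: "e \<in> L2" using that EL by auto
      have "cmod (L2_inner p e) \<le> L2_norm (axpy p (-1) (q n)) * L2_norm e" for n
      proof -
        have "L2_inner p e = L2_inner (axpy p (-1) (q n)) e"
          using qo[of n] that by (simp add: L2_inner_axpy p qL e orth_def)
        then show ?thesis using L2_inner_le_norms[of "axpy p (-1) (q n)" e] p qL e by (simp add: L2_axpy)
      qed
      moreover have "(\<lambda>n. L2_norm (axpy p (-1) (q n)) * L2_norm e) \<longlonglongrightarrow> 0"
        by (rule tendsto_mult_left_zero[OF plim])
      ultimately have "cmod (L2_inner p e) \<le> 0"
        by (intro LIMSEQ_le_const[of "\<lambda>n. L2_norm (axpy p (-1) (q n)) * L2_norm e"]) auto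
      then show ?thesis by simp
    qed
    then show ?thesis using p by (simp add: orth_def)
  qed
  have Xp: "L2_norm (X p) = 0"
  proof -
    have "L2_norm (X p) \<le> L2_norm (axpy p (-1) (q (Suc n))) + L2_norm (axpy p (-1) (q n))" for n
    proof -
      have "X p = axpy (axpy p (-1) (q (Suc n))) (-1) (K (axpy p (-1) (q n)))"
        by (simp add: K_axpy p qL qS X_def) (auto simp: axpy_def)
      then have "L2_norm (X p) \<le> L2_norm (axpy p (-1) (q (Suc n))) + L2_norm (K (axpy p (-1) (q n)))"
        using L2_norm_axpy[of "axpy p (-1) (q (Suc n))" "K (axpy p (-1) (q n))" "-1"] p qL
        by (simp add: KD L2_axpy)
      then show ?thesis using Kcontr[OF orth_axpy[OF EL po qo[of n], of "-1"]] by linarith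
    qed
    moreover have "(\<lambda>n. L2_norm (axpy p (-1) (q (Suc n))) + L2_norm (axpy p (-1) (q n))) \<longlonglongrightarrow> 0"
      using tendsto_add[OF LIMSEQ_Suc[OF plim] plim] by simp
    ultimately have "L2_norm (X p) \<le> 0"
      by (intro LIMSEQ_le_const[of "\<lambda>n. L2_norm (axpy p (-1) (q (Suc n))) + L2_norm (axpy p (-1) (q n))"]) auto
    then show ?thesis using L2_norm_nonneg[of "X p"] by linarith
  qed
  have qlow: "L2_norm f - (2 - 2 * (1/2)^n) * L2_norm (X f) \<le> L2_norm (q n)" for n
  proof (induction n)
    case (Suc n)
    have "q n = axpy (q (Suc n)) 1 (X (q n))" by (auto simp: qS X_def axpy_def)
    then have "L2_norm (q n) \<le> L2_norm (q (Suc n)) + L2_norm (X (q n))"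
      using L2_norm_axpy[OF qL[of "Suc n"] XL2[OF qL[of n]], of 1] by simp
    then show ?case using Suc Xq[of n] by (simp add: algebra_simps)
  qed (simp add: q0)
  have fpos: "0 < L2_norm f" using f by (simp add: L2_norm_sq)
  have plow: "L2_norm f / 2 \<le> L2_norm p + L2_norm (axpy p (-1) (q n))" for n
  proof -
    have "q n = axpy p (-1) (axpy p (-1) (q n))" by (auto simp: axpy_def)
    then have "L2_norm (q n) \<le> L2_norm p + L2_norm (axpy p (-1) (q n))"
      using L2_norm_axpy[OF p L2_axpy[OF p qL[of n], of "-1"], of "-1"] by simp
    moreover have "(2 - 2 * (1/2)^n) * L2_norm (X f) \<le> 2 * L2_norm (X f)"
      by (intro mult_right_mono) auto
    ultimately show ?thesis using qlow[of n] start fpos by linarith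
  qed
  have "(\<lambda>n. L2_norm p + L2_norm (axpy p (-1) (q n))) \<longlonglongrightarrow> L2_norm p + 0"
    by (intro tendsto_intros plim)
  then have "L2_norm f / 2 \<le> L2_norm p" using plow by (intro LIMSEQ_le_const[of _ "L2_norm p"]) auto
  then have ppos: "0 < L2_norm p" using fpos by linarith
  \<comment> \<open>The limit \<open>p\<close> is just some representative of its class;
    \<open>K p\<close> agrees with it almost everywhere and lies in \<open>D\<close>.\<close>
  have "sol m (K p) (\<lambda>_. 0)"
  proof -
    have "L2_inner (sc (X p)) g = 0" if "g \<in> D" for g
    proof -
      have "cmod (L2_inner (X p) g) \<le> 0"
        using L2_inner_le_norms[OF XL2[OF p] D_L2[OF that]] Xp by simp
      then show ?thesis using that by (simp add: sc_inner XL2 p D_L2)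
    qed
    then show ?thesis using Kshift[OF p] by (auto simp: sol_def zero_L2)
  qed
  moreover have "K p \<noteq> (\<lambda>_. 0)"
  proof
    assume "K p = (\<lambda>_. 0)"
    then have "X p = p" by (simp add: X_def axpy_def)
    then show False using Xp ppos by simp
  qed
  ultimately show ?thesis using Korth[OF po] by blast
qed

end

section \<open>Eigenvalue counting\<close>

text \<open>Gaussian elimination, by induction on the equations: an unknown \<open>k\<close> with
  nonzero coefficient in equation \<open>i\<close> is solved for and substituted into the
  others.\<close>

lemma homogeneous_system_nontrivial:
  fixes A :: "'i \<Rightarrow> 'j \<Rightarrow> complex"
  assumes "finite I" "finite J" "card I < card J"
  shows "\<exists>c. (\<exists>j\<in>J. c j \<noteq> 0) \<and> (\<forall>i\<in>I. (\<Sum>j\<in>J. c j * A i j) = 0)"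
  using assms
proof (induction I arbitrary: A J rule: finite_induct)
  case empty
  then obtain j where "j \<in> J" by fastforce
  then show ?case by (intro exI[of _ "\<lambda>_. 1"]) auto
next
  case (insert i I)
  show ?case
  proof (cases "\<forall>j\<in>J. A i j = 0")
    case True
    have "card I < card J" using insert.hyps insert.prems by simp
    from insert.IH[OF insert.prems(1) this, of A]
    obtain c where c: "\<exists>j\<in>J. c j \<noteq> 0" "\<forall>i\<in>I. (\<Sum>j\<in>J. c j * A i j) = 0"
      by blast
    moreover have "(\<Sum>j\<in>J. c j * A i j) = 0" using True by simp
    ultimately show ?thesis by (intro exI[of _ c]) auto
  next
    case False
    then obtain k where k: "k \<in> J" "A i k \<noteq> 0" by blast
    define A' where "A' r j = A r j - A r k * A i j / A i k" for r j
    have "card I < card (J - {k})" using insert k by (simp add: card_Diff_singleton)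
    from insert.IH[OF _ this, of A'] obtain c' where c': "\<exists>j\<in>J - {k}. c' j \<noteq> 0" "\<And>r. r \<in> I \<Longrightarrow> (\<Sum>j\<in>J - {k}. c' j * A' r j) = 0"
      using insert.prems(1) by auto
    define S where "S r = (\<Sum>j\<in>J - {k}. c' j * A r j)" for r
    define c where "c = c'(k := - S i / A i k)"
    have split: "(\<Sum>j\<in>J. c j * A r j) = - S i / A i k * A r k + S r" for r
      using insert k by (simp add: sum.remove[of J k] c_def S_def)
    have "S r = A r k * S i / A i k" if "r \<in> I" for r
      using c'(2)[OF that] 
      by (simp add: A'_def S_def algebra_simps sum_subtractf sum_distrib_left sum_divide_distrib)
    then have "(\<Sum>j\<in>J. c j * A r j) = 0" if "r \<in> insert i I" for r
      using that k split[of r] by auto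
    moreover have "\<exists>j\<in>J. c j \<noteq> 0" using c'(1) by (auto simp: c_def)
    ultimately show ?thesis by (intro exI[of _ c]) auto
  qed
qed

definition lin_comb :: "'j set \<Rightarrow> ('j \<Rightarrow> complex) \<Rightarrow> ('j \<Rightarrow> real \<Rightarrow> complex) \<Rightarrow> real \<Rightarrow> complex" where
  "lin_comb J c e = (\<lambda>x. \<Sum>j\<in>J. c j * e j x)"

lemma lin_comb_empty [simp]: "lin_comb {} c e = (\<lambda>_. 0)"
  by (simp add: lin_comb_def)

lemma lin_comb_insert:
  "finite J \<Longrightarrow> j \<notin> J \<Longrightarrow> lin_comb (insert j J) c e = axpy (lin_comb J c e) (c j) (e j)"
  by (auto simp: lin_comb_def axpy_def add.commute)

lemma lin_comb_closed:
  assumes "finite J" "(\<lambda>_. 0) \<in> V" "\<And>f c g. f \<in> V \<Longrightarrow> g \<in> V \<Longrightarrow> axpy f c g \<in> V"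
    and "\<And>j. j \<in> J \<Longrightarrow> e j \<in> V"
  shows "lin_comb J c e \<in> V"
  using assms(1,4) by (induction J rule: finite_induct) (auto simp: lin_comb_insert assms)

lemma lin_comb_linear:
  fixes \<phi> :: "(real \<Rightarrow> complex) \<Rightarrow> complex"
  assumes "finite J" "(\<lambda>_. 0) \<in> V" "\<And>f c g. f \<in> V \<Longrightarrow> g \<in> V \<Longrightarrow> axpy f c g \<in> V"
    and "\<And>j. j \<in> J \<Longrightarrow> e j \<in> V"
    and lin: "\<And>f c g. f \<in> V \<Longrightarrow> g \<in> V \<Longrightarrow> \<phi> (axpy f c g) = \<phi> f + c * \<phi> g"
  shows "\<phi> (lin_comb J c e) = (\<Sum>j\<in>J. c j * \<phi> (e j))"
  using assms(1,4)
proof (induction J rule: finite_induct)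
  case empty
  have "axpy (\<lambda>_. 0) 1 (\<lambda>_. 0) = (\<lambda>_. 0)" by (simp add: axpy_def)
  then show ?case using lin[OF assms(2,2), of 1] by simp
next
  case (insert j J)
  have "lin_comb J c e \<in> V"
    by (rule lin_comb_closed[OF insert.hyps(1) assms(2,3)]) (use insert.prems in auto)
  then show ?case using insert by (simp add: lin_comb_insert lin)
qed

text \<open>Links sums over index sets with the vector space in which \<open>cfun.span\<close> and
  \<open>cfun.independent\<close> are formulated.\<close>

lemma lin_comb_cfun: "finite B \<Longrightarrow> (\<Sum>v\<in>B. (\<lambda>x. u v * v x)) = lin_comb B u (\<lambda>v. v)"
  by (induction B rule: finite_induct) (auto simp: lin_comb_def zero_fun_def plus_fun_def fun_eq_iff)

context semibounded_form
begin

lemma sol_zero_axpy: "sol s f (\<lambda>_. 0) \<Longrightarrow> sol s g (\<lambda>_. 0) \<Longrightarrow> sol s (axpy f c g) (\<lambda>_. 0)"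
  using sol_axpy[of s f "\<lambda>_. 0" g "\<lambda>_. 0" c] by (simp add: axpy_def)

lemma sol_zero: "sol s (\<lambda>_. 0) (\<lambda>_. 0)"
proof -
  have "shifted s (\<lambda>_. 0) g = 0" if "g \<in> D" for g
    using shifted_axpy[OF zero_D zero_D that, of s 1] by (simp add: axpy_def)
  then show ?thesis by (simp add: sol_def zero_D zero_L2)
qed

lemma eigen_orthogonal:
  assumes "sol s f (\<lambda>_. 0)" "sol t g (\<lambda>_. 0)" "s \<noteq> t"
  shows "L2_inner f g = 0"
proof -
  have fg: "f \<in> D" "g \<in> D" using assms solD by auto
  have "shifted s f g = 0" "shifted t g f = 0" using assms fg solD(4) by fastforce+
  then have "shifted s f g = 0" "shifted t f g = 0" using shifted_commute[of g f t] fg by auto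
  then have "of_real s * L2_inner f g = of_real t * L2_inner f g"
    by (metis eq_iff_diff_eq_0 shifted_def)
  then show ?thesis using assms(3) by auto
qed

lemma eigenvalue_sequence_mono:
  "negative_eigenvalue_sequence H lam \<Longrightarrow> 1 \<le> j \<Longrightarrow> j \<le> k \<Longrightarrow> lam j \<le> lam k"
  using mono_onD[of "{1..}" lam j k] by (simp add: negative_eigenvalue_sequence_def)

lemma eigenvalue_iff: "op_eigenvalue H (of_real t) \<longleftrightarrow> (\<exists>f. sol t f (\<lambda>_. 0) \<and> f \<noteq> (\<lambda>_. 0))"
  by (auto simp: op_eigenvalue_def eigenspace_iff_sol)

lemma D_sq_pos: "f \<in> D \<Longrightarrow> f \<noteq> (\<lambda>_. 0) \<Longrightarrow> 0 < L2_sq f"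
  using D_definite[of f] L2_sq_nonneg[of f] by (metis order_le_less)

lemma eigenspace_basis:
  obtains B where "B \<subseteq> op_eigenspace H (of_real t)" "cfun.independent B"
    "op_eigenspace H (of_real t) \<subseteq> cfun.span B" "card B = eigen_multiplicity H (of_real t)"
  using cfun.basis_exists[of "op_eigenspace H (of_real t)"] unfolding eigen_multiplicity_def by blast

lemma eigenvalue_in_discrete_spectrum:
  assumes "negative_spectrum_discrete H" "t < 0" "op_eigenvalue H (of_real t)"
  shows "complex_of_real t \<in> discrete_spectrum H"
  using assms not_regular_eigen
  by (auto simp: negative_spectrum_discrete_def op_spectrum_def eigenvalue_iff)

text \<open>Hence a negative term of the eigenvalue sequence can never be its continuation value and
  must be an eigenvalue.\<close>

lemma inf_essential_spectrum_nonneg: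
  assumes "negative_spectrum_discrete H"
  shows "0 \<le> inf_essential_spectrum H"
  unfolding inf_essential_spectrum_def
proof (rule Inf_greatest)
  fix z assume "z \<in> {ereal t | t. complex_of_real t \<in> essential_spectrum H}"
  then obtain t where t: "z = ereal t" "complex_of_real t \<in> essential_spectrum H" by blast
  then have "\<not> t < 0" using assms by (auto simp: essential_spectrum_def negative_spectrum_discrete_def)
  then show "0 \<le> z" using t by simp
qed

text \<open>The constraints are linear functionals on \<open>D\<close> rather than inner products,
  because point evaluations, to which this is applied, are not given by L2 functions. If the term
  were below \<open>- l\<close>, the eigenspaces of the first \<open>n\<close> terms would contain a
  nonzero function that meets all constraints and has a quotient strictly below
  \<open>- l\<close>.\<close>

lemma eigenvalue_sequence_ge:
  assumes disc: "negative_spectrum_discrete H" and seq: "negative_eigenvalue_sequence H lam"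
    and l: "0 < l" and n: "1 \<le> n"
    and I: "finite I" "card I < n"
    and lin: "\<And>i f c g. i \<in> I \<Longrightarrow> f \<in> D \<Longrightarrow> g \<in> D \<Longrightarrow> \<phi> i (axpy f c g) = \<phi> i f + c * \<phi> i g"
    and coercive: "\<And>f. f \<in> D \<Longrightarrow> (\<And>i. i \<in> I \<Longrightarrow> \<phi> i f = (0::complex)) \<Longrightarrow> - l * L2_sq f \<le> Re (a f f)"
  shows "ereal (- l) \<le> lam n"
proof (rule ccontr)
  assume "\<not> ereal (- l) \<le> lam n"
  then have less: "lam n < ereal (- l)" by simp
  have lt: "lam k < ereal (- l)" if "k \<in> {1..n}" for k
  proof -
    have "lam k \<le> lam n"
      using eigenvalue_sequence_mono[OF seq] that by simp
    then show ?thesis using less by (rule le_less_trans)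
  qed
  define r where "r k = real_of_ereal (lam k)" for k
  have ev: "lam k = ereal (r k) \<and> op_eigenvalue H (of_real (r k)) \<and> r k < - l" if kn: "k \<in> {1..n}" for k
  proof -
    have "lam k < 0" 
      by (rule less_le_trans[OF lt[OF kn]]) (use l in simp)
    then have "lam k \<noteq> inf_essential_spectrum H"
      using inf_essential_spectrum_nonneg[OF disc] by auto
    then obtain t where "op_eigenvalue H (complex_of_real t)" "lam k = ereal t"
      using seq kn unfolding negative_eigenvalue_sequence_def atLeastAtMost_iff by blast
    then show ?thesis using lt[OF kn] by (simp add: r_def)
  qed
  define T where "T = r ` {1..n}"
  have finT: "finite T" by (simp add: T_def)
  have T: "op_eigenvalue H (of_real t)" "t < - l" if "t \<in> T" for t
    using ev that by (auto simp: T_def)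
  have "\<exists>B. B \<subseteq> op_eigenspace H (of_real t) \<and> cfun.independent B \<and> card B = eigen_multiplicity H (of_real t)" for t
    by (metis eigenspace_basis)
  then obtain B where B: "\<And>t. B t \<subseteq> op_eigenspace H (of_real t)" "\<And>t. cfun.independent (B t)"
      "\<And>t. card (B t) = eigen_multiplicity H (of_real t)" by metis
  \<comment> \<open>\<open>N t\<close> collects all indices with value \<open>t\<close>, also those
    beyond \<open>n\<close>, because the sequence matches full multiplicities. The dimension
    obtained may exceed \<open>n\<close> but is never smaller.\<close>
  define N where "N t = {k. 1 \<le> k \<and> lam k = ereal t}" for t
  have N: "finite (N t)" "card (N t) = card (B t)" if "t \<in> T" for t
    using seq T[OF that] l unfolding negative_eigenvalue_sequence_def N_def B(3) by auto
  \<comment> \<open>\<open>card\<close> is 0 for infinite sets; an index in \<open>N t\<close> makes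
    the common cardinality positive, so \<open>B t\<close> is finite.\<close>
  have finB: "finite (B t)" if t: "t \<in> T" for t
  proof -
    obtain k where "k \<in> {1..n}" "t = r k" using t by (auto simp: T_def)
    then have "k \<in> N t" using ev by (auto simp: N_def)
    then have "card (N t) \<noteq> 0" using N(1)[OF t] by auto
    then show ?thesis using N(2)[OF t] card_ge_0_finite by force
  qed
  define J where "J = Sigma T B"
  have "n = card {1..n}" by simp
  also have "\<dots> \<le> card (\<Union>t\<in>T. N t)"
    using finT N(1) ev by (intro card_mono) (auto simp: N_def T_def)
  also have "\<dots> \<le> (\<Sum>t\<in>T. card (N t))" by (rule card_UN_le[OF finT])
  also have "\<dots> = card J" using finT finB N(2) by (simp add: J_def)
  finally have J: "card I < card J" using I by simp
  have finJ: "finite J" using finT finB by (auto simp: J_def)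
  from homogeneous_system_nontrivial[OF I(1) finJ J, of "\<lambda>i j. \<phi> i (snd j)"]
  obtain c where c: "(\<exists>j\<in>J. c j \<noteq> 0) \<and> (\<forall>i\<in>I. (\<Sum>j\<in>J. c j * \<phi> i (snd j)) = 0)" ..
  define f where "f t = lin_comb (B t) (\<lambda>e. c (t, e)) (\<lambda>e. e)" for t
  have Bsol: "sol t e (\<lambda>_. 0)" if "e \<in> B t" for t e
    using B(1)[of t] that eigenspace_iff_sol by blast
  have fsol: "sol t (f t) (\<lambda>_. 0)" if "t \<in> T" for t
    using lin_comb_closed[OF finB[OF that], of "{g. sol t g (\<lambda>_. 0)}" "\<lambda>e. e"] Bsol[of _ t] sol_zero sol_zero_axpy
    by (auto simp: f_def)
  have fD: "f t \<in> D" if "t \<in> T" for t using fsol[OF that] solD by blast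
  \<comment> \<open>Grouping by eigenvalue: the parts \<open>f t\<close> are mutually orthogonal, so
    both the form and the squared norm of \<open>g\<close> become sums over
    \<open>T\<close>.\<close>
  define g where "g = lin_comb T (\<lambda>_. 1) f"
  have gD: "g \<in> D" unfolding g_def by (rule lin_comb_closed[OF finT zero_D axpy_D fD])
  have g_linear: "\<psi> g = (\<Sum>t\<in>T. \<psi> (f t))"
    if "\<And>f c g. f \<in> D \<Longrightarrow> g \<in> D \<Longrightarrow> \<psi> (axpy f c g) = \<psi> f + c * \<psi> g" for \<psi>
  proof -
    have "\<psi> (lin_comb T (\<lambda>_. 1) f) = (\<Sum>t\<in>T. 1 * \<psi> (f t))"
    proof (rule lin_comb_linear[where V = D])
      show "finite T" "(\<lambda>_. 0) \<in> D" by (rule finT, rule zero_D)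
      show "axpy f c g \<in> D" if "f \<in> D" "g \<in> D" for f c g using that by (rule axpy_D)
      show "f t \<in> D" if "t \<in> T" for t using that by (rule fD)
      show "\<psi> (axpy f c g) = \<psi> f + c * \<psi> g" if "f \<in> D" "g \<in> D" for f c g
        using that by (rule \<open>\<And>f c g. f \<in> D \<Longrightarrow> g \<in> D \<Longrightarrow> \<psi> (axpy f c g) = \<psi> f + c * \<psi> g\<close>)
    qed
    then show ?thesis by (simp add: g_def)
  qed
  have "\<phi> i g = 0" if i: "i \<in> I" for i
  proof -
    have "\<phi> i g = (\<Sum>t\<in>T. \<phi> i (f t))" by (rule g_linear[OF lin[OF i]])
    also have "\<dots> = (\<Sum>t\<in>T. \<Sum>e\<in>B t. c (t, e) * \<phi> i e)"
    proof (rule sum.cong[OF refl])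
      fix t assume "t \<in> T"
      then show "\<phi> i (f t) = (\<Sum>e\<in>B t. c (t, e) * \<phi> i e)"
        unfolding f_def
        by (intro lin_comb_linear[where V = D]) 
          (rule finB zero_D axpy_D lin[OF i] solD(1)[OF Bsol], assumption?, assumption?)+
    qed
    also have "\<dots> = (\<Sum>j\<in>J. c j * \<phi> i (snd j))"
      unfolding J_def using finT finB by (subst sum.Sigma) (auto simp: case_prod_unfold)
    finally show ?thesis using c i by simp
  qed
  then have low: "- l * L2_sq g \<le> Re (a g g)" using coercive gD by blast
  have gf: "L2_inner (f t) g = of_real (L2_sq (f t))" if t: "t \<in> T" for t
  proof -
    have "L2_inner g (f t) = (\<Sum>s\<in>T. L2_inner (f s) (f t))"
      by (rule g_linear) (simp add: L2_inner_axpy D_L2 fD t)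
    also have "\<dots> = (\<Sum>s\<in>T. if s = t then L2_inner (f t) (f t) else 0)"
      by (intro sum.cong refl) (auto intro: eigen_orthogonal[OF fsol fsol] t)
    finally have "L2_inner g (f t) = of_real (L2_sq (f t))" using finT t by (simp add: L2_inner_self)
    then show ?thesis by (subst L2_inner_commute) simp
  qed
  have "a g g = (\<Sum>t\<in>T. a (f t) g)" by (rule g_linear) (simp add: a_axpy gD)
  also have "\<dots> = (\<Sum>t\<in>T. of_real (t * L2_sq (f t)))"
  proof (rule sum.cong[OF refl])
    fix t assume t: "t \<in> T"
    have "shifted t (f t) g = 0" using solD(4)[OF fsol[OF t] gD] by simp
    then show "a (f t) g = of_real (t * L2_sq (f t))" by (simp add: shifted_def gf[OF t])
  qed
  finally have agg: "Re (a g g) = (\<Sum>t\<in>T. t * L2_sq (f t))" by simp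
  have "L2_inner g g = (\<Sum>t\<in>T. L2_inner (f t) g)" by (rule g_linear) (simp add: L2_inner_axpy D_L2 gD)
  also have "\<dots> = (\<Sum>t\<in>T. of_real (L2_sq (f t)))" using gf by simp
  finally have gg: "L2_sq g = (\<Sum>t\<in>T. L2_sq (f t))" 
    unfolding L2_inner_self by (metis of_real_eq_iff of_real_sum)
  obtain t e where te: "t \<in> T" "e \<in> B t" "c (t, e) \<noteq> 0" using c by (auto simp: J_def)
  have "f t \<noteq> (\<lambda>_. 0)"
  proof
    assume "f t = (\<lambda>_. 0)"
    then have "(\<Sum>e\<in>B t. (\<lambda>x. c (t, e) * e x)) = 0"
      using lin_comb_cfun[OF finB[OF te(1)], of "\<lambda>e. c (t, e)"] by (simp add: f_def zero_fun_def)
    then show False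
      using cfun.independentD[OF B(2)[of t] finB[OF te(1)] subset_refl, of "\<lambda>e. c (t, e)" e] te by simp
  qed
  then have pos: "0 < L2_sq (f t)" using fD te D_sq_pos by blast
  have "(\<Sum>t\<in>T. t * L2_sq (f t)) < (\<Sum>t\<in>T. - l * L2_sq (f t))"
  proof (rule sum_strict_mono_ex1[OF finT])
    show "\<forall>x\<in>T. x * L2_sq (f x) \<le> - l * L2_sq (f x)"
      using mult_right_mono[OF less_imp_le[OF T(2)] L2_sq_nonneg] by blast
    show "\<exists>x\<in>T. x * L2_sq (f x) < - l * L2_sq (f x)"
      using te(1) mult_strict_right_mono[OF T(2)[OF te(1)] pos] by blast
  qed
  then show False using low unfolding agg gg by (simp add: sum_distrib_left)
qed

text \<open>The count behind the contradiction: if the term exceeds \<open>- l\<close>, monotonicity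
  leaves only the indices below \<open>n\<close> for eigenvalues up to \<open>- l\<close>, so bases
  of their eigenspaces have fewer than \<open>n\<close> members altogether, and the trial space
  meets their orthogonal complement.\<close>

lemma eigenvalue_sequence_le:
  assumes disc: "negative_spectrum_discrete H" and seq: "negative_eigenvalue_sequence H lam"
    and l: "0 < l" and n: "1 \<le> n"
    and FD: "\<And>i. i < n \<Longrightarrow> F i \<in> D"
    and neg: "\<And>c. Re (a (lin_comb {..<n} c F) (lin_comb {..<n} c F)) \<le> - l * L2_sq (lin_comb {..<n} c F)"
    and indep: "\<And>c i. lin_comb {..<n} c F = (\<lambda>_. 0) \<Longrightarrow> i < n \<Longrightarrow> c i = 0"
  shows "lam n \<le> ereal (- l)"
proof (rule ccontr)
  assume "\<not> lam n \<le> ereal (- l)"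
  then have gt: "ereal (- l) < lam n" by simp
  define T where "T = {t. t \<le> - l \<and> op_eigenvalue H (of_real t)}"
  define N where "N t = {k. 1 \<le> k \<and> lam k = ereal t}" for t
  have "\<exists>B. B \<subseteq> op_eigenspace H (of_real t) \<and> cfun.independent B \<and>
     op_eigenspace H (of_real t) \<subseteq> cfun.span B \<and> card B = eigen_multiplicity H (of_real t)" for t
    by (metis eigenspace_basis)
  then obtain B where B: "\<And>t. B t \<subseteq> op_eigenspace H (of_real t)" "\<And>t. cfun.independent (B t)"
      "\<And>t. op_eigenspace H (of_real t) \<subseteq> cfun.span (B t)"
      "\<And>t. card (B t) = eigen_multiplicity H (of_real t)" by metis
  have finB: "finite (B t)" if t: "t \<in> T" for t
  proof -
    have "finite_multiplicity H (of_real t)"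
      using eigenvalue_in_discrete_spectrum[OF disc, of t] t l
      by (auto simp: T_def discrete_spectrum_def)
    then obtain W where "finite W" "op_eigenspace H (of_real t) \<subseteq> cfun.span W"
      by (auto simp: finite_multiplicity_def)
    then show ?thesis using cfun.independent_span_bound[of W "B t"] B(1,2)[of t] by auto
  qed
  \<comment> \<open>Nonempty bases give nonempty \<open>N t\<close>, which embeds \<open>T\<close>
    into the finitely many values of \<open>lam\<close> at indices below \<open>n\<close>.\<close>
  have cardB: "card (B t) \<noteq> 0" if t: "t \<in> T" for t
  proof
    assume "card (B t) = 0"
    then have "B t = {}" using finB[OF t] by simp
    then have "op_eigenspace H (of_real t) \<subseteq> {\<lambda>_. 0}" using B(3)[of t] by (simp add: zero_fun_def)
    then show False using t by (auto simp: T_def op_eigenvalue_def)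
  qed
  have N: "finite (N t)" "card (N t) = card (B t)" if "t \<in> T" for t
    using seq that l unfolding negative_eigenvalue_sequence_def N_def B(4) T_def by auto
  have Nsub: "N t \<subseteq> {1..<n}" if t: "t \<in> T" for t
  proof
    fix k assume k: "k \<in> N t"
    have "\<not> n \<le> k"
    proof
      assume "n \<le> k"
      then have "lam n \<le> lam k"
        using eigenvalue_sequence_mono[OF seq] n by simp
      then have "lam n \<le> ereal t" using k by (simp add: N_def)
      also have "\<dots> \<le> ereal (- l)" using t by (simp add: T_def)
      finally show False using gt by simp
    qed
    then show "k \<in> {1..<n}" using k by (simp add: N_def)
  qed
  have finT: "finite T"
  proof (rule finite_subset)
    show "T \<subseteq> (\<lambda>k. real_of_ereal (lam k)) ` {1..<n}"
    proof
      fix t assume t: "t \<in> T"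
      then have "N t \<noteq> {}" using N[OF t] cardB[OF t] by auto
      then obtain k where "k \<in> N t" by blast
      then show "t \<in> (\<lambda>k. real_of_ereal (lam k)) ` {1..<n}"
        using Nsub[OF t] by (intro image_eqI[of _ _ k]) (auto simp: N_def)
    qed
  qed simp
  define E where "E = (\<Union>t\<in>T. B t)"
  have finE: "finite E" using finT finB by (simp add: E_def)
  have "card E \<le> (\<Sum>t\<in>T. card (B t))" unfolding E_def by (rule card_UN_le[OF finT])
  also have "\<dots> = (\<Sum>t\<in>T. card (N t))" using N by simp
  also have "\<dots> = card (\<Union>t\<in>T. N t)"
    using finT N(1) by (subst card_UN_disjoint) (auto simp: N_def)
  also have "\<dots> \<le> card {1..<n}" using Nsub by (intro card_mono) auto
  finally have cardE: "card E < card {..<n}" using n by simp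
  have Esol: "\<exists>t. sol t e (\<lambda>_. 0)" if "e \<in> E" for e
    using that B(1) eigenspace_iff_sol unfolding E_def by blast
  then have eE: "eigenvectors E" by (simp add: eigenvectors_def)
  have EL: "E \<subseteq> L2" by (rule eigenvectors_L2[OF eE])
  obtain c where c: "\<exists>j<n. c j \<noteq> 0" "\<And>e. e \<in> E \<Longrightarrow> (\<Sum>j<n. c j * L2_inner (F j) e) = 0"
    using homogeneous_system_nontrivial[OF finE _ cardE, of "\<lambda>e j. L2_inner (F j) e"] by auto
  define f where "f = lin_comb {..<n} c F"
  have fD: "f \<in> D" unfolding f_def by (rule lin_comb_closed[OF _ zero_D axpy_D]) (auto simp: FD)
  have f0: "f \<noteq> (\<lambda>_. 0)" using c(1) indep unfolding f_def by blast
  have fo: "f \<in> orth E"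
  proof -
    have "L2_inner f e = 0" if e: "e \<in> E" for e
    proof -
      have "L2_inner f e = (\<Sum>j<n. c j * L2_inner (F j) e)"
        unfolding f_def using e EL
        by (intro lin_comb_linear[OF _ zero_D axpy_D]) (auto simp: FD L2_inner_axpy D_L2)
      then show ?thesis using c(2)[OF e] by simp
    qed
    then show ?thesis using fD D_L2 by (simp add: orth_def)
  qed
  define S where "S = {Re (a f f) / L2_sq f | f. f \<in> D \<inter> orth E \<and> L2_sq f \<noteq> 0}"
  define m where "m = Inf S"
  obtain C where C: "\<And>f. f \<in> D \<Longrightarrow> C * L2_sq f \<le> Re (a f f)" using semibounded by blast
  have quot: "C \<le> Re (a f f) / L2_sq f" if "f \<in> D" "L2_sq f \<noteq> 0" for f
  proof -
    have "0 < L2_sq f" using that(2) L2_sq_nonneg[of f] by linarith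
    then show ?thesis using C[OF that(1)] by (simp add: pos_le_divide_eq)
  qed
  have bdd: "bdd_below S" by (rule bdd_belowI[of _ C]) (auto simp: S_def quot)
  have Sf: "Re (a f f) / L2_sq f \<in> S" using fD fo D_sq_pos[OF fD f0] by (auto simp: S_def)
  have "m \<le> Re (a f f) / L2_sq f" unfolding m_def by (rule cInf_lower[OF Sf bdd])
  also have "\<dots> \<le> - l" using neg[of c] D_sq_pos[OF fD f0] by (simp add: f_def divide_simps)
  finally have ml: "m \<le> - l" .
  have nonneg: "0 \<le> Re (shifted m g g)" if g: "g \<in> D \<inter> orth E" for g
  proof (cases "L2_sq g = 0")
    case True
    then show ?thesis using C[of g] g by (simp add: Re_shifted_self)
  next
    case False
    then have "m \<le> Re (a g g) / L2_sq g"
      unfolding m_def using g by (intro cInf_lower[OF _ bdd]) (auto simp: S_def)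
    moreover have "0 < L2_sq g" using False L2_sq_nonneg[of g] by linarith
    ultimately show ?thesis using g by (simp add: Re_shifted_self pos_le_divide_eq)
  qed
  have approx: "\<exists>g\<in>D \<inter> orth E. 0 < L2_sq g \<and> Re (shifted m g g) < \<epsilon> * L2_sq g" if "0 < \<epsilon>" for \<epsilon>
  proof -
    have "S \<noteq> {}" "Inf S < m + \<epsilon>" using Sf that by (auto simp: m_def)
    then obtain x where "x \<in> S" "x < m + \<epsilon>" using cInf_lessD by blast
    then obtain g where g: "g \<in> D \<inter> orth E" "L2_sq g \<noteq> 0" "Re (a g g) / L2_sq g < m + \<epsilon>"
      by (auto simp: S_def)
    then have "0 < L2_sq g" using L2_sq_nonneg[of g] by linarith
    then show ?thesis using g by (intro bexI[of _ g]) (auto simp: Re_shifted_self field_simps)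
  qed
  have nr: "\<not> regular m" by (rule bottom_not_regular[OF eE nonneg approx])
  have "m < 0" using ml l by simp
  then have "complex_of_real m \<in> discrete_spectrum H"
    using disc nr by (auto simp: negative_spectrum_discrete_def op_spectrum_def)
  then obtain \<epsilon> where \<epsilon>: "\<epsilon> > 0" "\<And>y. y \<in> op_spectrum H \<Longrightarrow> dist (complex_of_real m) y < \<epsilon> \<Longrightarrow> y = of_real m"
    unfolding discrete_spectrum_def isolated_in_dist_Ex_iff by auto
  have reg: "regular s" if "s \<noteq> m" "\<bar>s - m\<bar> < \<epsilon>" for s
  proof (rule ccontr)
    assume "\<not> regular s"
    moreover have "dist (complex_of_real m) (of_real s) < \<epsilon>"
      using that(2) by (simp add: dist_norm norm_minus_commute flip: of_real_diff)
    ultimately show False using \<epsilon>(2)[of "of_real s"] that(1) by (simp add: op_spectrum_def)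
  qed
  \<comment> \<open>Half of the isolation radius \<open>\<epsilon>\<close> makes regular both the
    interval of length \<open>\<epsilon>\<close> above \<open>m\<close> and the point
    \<open>m - \<epsilon> / 2\<close>.\<close>
  have "\<exists>p\<in>orth E. p \<noteq> (\<lambda>_. 0) \<and> sol m p (\<lambda>_. 0)"
  proof (rule isolated_bottom_eigen[OF eE nonneg approx, of "\<epsilon> / 2"])
    show "regular s" if "m < s" "s < m + 2 * (\<epsilon> / 2)" for s by (rule reg) (use that in auto)
    show "regular (m - \<epsilon> / 2)" by (rule reg) (use \<epsilon>(1) in auto)
  qed (use \<epsilon>(1) in auto)
  then obtain p where p: "p \<in> orth E" "p \<noteq> (\<lambda>_. 0)" "sol m p (\<lambda>_. 0)" by blast
  then have mT: "m \<in> T" using ml by (auto simp: T_def eigenvalue_iff)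
  \<comment> \<open>Since \<open>m <= - l\<close>, the eigenvalue \<open>m\<close> belongs to
    \<open>T\<close> and \<open>B m\<close> is part of \<open>E\<close>; \<open>p\<close> lies in
    its span and is orthogonal to it, hence to itself.\<close>
  have "p \<in> cfun.span (B m)" using p B(3)[of m] eigenspace_iff_sol by blast
  then obtain u where "p = lin_comb (B m) u (\<lambda>v. v)"
    unfolding cfun.span_finite[OF finB[OF mT]] using lin_comb_cfun[OF finB[OF mT]] by auto
  moreover have "L2_inner (lin_comb (B m) u (\<lambda>v. v)) p = (\<Sum>v\<in>B m. u v * L2_inner v p)"
    using mT EL p by (intro lin_comb_linear[OF finB[OF mT], of L2])
      (auto simp: E_def zero_L2 L2_axpy L2_inner_axpy orth_def)
  moreover have "L2_inner v p = 0" if "v \<in> B m" for v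
    using p(1) mT that L2_inner_commute[of v p] by (auto simp: E_def orth_def)
  ultimately have "L2_inner p p = 0" by simp
  then show False using p D_definite[of p] solD(1)[OF p(3)] by (simp add: L2_inner_self)
qed

end

section \<open>The form of the potential\<close>

lemma L2_set_integrable:
  assumes "g \<in> L2"
  shows "set_integrable lborel {a..b} g"
  unfolding set_integrable_def
proof (rule Bochner_Integration.integrable_bound)
  show "integrable lborel (\<lambda>x. indicat_real {a..b} x + (cmod (g x))\<^sup>2)"
    using assms by (intro Bochner_Integration.integrable_add integrable_real_indicator) (auto simp: L2_def emeasure_lborel_Icc_eq)
  show "(\<lambda>x. indicator {a..b} x *\<^sub>R g x) \<in> borel_measurable lborel"
    using assms by (auto simp: L2_def)
  show "AE x in lborel. norm (indicator {a..b} x *\<^sub>R g x) \<le> norm (indicat_real {a..b} x + (cmod (g x))\<^sup>2)"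
  proof (intro AE_I2)
    fix x
    have "cmod (g x) \<le> 1 + (cmod (g x))\<^sup>2"
      using sum_squares_bound[of 1 "cmod (g x)"] norm_ge_zero[of "g x"]
      unfolding one_power2 by linarith
    then show "norm (indicator {a..b} x *\<^sub>R g x) \<le> norm (indicat_real {a..b} x + (cmod (g x))\<^sup>2)"
      by (auto simp: indicator_def)
  qed
qed

text \<open>Dynkin argument: closed intervals generate the Borel sets and are stable under
  intersection, while vanishing of the integral passes to complements and countable disjoint unions.
  Complements require the integral over the line to vanish, which follows by exhaustion.\<close>

lemma AE_zero_if_interval_integrals_zero:
  fixes v :: "real \<Rightarrow> 'b::{second_countable_topology, banach}"
  assumes v: "integrable lborel v"
    and zero: "\<And>a b. (LINT x:{a..b}|lborel. v x) = 0"
  shows "AE x in lborel. v x = 0"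
proof (rule sigma_finite_measure.density_zero[OF sigma_finite_lborel v])
  let ?G = "range (\<lambda>(a, b). {a..b::real})"
  have sets: "sets lborel = sigma_sets UNIV ?G" by (simp add: borel_eq_atLeastAtMost)
  have ints: "set_integrable lborel A v" if "A \<in> sigma_sets UNIV ?G" for A
    using that v unfolding set_integrable_def sets[symmetric] by (intro integrable_mult_indicator)
  have "{a..b} \<inter> {c..d} = {max a c..min b d}" for a b c d :: real by auto
  then have stable: "Int_stable ?G" unfolding Int_stable_def by auto
  have U: "(\<Union>n. {- real n..real n}) = UNIV"
  proof (intro equalityI subsetI UNIV_I)
    fix x :: real
    obtain n where "\<bar>x\<bar> \<le> real n" using real_arch_simple by blast
    then show "x \<in> (\<Union>n. {- real n..real n})" by (auto simp: abs_le_iff intro!: exI[of _ n])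
  qed
  have total: "(LINT x:UNIV|lborel. v x) = 0"
  proof (rule LIMSEQ_unique)
    have "(\<lambda>n. LINT x:{- real n..real n}|lborel. v x) \<longlonglongrightarrow> (LINT x:(\<Union>n. {- real n..real n})|lborel. v x)"
    proof (rule set_integral_cont_up)
      show "set_integrable lborel (\<Union>n. {- real n..real n}) v"
        using v unfolding U by (simp add: set_integrable_def)
    qed (auto simp: incseq_def)
    then show "(\<lambda>n. LINT x:{- real n..real n}|lborel. v x) \<longlonglongrightarrow> (LINT x:UNIV|lborel. v x)"
      unfolding U .
    show "(\<lambda>n. LINT x:{- real n..real n}|lborel. v x) \<longlonglongrightarrow> 0" by (simp add: zero)
  qed
  fix A assume "A \<in> sets (lborel :: real measure)"
  note stable
  moreover have "?G \<subseteq> Pow UNIV" by simp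
  moreover have "A \<in> sigma_sets UNIV ?G" using \<open>A \<in> sets lborel\<close> sets by simp
  ultimately show "(LINT x:A|lborel. v x) = 0"
  proof (induction rule: sigma_sets_induct_disjoint)
    case (basic A)
    then show ?case using zero by auto
  next
    case empty
    then show ?case by (simp add: set_lebesgue_integral_def)
  next
    case (compl A)
    have "(LINT x:A \<union> (UNIV - A)|lborel. v x) = (LINT x:A|lborel. v x) + (LINT x:UNIV - A|lborel. v x)"
      using compl by (intro set_integral_Un ints sigma_sets.Compl) auto
    then show ?case using compl total by (simp add: Un_absorb1)
  next
    case (union A)
    have "(LINT x:(\<Union>i. A i)|lborel. v x) = (\<Sum>i. LINT x:A i|lborel. v x)"
    proof (rule lebesgue_integral_countable_add)
      show "A i \<in> sets lborel" for i using union.hyps sets by auto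
      show "A i \<inter> A j = {}" if "i \<noteq> j" for i j using union.hyps(1) that by (auto simp: disjoint_family_on_def)
      show "set_integrable lborel (\<Union>i. A i) v"
        using union.hyps(2) by (intro ints sigma_sets.Union) auto
    qed
    then show ?case using union by simp
  qed
qed

text \<open>A square-integrable difference need not be integrable over the line, so it is cut off to
  \<open>[-n, n]\<close>, where its interval integrals still vanish, and countably many null sets
  are collected.\<close>

lemma has_L2_derivative_unique:
  assumes "has_L2_derivative f g" "has_L2_derivative f g'"
  shows "AE x in lborel. g x = g' x"
proof -
  define u where "u = axpy g (-1) g'"
  have L: "g \<in> L2" "g' \<in> L2" using assms by (auto simp: has_L2_derivative_def)
  have uint: "set_integrable lborel {a..b} u" for a b
    using L by (intro L2_set_integrable) (simp add: u_def L2_axpy)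
  have uz: "(LINT x:{a..b}|lborel. u x) = 0" for a b
  proof (cases "a \<le> b")
    case True
    have "(LINT x:{a..b}|lborel. g x - g' x) = (LINT x:{a..b}|lborel. g x) - (LINT x:{a..b}|lborel. g' x)"
      using L by (intro set_integral_diff L2_set_integrable)
    then show ?thesis using assms True by (simp add: u_def axpy_def has_L2_derivative_def)
  qed (simp add: set_lebesgue_integral_def)
  have "AE x in lborel. \<forall>n. indicator {- real n..real n} x *\<^sub>R u x = 0"
  proof (subst AE_all_countable, intro allI AE_zero_if_interval_integrals_zero)
    fix n a b
    show "integrable lborel (\<lambda>x. indicator {- real n..real n} x *\<^sub>R u x)"
      using uint by (simp add: set_integrable_def)
    have "(LINT x:{a..b}|lborel. indicator {- real n..real n} x *\<^sub>R u x)
      = (LINT x:{max a (- real n)..min b (real n)}|lborel. u x)"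
      unfolding set_lebesgue_integral_def
      by (intro Bochner_Integration.integral_cong) (auto simp: indicator_def)
    then show "(LINT x:{a..b}|lborel. indicator {- real n..real n} x *\<^sub>R u x) = 0" by (simp add: uz)
  qed
  then show ?thesis
  proof eventually_elim
    case (elim x)
    obtain n where "\<bar>x\<bar> \<le> real n" using real_arch_simple by blast
    then have "u x = 0" using elim[rule_format, of n] by (simp add: indicator_def abs_le_iff split: if_splits)
    then show ?case by (simp add: u_def axpy_def)
  qed
qed

lemma has_L2_derivative_axpy:
  assumes "has_L2_derivative f g" "has_L2_derivative f' g'"
  shows "has_L2_derivative (axpy f c f') (axpy g c g')"
proof -
  have L: "g \<in> L2" "g' \<in> L2" using assms by (auto simp: has_L2_derivative_def)
  have "axpy f c f' b - axpy f c f' a = (LINT x:{a..b}|lborel. axpy g c g' x)" if "a \<le> b" for a b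
  proof -
    have "(LINT x:{a..b}|lborel. g x + c * g' x) = (LINT x:{a..b}|lborel. g x) + (LINT x:{a..b}|lborel. c * g' x)"
      using L by (intro set_integral_add L2_set_integrable scale_L2)
    also have "\<dots> = (f b - f a) + c * (f' b - f' a)"
      using assms that by (simp add: has_L2_derivative_def)
    finally show ?thesis by (simp add: axpy_def algebra_simps)
  qed
  then show ?thesis using L by (simp add: has_L2_derivative_def L2_axpy)
qed

lemma has_L2_derivative_H1_deriv: "f \<in> H1 \<Longrightarrow> has_L2_derivative f (H1_deriv f)"
  unfolding H1_deriv_def H1_def by (auto intro: someI[of "has_L2_derivative f"])

lemma H1_deriv_L2: "f \<in> H1 \<Longrightarrow> H1_deriv f \<in> L2"
  using has_L2_derivative_H1_deriv by (simp add: has_L2_derivative_def)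

lemma H1_L2: "f \<in> H1 \<Longrightarrow> f \<in> L2"
  by (simp add: H1_def)

lemma H1_axpy: "f \<in> H1 \<Longrightarrow> g \<in> H1 \<Longrightarrow> axpy f c g \<in> H1"
  unfolding H1_def by (blast intro: has_L2_derivative_axpy L2_axpy)

lemma H1_deriv_AE_eq: "has_L2_derivative f g \<Longrightarrow> AE x in lborel. H1_deriv f x = g x"
  unfolding H1_deriv_def 
  by (rule has_L2_derivative_unique[of f]) (auto intro: someI[of "has_L2_derivative f"])

lemma zero_H1: "(\<lambda>_. 0) \<in> H1"
proof -
  have "has_L2_derivative (\<lambda>_. 0) (\<lambda>_. 0)" by (simp add: has_L2_derivative_def zero_L2)
  then show ?thesis by (auto simp: H1_def zero_L2)
qed

lemma set_integral_Cauchy_Schwarz: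
  assumes g: "g \<in> L2" and "a \<le> b"
  shows "(cmod (LINT x:{a..b}|lborel. g x))\<^sup>2 \<le> (b - a) * (LINT x:{a..b}|lborel. (cmod (g x))\<^sup>2)"
proof -
  define u where "u x = indicator {a..b} x *\<^sub>R g x" for x
  define w where "w x = complex_of_real (indicator {a..b} x)" for x
  have [measurable]: "g \<in> borel_measurable lborel" using g by (simp add: L2_def)
  have "integrable lborel (\<lambda>x. indicator {a..b} x *\<^sub>R (cmod (g x))\<^sup>2)"
    using g by (intro integrable_mult_indicator) (auto simp: L2_def)
  moreover have usq: "(cmod (u x))\<^sup>2 = indicator {a..b} x *\<^sub>R (cmod (g x))\<^sup>2" for x
    by (auto simp: u_def indicator_def)
  moreover have "u \<in> borel_measurable lborel" unfolding u_def by measurable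
  ultimately have u: "u \<in> L2" by (simp add: L2_def)
  have wsq: "(cmod (w x))\<^sup>2 = indicator {a..b} x" for x by (auto simp: w_def indicator_def)
  have "w \<in> borel_measurable lborel" unfolding w_def by measurable
  then have w: "w \<in> L2" using wsq assms(2) by (simp add: L2_def integrable_real_indicator)
  have "L2_inner u w = (LINT x:{a..b}|lborel. g x)"
    unfolding L2_inner_def set_lebesgue_integral_def
    by (intro Bochner_Integration.integral_cong) (auto simp: u_def w_def indicator_def)
  moreover have "L2_sq u = (LINT x:{a..b}|lborel. (cmod (g x))\<^sup>2)"
    by (simp add: L2_sq_def usq set_lebesgue_integral_def)
  moreover have "L2_sq w = b - a" using assms by (simp add: L2_sq_def wsq)
  ultimately show ?thesis using L2_Cauchy_Schwarz[OF u w] by (simp add: mult.commute)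
qed

lemma L2_sq_set_integrable: 
  "g \<in> L2 \<Longrightarrow> A \<in> sets borel \<Longrightarrow> set_integrable lborel A (\<lambda>x. (cmod (g x))\<^sup>2)"
  unfolding set_integrable_def by (intro integrable_mult_indicator) (auto simp: L2_def)

lemma set_integral_mono_set_nonneg:
  fixes f :: "real \<Rightarrow> real"
  assumes "set_integrable lborel B f" "A \<in> sets borel" "A \<subseteq> B" "\<And>x. 0 \<le> f x"
  shows "(LINT x:A|lborel. f x) \<le> (LINT x:B|lborel. f x)"
proof -
  have "set_integrable lborel A f" using assms set_integrable_subset[of lborel B f A] by auto
  then show ?thesis
    using assms unfolding set_integrable_def set_lebesgue_integral_def
    by (intro integral_mono) (auto simp: indicator_def)
qed

lemma has_L2_derivative_diff_bound:
  assumes "has_L2_derivative f g" "x \<in> {a..b}" "y \<in> {a..b}"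
  shows "(cmod (f x - f y))\<^sup>2 \<le> (b - a) * (LINT x:{a..b}|lborel. (cmod (g x))\<^sup>2)"
proof -
  have g: "g \<in> L2" using assms by (simp add: has_L2_derivative_def)
  have G: "set_integrable lborel S (\<lambda>x. (cmod (g x))\<^sup>2)" if "S \<in> sets borel" for S
    by (rule L2_sq_set_integrable[OF g that])
  have *: "(cmod (f y - f x))\<^sup>2 \<le> (b - a) * (LINT x:{a..b}|lborel. (cmod (g x))\<^sup>2)"
    if "x \<le> y" "x \<in> {a..b}" "y \<in> {a..b}" for x y
  proof -
    have "(cmod (f y - f x))\<^sup>2 \<le> (y - x) * (LINT x:{x..y}|lborel. (cmod (g x))\<^sup>2)"
      using assms(1) that(1) set_integral_Cauchy_Schwarz[OF g that(1)] by (simp add: has_L2_derivative_def)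
    also have "\<dots> \<le> (b - a) * (LINT x:{a..b}|lborel. (cmod (g x))\<^sup>2)"
      using that G by (intro mult_mono set_integral_mono_set_nonneg) (auto simp: set_lebesgue_integral_def)
    finally show ?thesis .
  qed
  show ?thesis
    using *[of x y] *[of y x] assms(2,3) by (cases "x \<le> y") (auto simp: norm_minus_commute)
qed

lemma H1_continuous:
  assumes "f \<in> H1"
  shows "continuous_on UNIV f"
proof -
  obtain g where g: "has_L2_derivative f g" using assms by (auto simp: H1_def)
  then have gL: "g \<in> L2" by (simp add: has_L2_derivative_def)
  have bound: "cmod (f y - f x) \<le> sqrt (\<bar>y - x\<bar> * L2_sq g)" for x y
  proof -
    define a b where "a = min x y" and "b = max x y"
    have "(cmod (f y - f x))\<^sup>2 \<le> (b - a) * (LINT x:{a..b}|lborel. (cmod (g x))\<^sup>2)"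
      by (rule has_L2_derivative_diff_bound[OF g]) (auto simp: a_def b_def)
    also have "\<dots> \<le> (b - a) * (LINT x:UNIV|lborel. (cmod (g x))\<^sup>2)"
      by (intro mult_left_mono set_integral_mono_set_nonneg L2_sq_set_integrable gL) (auto simp: a_def b_def)
    also have "\<dots> = \<bar>y - x\<bar> * L2_sq g"
      by (auto simp: a_def b_def L2_sq_def set_lebesgue_integral_def min_def max_def)
    finally show ?thesis by (rule real_le_rsqrt)
  qed
  show ?thesis unfolding continuous_on_def
  proof
    fix x
    show "(f \<longlongrightarrow> f x) (at x within UNIV)"
    proof (rule Lim_transform_bound[of "\<lambda>y. f y - f x" "\<lambda>y. sqrt (\<bar>y - x\<bar> * L2_sq g)", THEN LIM_zero_cancel])
      show "\<forall>\<^sub>F y in at x. cmod (f y - f x) \<le> norm (sqrt (\<bar>y - x\<bar> * L2_sq g))"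
        using bound by (intro always_eventually allI) (simp add: abs_mult)
      have "((\<lambda>y. sqrt (\<bar>y - x\<bar> * L2_sq g)) \<longlongrightarrow> sqrt (\<bar>x - x\<bar> * L2_sq g)) (at x)"
        by (intro tendsto_intros)
      then show "((\<lambda>y. sqrt (\<bar>y - x\<bar> * L2_sq g)) \<longlongrightarrow> 0) (at x within UNIV)" by simp
    qed
  qed
qed

lemma H1_borel: "f \<in> H1 \<Longrightarrow> f \<in> borel_measurable borel"
  by (intro borel_measurable_continuous_onI H1_continuous)

text \<open>The set where \<open>f\<close> is nonzero is open by continuity and null by assumption,
  hence empty. This is where the continuous representative matters.\<close>

lemma H1_definite:
  assumes f: "f \<in> H1" and "L2_sq f = 0"
  shows "f = (\<lambda>_. 0)"
proof -
  define S where "S = {x. f x \<noteq> 0}"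
  have "open S" unfolding S_def
    using open_Collect_neq[of f "\<lambda>_. 0"] H1_continuous[OF f] by simp
  have "AE x in lborel. (cmod (f x))\<^sup>2 = 0"
    using assms H1_L2[OF f] by (subst (asm) L2_sq_def, subst (asm) integral_nonneg_eq_0_iff_AE) (auto simp: L2_def)
  then have "AE x in lborel. x \<notin> S" by (simp add: S_def)
  then have "S \<in> null_sets lborel" using \<open>open S\<close> by (subst (asm) AE_iff_null_sets[symmetric]) auto
  then have "negligible S" by (simp add: negligible_iff_null_sets null_sets_completionI)
  then have "S = {}" using \<open>open S\<close> open_not_negligible by blast
  then show ?thesis by (auto simp: S_def)
qed

lemma H1_sq_integrable:
  assumes "sets \<mu> = sets borel" "f \<in> form_domain \<mu>"
  shows "f \<in> sq_integrable \<mu>"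
  using assms H1_borel[of f] by (auto simp: form_domain_def sq_integrable_def cong: measurable_cong_sets)

text \<open>The form refers to a derivative picked by \<open>SOME\<close>; candidates agree almost
  everywhere, so any known derivative may be substituted.\<close>

lemma mu_form_eq:
  assumes "has_L2_derivative f f'" "has_L2_derivative g g'"
  shows "mu_form \<mu> f g = L2_inner f' g' - (LINT x|\<mu>. f x * cnj (g x))"
proof -
  have L: "f' \<in> L2" "g' \<in> L2" using assms by (auto simp: has_L2_derivative_def)
  have f: "has_L2_derivative f (H1_deriv f)" and g: "has_L2_derivative g (H1_deriv g)"
    using assms unfolding H1_deriv_def
    by (auto intro: someI[of "has_L2_derivative f"] someI[of "has_L2_derivative g"])
  then have H: "H1_deriv f \<in> L2" "H1_deriv g \<in> L2" by (auto simp: has_L2_derivative_def)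
  have "L2_inner (H1_deriv f) (H1_deriv g) = L2_inner f' (H1_deriv g)"
    by (intro L2_inner_cong_AE L H H1_deriv_AE_eq assms)
  also have "\<dots> = cnj (L2_inner (H1_deriv g) f')" by (rule L2_inner_commute)
  also have "L2_inner (H1_deriv g) f' = L2_inner g' f'"
    by (intro L2_inner_cong_AE L H H1_deriv_AE_eq assms)
  also have "cnj (L2_inner g' f') = L2_inner f' g'" by (rule L2_inner_commute[symmetric])
  finally show ?thesis by (simp add: mu_form_def L2_inner_def)
qed

lemma mu_form_semibounded_form:
  assumes sets: "sets \<mu> = sets borel"
    and bounded: "\<exists>C. \<forall>f\<in>form_domain \<mu>. C * L2_sq f \<le> Re (mu_form \<mu> f f)"
  shows "semibounded_form (form_domain \<mu>) (mu_form \<mu>)"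
proof
  show "f \<in> L2" if "f \<in> form_domain \<mu>" for f using that by (simp add: form_domain_def H1_L2)
  show "(\<lambda>_. 0) \<in> form_domain \<mu>" by (simp add: form_domain_def zero_H1)
  show "axpy f c g \<in> form_domain \<mu>" if fg: "f \<in> form_domain \<mu>" "g \<in> form_domain \<mu>" for f g c
    using fg sq_integrable_axpy[OF fg[THEN H1_sq_integrable[OF sets]], of c]
    by (auto simp: form_domain_def H1_axpy sq_integrable_def)
  show "mu_form \<mu> (axpy f c g) h = mu_form \<mu> f h + c * mu_form \<mu> g h"
    if "f \<in> form_domain \<mu>" "g \<in> form_domain \<mu>" "h \<in> form_domain \<mu>" for f g h c
  proof -
    have d: "has_L2_derivative f (H1_deriv f)" "has_L2_derivative g (H1_deriv g)" "has_L2_derivative h (H1_deriv h)"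
      using that by (auto simp: form_domain_def has_L2_derivative_H1_deriv)
    then have L: "H1_deriv f \<in> L2" "H1_deriv g \<in> L2" "H1_deriv h \<in> L2"
      by (auto simp: has_L2_derivative_def)
    show ?thesis
      unfolding mu_form_eq[OF has_L2_derivative_axpy[OF d(1,2), of c] d(3)] mu_form_eq[OF d(1,3)] mu_form_eq[OF d(2,3)]
      unfolding L2_inner_axpy[OF L]
      using that by (subst integral_mult_axpy) (auto simp: H1_sq_integrable[OF sets] algebra_simps)
  qed
  show "mu_form \<mu> g f = cnj (mu_form \<mu> f g)" for f g
    unfolding mu_form_def by (simp add: integral_mult_cnj_commute[of _ g f] integral_mult_cnj_commute[of _ "H1_deriv g"])
  show "f = (\<lambda>_. 0)" if "f \<in> form_domain \<mu>" "L2_sq f = 0" for f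
    using that H1_definite by (simp add: form_domain_def)
qed (rule bounded)

lemma Re_mu_form_self:
  assumes "has_L2_derivative f g"
  shows "Re (mu_form \<mu> f f) = L2_sq g - (LINT x|\<mu>. (cmod (f x))\<^sup>2)"
  unfolding mu_form_eq[OF assms assms] integral_mult_cnj_self L2_inner_self by simp

section \<open>Partitions into light and heavy intervals\<close>

text \<open>A density that localizes the bound \<open>- l ||f||^2\<close> for the form: it suffices
  to dominate the \<open>\<mu>\<close>-integral of \<open>|f|^2\<close> by the integral of this
  function on each piece of a partition.\<close>

definition energy :: "real \<Rightarrow> (real \<Rightarrow> complex) \<Rightarrow> (real \<Rightarrow> complex) \<Rightarrow> real \<Rightarrow> real" where
  "energy l f g x = (cmod (g x))\<^sup>2 + l * (cmod (f x))\<^sup>2"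

lemma energy_nonneg: "0 \<le> l \<Longrightarrow> 0 \<le> energy l f g x"
  by (simp add: energy_def)

lemma energy_set_integral:
  assumes "f \<in> L2" "g \<in> L2" "A \<in> sets borel"
  shows "set_integrable lborel A (energy l f g)"
    "(LINT x:A|lborel. energy l f g x) =
      (LINT x:A|lborel. (cmod (g x))\<^sup>2) + l * (LINT x:A|lborel. (cmod (f x))\<^sup>2)"
  using assms unfolding energy_def
  by (auto simp: L2_sq_set_integrable)

lemma set_integral_Ico_Icc:
  fixes f :: "real \<Rightarrow> real"
  assumes "f \<in> borel_measurable borel"
  shows "(LINT x:{a..<b}|lborel. f x) = (LINT x:{a..b}|lborel. f x)"
proof (rule set_integral_cong_set)
  show "AE x in lborel. (x \<in> {a..b}) = (x \<in> {a..<b})"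
    using AE_lborel_singleton[of b] by eventually_elim auto
qed (use assms in \<open>auto simp: set_borel_measurable_def\<close>)

text \<open>
  On a long interval of small \<open>\<mu>\<close>-mass the form is bounded below by itself; on a short one it is
  nonnegative once \<open>f\<close> vanishes at the left end point.
\<close>

lemma interval_mass_bound:
  assumes fg: "has_L2_derivative f g" and f: "f \<in> H1" and ab: "a < b"
    and mass: "emeasure \<mu> {a..<b} \<le> ennreal (1 / (2 * (b - a)))"
    and sets: "sets \<mu> = sets borel"
    and alt: "l = 1 / (b - a)\<^sup>2 \<or> 0 \<le> l \<and> f a = 0"
  shows "(\<integral>\<^sup>+x\<in>{a..<b}. ennreal ((cmod (f x))\<^sup>2) \<partial>\<mu>) \<le> (\<integral>\<^sup>+x\<in>{a..<b}. ennreal (energy l f g x) \<partial>lborel)"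
proof -
  have g: "g \<in> L2" using fg by (simp add: has_L2_derivative_def)
  note fL = H1_L2[OF f]
  have l: "0 \<le> l" using alt by auto
  define d where "d = b - a"
  have d: "d > 0" using ab by (simp add: d_def)
  define G where "G = (LINT x:{a..b}|lborel. (cmod (g x))\<^sup>2)"
  define F where "F = (LINT x:{a..b}|lborel. (cmod (f x))\<^sup>2)"
  have G0: "0 \<le> G" and F0: "0 \<le> F" by (auto simp: G_def F_def set_lebesgue_integral_def)
  have diff: "(cmod (f x - f y))\<^sup>2 \<le> d * G" if "x \<in> {a..b}" "y \<in> {a..b}" for x y
    unfolding d_def G_def by (rule has_L2_derivative_diff_bound[OF fg that])
  have point: "(cmod (f x))\<^sup>2 \<le> 2 * d * (G + l * F)" if x: "x \<in> {a..b}" for x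
  proof (cases "l = 1 / d\<^sup>2")
    case True
    have y: "(cmod (f x))\<^sup>2 - 2 * d * G \<le> 2 * (cmod (f y))\<^sup>2" if "y \<in> {a..b}" for y
    proof -
      have "cmod (f x) \<le> cmod (f y) + cmod (f x - f y)" by (metis norm_triangle_sub)
      then have "(cmod (f x))\<^sup>2 \<le> (cmod (f y) + cmod (f x - f y))\<^sup>2" by (intro power_mono) auto
      also have "\<dots> \<le> 2 * (cmod (f y))\<^sup>2 + 2 * (cmod (f x - f y))\<^sup>2"
        using sum_squares_bound[of "cmod (f y)" "cmod (f x - f y)"] by (simp add: power2_sum)
      finally show ?thesis using diff[OF x that] by simp
    qed
    \<comment> \<open>Averaging over the comparison point \<open>y\<close> replaces an unknown value
      of \<open>f\<close> by \<open>F\<close>; with \<open>l = 1 / d^2\<close> the resulting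
      \<open>2 F / d\<close> is \<open>2 d l F\<close>.\<close>
    have "(LINT y:{a..b}|lborel. (cmod (f x))\<^sup>2 - 2 * d * G) \<le> (LINT y:{a..b}|lborel. 2 * (cmod (f y))\<^sup>2)"
    proof (rule set_integral_mono)
      show "set_integrable lborel {a..b} (\<lambda>_. (cmod (f x))\<^sup>2 - 2 * d * G)"
        by (simp add: set_integrable_def emeasure_lborel_Icc_eq)
      show "set_integrable lborel {a..b} (\<lambda>y. 2 * (cmod (f y))\<^sup>2)"
        using L2_sq_set_integrable[OF fL, of "{a..b}"] by simp
    qed (use y in auto)
    moreover have "(LINT y:{a..b}|lborel. (cmod (f x))\<^sup>2 - 2 * d * G) = d * ((cmod (f x))\<^sup>2 - 2 * d * G)"
      using ab by (subst set_integral_const) (auto simp: d_def)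
    ultimately have "d * ((cmod (f x))\<^sup>2 - 2 * d * G) \<le> 2 * F" by (simp add: F_def)
    then have "(cmod (f x))\<^sup>2 - 2 * d * G \<le> 2 * F / d" using d by (simp add: field_simps)
    moreover have "2 * F / d = 2 * d * (l * F)" using d True by (simp add: field_simps power2_eq_square)
    ultimately show ?thesis by (simp add: algebra_simps)
  next
    case False
    then have "f a = 0" using alt by (simp add: d_def)
    then have "(cmod (f x))\<^sup>2 \<le> d * G" using diff[OF x, of a] ab by simp
    also have "\<dots> \<le> 2 * d * (G + l * F)" using d G0 F0 l by (simp add: algebra_simps)
    finally show ?thesis .
  qed
  have "(\<integral>\<^sup>+x\<in>{a..<b}. ennreal ((cmod (f x))\<^sup>2) \<partial>\<mu>) \<le> (\<integral>\<^sup>+x\<in>{a..<b}. ennreal (2 * d * (G + l * F)) \<partial>\<mu>)"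
    using point by (intro nn_integral_mono) (auto simp: indicator_def intro!: ennreal_leI)
  also have "\<dots> = ennreal (2 * d * (G + l * F)) * emeasure \<mu> {a..<b}"
    using sets by (intro nn_integral_cmult_indicator) simp
  also have "\<dots> \<le> ennreal (2 * d * (G + l * F)) * ennreal (1 / (2 * d))"
    using mass by (intro mult_left_mono) (auto simp: d_def)
  also have "\<dots> = ennreal (G + l * F)"
    using d G0 F0 l by (simp flip: ennreal_mult)
  also have "G + l * F = (LINT x:{a..<b}|lborel. energy l f g x)"
    using fL g unfolding energy_set_integral(2)[OF fL g] G_def F_def
    by (subst (1 2) set_integral_Ico_Icc[symmetric]) (auto simp: L2_def energy_set_integral(2)[OF fL g])
  also have "ennreal \<dots> = (\<integral>\<^sup>+x\<in>{a..<b}. ennreal (energy l f g x) \<partial>lborel)"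
    using energy_set_integral(1)[OF fL g, of "{a..<b}" l] energy_nonneg[OF l]
    unfolding set_lebesgue_integral_def set_integrable_def
    by (subst nn_integral_eq_integral[symmetric]) (auto simp: indicator_def intro!: nn_integral_cong)
  finally show ?thesis .
qed

lemma cover_mass_bound:
  fixes I :: "nat \<Rightarrow> real set"
  assumes disj: "disjoint_family I" and f: "f \<in> H1" and g: "g \<in> L2" and sets: "sets \<mu> = sets borel"
    and I: "\<And>k. I k \<in> sets borel"
    and bound: "\<And>k. (\<integral>\<^sup>+x\<in>I k. ennreal ((cmod (f x))\<^sup>2) \<partial>\<mu>) \<le> (\<integral>\<^sup>+x\<in>I k. ennreal (energy l f g x) \<partial>lborel)"
  shows "(\<integral>\<^sup>+x\<in>(\<Union>k. I k). ennreal ((cmod (f x))\<^sup>2) \<partial>\<mu>) \<le> (\<integral>\<^sup>+x\<in>(\<Union>k. I k). ennreal (energy l f g x) \<partial>lborel)"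
proof -
  have fm[measurable]: "f \<in> borel_measurable borel" by (rule H1_borel[OF f])
  have gm[measurable]: "g \<in> borel_measurable borel" using g by (simp add: L2_def)
  have "(\<integral>\<^sup>+x\<in>(\<Union>k. I k). ennreal ((cmod (f x))\<^sup>2) \<partial>\<mu>) = (\<Sum>k. \<integral>\<^sup>+x\<in>I k. ennreal ((cmod (f x))\<^sup>2) \<partial>\<mu>)"
    using disj I sets by (intro nn_integral_disjoint_family) (simp_all cong: measurable_cong_sets)
  also have "\<dots> \<le> (\<Sum>k. \<integral>\<^sup>+x\<in>I k. ennreal (energy l f g x) \<partial>lborel)"
    by (intro suminf_le bound) auto
  also have "\<dots> = (\<integral>\<^sup>+x\<in>(\<Union>k. I k). ennreal (energy l f g x) \<partial>lborel)"
    using disj I by (intro nn_integral_disjoint_family[symmetric]) (simp_all add: energy_def)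
  finally show ?thesis .
qed

lemma mu_form_lower_bound_split:
  assumes fg: "has_L2_derivative f g" and f: "f \<in> form_domain \<mu>" and sets: "sets \<mu> = sets borel" and l: "0 \<le> l"
    and left: "(\<integral>\<^sup>+x\<in>{..<A}. ennreal ((cmod (f x))\<^sup>2) \<partial>\<mu>) \<le> (\<integral>\<^sup>+x\<in>{..<A}. ennreal (energy l f g x) \<partial>lborel)"
    and right: "(\<integral>\<^sup>+x\<in>{A..}. ennreal ((cmod (f x))\<^sup>2) \<partial>\<mu>) \<le> (\<integral>\<^sup>+x\<in>{A..}. ennreal (energy l f g x) \<partial>lborel)"
  shows "- l * L2_sq f \<le> Re (mu_form \<mu> f f)"
proof -
  have H: "f \<in> H1" using f by (simp add: form_domain_def)
  have g: "g \<in> L2" using fg by (simp add: has_L2_derivative_def)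
  have fm[measurable]: "f \<in> borel_measurable borel" by (rule H1_borel[OF H])
  have gm[measurable]: "g \<in> borel_measurable borel" using g by (simp add: L2_def)
  have split: "(\<integral>\<^sup>+x. u x \<partial>M) = (\<integral>\<^sup>+x\<in>{..<A}. u x \<partial>M) + (\<integral>\<^sup>+x\<in>{A..}. u x \<partial>M)"
    if "sets M = sets borel" "u \<in> borel_measurable borel" for M and u :: "real \<Rightarrow> ennreal"
  proof -
    have "{..<A} \<union> {A..} = UNIV" "{..<A} \<inter> {A..} = {}" by auto
    then show ?thesis using nn_integral_disjoint_pair[of u M "{..<A}" "{A..}"] that
      by (simp cong: measurable_cong_sets)
  qed
  have "ennreal (LINT x|\<mu>. (cmod (f x))\<^sup>2) = (\<integral>\<^sup>+x. ennreal ((cmod (f x))\<^sup>2) \<partial>\<mu>)"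
    using f by (intro nn_integral_eq_integral[symmetric]) (auto simp: form_domain_def)
  also have "\<dots> \<le> (\<integral>\<^sup>+x. ennreal (energy l f g x) \<partial>lborel)"
    using left right by (subst (1 2) split) (auto simp: sets energy_def intro: add_mono)
  also have "\<dots> = ennreal (LINT x|lborel. energy l f g x)"
    using energy_set_integral(1)[OF H1_L2[OF H] g, of UNIV l] energy_nonneg[OF l]
    by (intro nn_integral_eq_integral) (auto simp: set_integrable_def)
  also have "(LINT x|lborel. energy l f g x) = L2_sq g + l * L2_sq f"
    using energy_set_integral(2)[OF H1_L2[OF H] g, of UNIV l] 
    by (simp add: L2_sq_def set_lebesgue_integral_def)
  finally have "(LINT x|\<mu>. (cmod (f x))\<^sup>2) \<le> L2_sq g + l * L2_sq f"
    using l by (subst (asm) ennreal_le_iff) auto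
  then show ?thesis by (simp add: Re_mu_form_self[OF fg])
qed

text \<open>The threshold is that of the Otelbaev function for \<open>\<beta> = 2\<close> and also
  the one \<open>interval_mass_bound\<close> tolerates. Half-open intervals count an atom at a
  common end point once.\<close>

definition light :: "real measure \<Rightarrow> real \<Rightarrow> real \<Rightarrow> bool" where
  "light \<mu> h a \<longleftrightarrow> emeasure \<mu> {a..<a + h} \<le> ennreal (1 / (2 * h))"

fun endpoint :: "real measure \<Rightarrow> real \<Rightarrow> real \<Rightarrow> real \<Rightarrow> nat \<Rightarrow> real" where
  "endpoint \<mu> h e A 0 = A"
| "endpoint \<mu> h e A (Suc k) = endpoint \<mu> h e A k + (if light \<mu> h (endpoint \<mu> h e A k) then h else e)"

lemma endpoint_mono:
  assumes "0 < h" "0 < e"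
  shows "j \<le> k \<Longrightarrow> endpoint \<mu> h e A j \<le> endpoint \<mu> h e A k"
  by (rule lift_Suc_mono_le[of "endpoint \<mu> h e A"]) (use assms in \<open>auto simp: less_imp_le\<close>)

lemma endpoint_lower:
  assumes "0 < h" "0 < e"
  shows "A + real k * min h e \<le> endpoint \<mu> h e A k"
  by (induction k) (use assms in \<open>auto simp: algebra_simps min_def split: if_splits\<close>)

lemma incseq_intervals:
  fixes p :: "nat \<Rightarrow> real"
  assumes mono: "\<And>j k. j \<le> k \<Longrightarrow> p j \<le> p k"
  shows "disjoint_family (\<lambda>k. {p k..<p (Suc k)})"
    and "(\<And>x. \<exists>k. x < p k) \<Longrightarrow> (\<Union>k. {p k..<p (Suc k)}) = {p 0..}"
proof -
  have "x \<notin> {p k..<p (Suc k)}" if "j < k" "x \<in> {p j..<p (Suc j)}" for j k x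
    using mono[of "Suc j" k] that by auto
  then show "disjoint_family (\<lambda>k. {p k..<p (Suc k)})"
    unfolding disjoint_family_on_def by (metis disjoint_iff linorder_neqE_nat)
  assume unb: "\<And>x. \<exists>k. x < p k"
  have "x \<in> (\<Union>k. {p k..<p (Suc k)})" if x: "p 0 \<le> x" for x
  proof -
    define k where "k = (LEAST k. x < p k)"
    have k: "x < p k" unfolding k_def using unb by (rule LeastI_ex)
    then obtain j where j: "k = Suc j" using x by (cases k) auto
    then have "\<not> x < p j" using not_less_Least[of j "\<lambda>k. x < p k"] by (simp add: k_def)
    then show ?thesis using k j by (auto simp: not_less)
  qed
  moreover have "p 0 \<le> x" if "x \<in> {p k..<p (Suc k)}" for x k using mono[of 0 k] that by auto
  ultimately show "(\<Union>k. {p k..<p (Suc k)}) = {p 0..}" by blast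
qed

lemma decreasing_intervals:
  fixes h :: real
  assumes "0 < h"
  shows "disjoint_family (\<lambda>k::nat. {A - real (Suc k) * h..<A - real (Suc k) * h + h})"
    and "(\<Union>k::nat. {A - real (Suc k) * h..<A - real (Suc k) * h + h}) = {..<A}"
proof -
  have eq: "A - real (Suc k) * h + h = A - real k * h" for k by (simp add: algebra_simps)
  have "x \<notin> {A - real (Suc k) * h..<A - real k * h}" if "j < k" "x \<in> {A - real (Suc j) * h..<A - real j * h}" for j k x
  proof -
    have "real (Suc j) * h \<le> real k * h" using that(1) assms by (intro mult_right_mono) auto
    then show ?thesis using that by auto
  qed
  then show "disjoint_family (\<lambda>k::nat. {A - real (Suc k) * h..<A - real (Suc k) * h + h})"
    unfolding disjoint_family_on_def eq by (metis disjoint_iff linorder_neqE_nat)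
  have "x \<in> (\<Union>k::nat. {A - real (Suc k) * h..<A - real k * h})" if x: "x < A" for x
  proof -
    define k where "k = (LEAST k. A - real k * h \<le> x)"
    have "\<exists>k. A - real k * h \<le> x"
    proof -
      obtain k where "(A - x) / h < real k" using reals_Archimedean2 by blast
      then show ?thesis using assms by (intro exI[of _ k]) (simp add: field_simps)
    qed
    then have k: "A - real k * h \<le> x" unfolding k_def by (rule LeastI_ex)
    then obtain j where j: "k = Suc j" using x by (cases k) auto
    then have "\<not> A - real j * h \<le> x" using not_less_Least[of j "\<lambda>k. A - real k * h \<le> x"] by (simp add: k_def)
    then show ?thesis using k j by (auto simp: not_le intro!: exI[of _ j])
  qed
  moreover have "x < A" if "x \<in> {A - real (Suc k) * h..<A - real k * h}" for x k
  proof -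
    have "0 \<le> real k * h" using assms by simp
    then show ?thesis using that by (auto simp del: zero_le_mult_iff of_nat_0_le_iff)
  qed
  ultimately show "(\<Union>k::nat. {A - real (Suc k) * h..<A - real (Suc k) * h + h}) = {..<A}"
    unfolding eq by auto
qed

text \<open>The line is tiled from \<open>A\<close> in both directions: to the left by light
  intervals of length \<open>h\<close>, to the right as \<open>endpoint\<close> dictates. Steps of
  at least \<open>min h e\<close> reach every point, and the local bounds add up.\<close>

lemma mu_form_lower_bound:
  assumes f: "f \<in> form_domain \<mu>" and sets: "sets \<mu> = sets borel" and pos: "0 < h" "0 < e"
    and left: "\<And>a. a \<le> A \<Longrightarrow> light \<mu> h a"
    and short: "\<And>a. \<not> light \<mu> h a \<Longrightarrow> light \<mu> e a"
    and zero: "\<And>k. \<not> light \<mu> h (endpoint \<mu> h e A k) \<Longrightarrow> f (endpoint \<mu> h e A k) = 0"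
  shows "- (1 / h\<^sup>2) * L2_sq f \<le> Re (mu_form \<mu> f f)"
proof -
  define l p where "l = 1 / h\<^sup>2" and "p = endpoint \<mu> h e A"
  have H: "f \<in> H1" using f by (simp add: form_domain_def)
  have fg: "has_L2_derivative f (H1_deriv f)" by (rule has_L2_derivative_H1_deriv[OF H])
  have pS: "p (Suc k) = p k + (if light \<mu> h (p k) then h else e)" for k by (simp add: p_def)
  have "- l * L2_sq f \<le> Re (mu_form \<mu> f f)"
  proof (rule mu_form_lower_bound_split[OF fg f sets])
    show "0 \<le> l" by (simp add: l_def)
    have "(\<integral>\<^sup>+x\<in>(\<Union>k. {A - real (Suc k) * h..<A - real (Suc k) * h + h}). ennreal ((cmod (f x))\<^sup>2) \<partial>\<mu>)
      \<le> (\<integral>\<^sup>+x\<in>(\<Union>k. {A - real (Suc k) * h..<A - real (Suc k) * h + h}). ennreal (energy l f (H1_deriv f) x) \<partial>lborel)"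
    proof (rule cover_mass_bound[OF decreasing_intervals(1)[OF pos(1)] H H1_deriv_L2[OF H] sets])
      fix k
      have "light \<mu> h (A - real (Suc k) * h)" using pos by (intro left) simp
      then show "(\<integral>\<^sup>+x\<in>{A - real (Suc k) * h..<A - real (Suc k) * h + h}. ennreal ((cmod (f x))\<^sup>2) \<partial>\<mu>)
        \<le> (\<integral>\<^sup>+x\<in>{A - real (Suc k) * h..<A - real (Suc k) * h + h}. ennreal (energy l f (H1_deriv f) x) \<partial>lborel)"
        using pos by (intro interval_mass_bound[OF fg H _ _ sets]) (auto simp: light_def l_def)
    qed simp
    then show "(\<integral>\<^sup>+x\<in>{..<A}. ennreal ((cmod (f x))\<^sup>2) \<partial>\<mu>) \<le> (\<integral>\<^sup>+x\<in>{..<A}. ennreal (energy l f (H1_deriv f) x) \<partial>lborel)"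
      unfolding decreasing_intervals(2)[OF pos(1)] .
    have mono: "p j \<le> p k" if "j \<le> k" for j k unfolding p_def by (rule endpoint_mono[OF pos that])
    have "\<exists>k. x < p k" for x
    proof -
      obtain k where "(x - A) / min h e < real k" using reals_Archimedean2 by blast
      then have "x < A + real k * min h e" using pos by (simp add: field_simps)
      then show ?thesis using endpoint_lower[OF pos, of A k \<mu>] by (intro exI[of _ k]) (simp add: p_def)
    qed
    then have U: "(\<Union>k. {p k..<p (Suc k)}) = {A..}" using incseq_intervals(2)[of p, OF mono] by (simp add: p_def)
    have "(\<integral>\<^sup>+x\<in>(\<Union>k. {p k..<p (Suc k)}). ennreal ((cmod (f x))\<^sup>2) \<partial>\<mu>)
      \<le> (\<integral>\<^sup>+x\<in>(\<Union>k. {p k..<p (Suc k)}). ennreal (energy l f (H1_deriv f) x) \<partial>lborel)"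
    proof (rule cover_mass_bound[OF incseq_intervals(1)[of p, OF mono] H H1_deriv_L2[OF H] sets])
      fix k
      show "(\<integral>\<^sup>+x\<in>{p k..<p (Suc k)}. ennreal ((cmod (f x))\<^sup>2) \<partial>\<mu>)
        \<le> (\<integral>\<^sup>+x\<in>{p k..<p (Suc k)}. ennreal (energy l f (H1_deriv f) x) \<partial>lborel)"
      proof (cases "light \<mu> h (p k)")
        case True
        then show ?thesis
          using pos by (intro interval_mass_bound[OF fg H _ _ sets]) (auto simp: light_def l_def pS)
      next
        case False
        then have "light \<mu> e (p k)" "f (p k) = 0" using short zero by (auto simp: p_def)
        then show ?thesis
          using False pos by (intro interval_mass_bound[OF fg H _ _ sets]) (auto simp: light_def l_def pS)
      qed
    qed simp_all
    then show "(\<integral>\<^sup>+x\<in>{A..}. ennreal ((cmod (f x))\<^sup>2) \<partial>\<mu>) \<le> (\<integral>\<^sup>+x\<in>{A..}. ennreal (energy l f (H1_deriv f) x) \<partial>lborel)"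
      unfolding U .
  qed
  then show ?thesis by (simp add: l_def)
qed

section \<open>The Otelbaev function\<close>

lemma inverse_square_le_iff: "0 < D \<Longrightarrow> 0 < d \<Longrightarrow> 1 / D\<^sup>2 \<le> 1 / d\<^sup>2 \<longleftrightarrow> d \<le> (D::real)"
  by (simp add: field_simps abs_le_square_iff[symmetric])

text \<open>As \<open>1 / d^2\<close> decreases in \<open>d\<close>, a lower bound for the infimum
  says that no \<open>d > D\<close> is admissible.\<close>

lemma otelbaev_ge_iff:
  assumes "0 < D"
  shows "ereal (1 / D\<^sup>2) \<le> otelbaev \<beta> \<mu> x \<longleftrightarrow>
    (\<forall>d>D. ennreal (1 / (\<beta> * d)) \<le> emeasure \<mu> {x - d/2..x + d/2})"
proof -
  have "ereal (1 / D\<^sup>2) \<le> otelbaev \<beta> \<mu> x \<longleftrightarrow>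
     (\<forall>d>0. emeasure \<mu> {x - d/2..x + d/2} < ennreal (1 / (\<beta> * d)) \<longrightarrow> 1 / D\<^sup>2 \<le> 1 / d\<^sup>2)"
    unfolding otelbaev_def le_Inf_iff by auto
  also have "\<dots> \<longleftrightarrow> (\<forall>d>0. emeasure \<mu> {x - d/2..x + d/2} < ennreal (1 / (\<beta> * d)) \<longrightarrow> d \<le> D)"
    using inverse_square_le_iff[OF assms] by auto
  also have "\<dots> \<longleftrightarrow> (\<forall>d>D. ennreal (1 / (\<beta> * d)) \<le> emeasure \<mu> {x - d/2..x + d/2})"
    using assms by (meson le_less_trans not_le order_less_trans)
  finally show ?thesis .
qed

text \<open>Admissible \<open>d\<close> form an initial segment: shrinking \<open>d\<close> lowers
  the mass and raises the threshold. The bound \<open>d < 1 / sqrt Q\<close> is strict because the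
  infimum need not be attained.\<close>

lemma otelbaev_le_imp:
  assumes sets: "sets \<mu> = sets borel" and \<beta>: "0 < \<beta>"
    and q: "otelbaev \<beta> \<mu> x \<le> ereal Q" and Q: "0 < Q" and d: "0 < d" "d < 1 / sqrt Q"
  shows "emeasure \<mu> {x - d/2..x + d/2} < ennreal (1 / (\<beta> * d))"
proof (rule ccontr)
  have "Q < 1 / d\<^sup>2"
  proof -
    have "d\<^sup>2 < (1 / sqrt Q)\<^sup>2" using d by (intro power_strict_mono) auto
    then show ?thesis using Q d by (simp add: power_divide field_simps)
  qed
  then have "otelbaev \<beta> \<mu> x < ereal (1 / d\<^sup>2)" using q by (metis ereal_less_eq(3) le_less_trans less_ereal.simps(1))
  then obtain d' where d': "0 < d'" "emeasure \<mu> {x - d'/2..x + d'/2} < ennreal (1 / (\<beta> * d'))" "1 / d'\<^sup>2 < 1 / d\<^sup>2"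
    unfolding otelbaev_def Inf_less_iff by auto
  have "d < d'" using d'(3) inverse_square_le_iff[OF d(1) d'(1)] by linarith
  assume "\<not> ?thesis"
  then have "ennreal (1 / (\<beta> * d)) \<le> emeasure \<mu> {x - d/2..x + d/2}" by simp
  also have "\<dots> \<le> emeasure \<mu> {x - d'/2..x + d'/2}"
    using \<open>d < d'\<close> sets by (intro emeasure_mono) auto
  also have "\<dots> < ennreal (1 / (\<beta> * d'))" by (rule d'(2))
  also have "\<dots> \<le> ennreal (1 / (\<beta> * d))"
    using \<open>d < d'\<close> d \<beta> by (intro ennreal_leI divide_left_mono) auto
  finally show False by simp
qed

text \<open>The complement is open: if \<open>d > D\<close> is admissible at \<open>x\<close>, then
  \<open>d'\<close>, halfway between \<open>D\<close> and \<open>d\<close>, is admissible at nearby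
  centres, where its interval stays inside that of \<open>d\<close>.\<close>

lemma otelbaev_superlevel_borel:
  assumes sets: "sets \<mu> = sets borel" and "0 < \<beta>" "0 < D"
  shows "{x. ereal (1 / D\<^sup>2) \<le> otelbaev \<beta> \<mu> x} \<in> sets borel"
proof -
  have "open (- {x. ereal (1 / D\<^sup>2) \<le> otelbaev \<beta> \<mu> x})" (is "open ?S")
    unfolding open_dist
  proof
    fix x assume "x \<in> ?S"
    then obtain d where d: "D < d" "emeasure \<mu> {x - d/2..x + d/2} < ennreal (1 / (\<beta> * d))"
      using otelbaev_ge_iff[OF assms(3)] by (auto simp: not_le)
    define d' where "d' = (d + D) / 2"
    have d': "D < d'" "d' < d" using d by (auto simp: d'_def)
    have "y \<in> ?S" if "dist y x < (d - d') / 2" for y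
    proof -
      have "y - x \<le> (d - d') / 2" "x - y \<le> (d - d') / 2"
        using that abs_ge_self[of "y - x"] abs_ge_minus_self[of "y - x"] by (auto simp: dist_real_def)
      then have "x - d/2 \<le> y - d'/2" "y + d'/2 \<le> x + d/2" by (simp_all add: diff_divide_distrib)
      then have "emeasure \<mu> {y - d'/2..y + d'/2} \<le> emeasure \<mu> {x - d/2..x + d/2}"
        using sets by (intro emeasure_mono) auto
      also have "\<dots> < ennreal (1 / (\<beta> * d))" by (rule d(2))
      also have "\<dots> \<le> ennreal (1 / (\<beta> * d'))"
        using d' assms by (intro ennreal_leI divide_left_mono) auto
      finally show ?thesis using otelbaev_ge_iff[OF assms(3)] d' by (auto simp: not_le)
    qed
    then show "\<exists>e>0. \<forall>y. dist y x < e \<longrightarrow> y \<in> ?S" using d' by (intro exI[of _ "(d - d') / 2"]) auto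
  qed
  then show ?thesis by (metis borel_open borel_comp double_compl)
qed

lemma brinck_small_interval:
  assumes sets: "sets \<mu> = sets borel" and "brinck \<mu>" and \<beta>: "0 < \<beta>"
  shows "\<exists>d>0. \<forall>a. emeasure \<mu> {a..a + d} < ennreal (1 / (\<beta> * d))"
proof -
  obtain C where C: "0 < C" "\<And>x. emeasure \<mu> {x..x + 1} < ennreal C"
    using assms by (auto simp: brinck_def)
  define d where "d = min 1 (1 / (\<beta> * C))"
  have d: "0 < d" "d \<le> 1" using C \<beta> by (auto simp: d_def)
  have "emeasure \<mu> {a..a + d} < ennreal (1 / (\<beta> * d))" for a
  proof -
    have "emeasure \<mu> {a..a + d} \<le> emeasure \<mu> {a..a + 1}"
      using d sets by (intro emeasure_mono) auto
    also have "\<dots> < ennreal C" by (rule C(2))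
    also have "C \<le> 1 / (\<beta> * d)"
    proof -
      have "d \<le> 1 / (\<beta> * C)" by (simp add: d_def)
      then show ?thesis using d C \<beta> by (simp add: field_simps)
    qed
    finally show ?thesis by (metis ennreal_leI less_le_trans)
  qed
  then show ?thesis using d by blast
qed

lemma otelbaev_nonneg: "0 \<le> otelbaev \<beta> \<mu> x"
  unfolding otelbaev_def by (intro Inf_greatest) auto

lemma sup_norm_otelbaev:
  assumes radon: "radon_measure \<mu>" and nz: "emeasure \<mu> UNIV \<noteq> 0" and "brinck \<mu>" and \<beta>: "0 < \<beta>"
  shows "\<exists>Q>0. sup_norm (otelbaev \<beta> \<mu>) = ereal Q \<and> (\<forall>x. otelbaev \<beta> \<mu> x \<le> ereal Q)"
proof -
  have sets: "sets \<mu> = sets borel" using radon by (simp add: radon_measure_def)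
  obtain d where d: "d > 0" "\<And>a. emeasure \<mu> {a..a + d} < ennreal (1 / (\<beta> * d))"
    using brinck_small_interval[OF sets assms(3) \<beta>] by blast
  have "otelbaev \<beta> \<mu> x \<le> ereal (1 / d\<^sup>2)" for x
    unfolding otelbaev_def using d(1) d(2)[of "x - d/2"] by (intro Inf_lower CollectI exI[of _ d]) (auto simp: add.commute)
  then have upper: "sup_norm (otelbaev \<beta> \<mu>) \<le> ereal (1 / d\<^sup>2)"
    unfolding sup_norm_def using otelbaev_nonneg by (intro SUP_least) (simp add: abs_of_nonneg)
  have le: "otelbaev \<beta> \<mu> x \<le> sup_norm (otelbaev \<beta> \<mu>)" for x
    unfolding sup_norm_def using otelbaev_nonneg[of \<beta> \<mu> x] by (intro SUP_upper2[of x]) auto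
  have "\<exists>n::nat. emeasure \<mu> {- real n..real n} \<noteq> 0"
  proof (rule ccontr)
    assume "\<not> ?thesis"
    then have "(\<Union>n. {- real n..real n}) \<in> null_sets \<mu>"
      using sets by (intro null_sets_UN) (auto simp: null_sets_def)
    moreover have "(\<Union>n. {- real n..real n}) = UNIV"
    proof (intro equalityI subsetI UNIV_I)
      fix x :: real
      obtain n where "\<bar>x\<bar> \<le> real n" using real_arch_simple by blast
      then show "x \<in> (\<Union>n. {- real n..real n})" by (auto simp: abs_le_iff intro!: exI[of _ n])
    qed
    ultimately show False using nz by auto
  qed
  then obtain n :: nat where n: "emeasure \<mu> {- real n..real n} \<noteq> 0" by blast
  have "emeasure \<mu> {- real n..real n} < \<infinity>" using radon by (simp add: radon_measure_def)
  then obtain m where m: "emeasure \<mu> {- real n..real n} = ennreal m" "0 \<le> m"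
    by (metis ennreal_cases infinity_ennreal_def less_irrefl)
  have "m \<noteq> 0" using n m(1) by (metis ennreal_0)
  with m(2) have m0: "0 < m" by linarith
  \<comment> \<open>For \<open>d > D\<close> the interval around 0 contains \<open>[-n, n]\<close>
    and \<open>1 / (\<beta> * d)\<close> is below its mass \<open>m\<close>; so the function is
    positive at 0.\<close>
  define D where "D = max (2 * real n + 1) (1 / (\<beta> * m))"
  have D: "0 < D" by (simp add: D_def less_max_iff_disj)
  have "ereal (1 / D\<^sup>2) \<le> otelbaev \<beta> \<mu> 0"
    unfolding otelbaev_ge_iff[OF D]
  proof (intro allI impI)
    fix d assume "D < d"
    then have dd: "2 * real n + 1 < d" "1 / (\<beta> * m) < d" by (auto simp: D_def)
    have "1 / (\<beta> * d) \<le> m" using dd m0 \<beta> by (simp add: field_simps)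
    then have "ennreal (1 / (\<beta> * d)) \<le> emeasure \<mu> {- real n..real n}" unfolding m(1) by (rule ennreal_leI)
    also have "\<dots> \<le> emeasure \<mu> {0 - d/2..0 + d/2}" using dd sets by (intro emeasure_mono) auto
    finally show "ennreal (1 / (\<beta> * d)) \<le> emeasure \<mu> {0 - d/2..0 + d/2}" .
  qed
  then have lower: "ereal (1 / D\<^sup>2) \<le> sup_norm (otelbaev \<beta> \<mu>)" using le order_trans by blast
  then obtain Q where Q: "sup_norm (otelbaev \<beta> \<mu>) = ereal Q"
    using upper by (cases "sup_norm (otelbaev \<beta> \<mu>)") auto
  have "1 / D\<^sup>2 \<le> Q" using lower Q by simp
  then have "0 < Q" by (rule less_le_trans[rotated]) (use D in simp)
  then show ?thesis using Q le by auto
qed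

text \<open>The Brinck condition makes all intervals of one fixed length light; the partition then
  imposes no vanishing condition on \<open>f\<close>.\<close>

lemma mu_form_semibounded:
  assumes "radon_measure \<mu>" "brinck \<mu>"
  shows "semibounded_form (form_domain \<mu>) (mu_form \<mu>)"
proof (rule mu_form_semibounded_form)
  show sets: "sets \<mu> = sets borel" using assms by (simp add: radon_measure_def)
  obtain d where d: "d > 0" "\<And>a. emeasure \<mu> {a..a + d} < ennreal (1 / (2 * d))"
    using brinck_small_interval[OF sets assms(2), of 2] by auto
  have "emeasure \<mu> {a..<a + d} \<le> emeasure \<mu> {a..a + d}" for a
    using sets by (intro emeasure_mono) auto
  then have L: "light \<mu> d a" for a unfolding light_def using d(2) less_imp_le order_trans by blast
  have "- (1 / d\<^sup>2) * L2_sq f \<le> Re (mu_form \<mu> f f)" if "f \<in> form_domain \<mu>" for f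
    by (rule mu_form_lower_bound[OF that sets d(1) d(1), of 0]) (use L in auto)
  then show "\<exists>C. \<forall>f\<in>form_domain \<mu>. C * L2_sq f \<le> Re (mu_form \<mu> f f)" by blast
qed

section \<open>Separated points in sets of given measure, and the count of heavy intervals\<close>

definition separated :: "real \<Rightarrow> real set \<Rightarrow> bool" where
  "separated w X \<longleftrightarrow> (\<forall>x\<in>X. \<forall>y\<in>X. x < y \<longrightarrow> x + w \<le> y)"

lemma separated_insert_left:
  assumes "separated w X" "\<And>y. y \<in> X \<Longrightarrow> x + w \<le> y" "0 < w"
  shows "separated w (insert x X)"
  using assms unfolding separated_def by force

lemma unbounded_separated:
  assumes "\<And>A. \<exists>a\<le>A. a \<in> S" "0 < w"
  shows "\<exists>X\<subseteq>S. finite X \<and> card X = m \<and> separated w X"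
proof (induction m)
  case 0
  show ?case by (intro exI[of _ "{}"]) (simp add: separated_def)
next
  case (Suc m)
  then obtain X where X: "X \<subseteq> S" "finite X" "card X = m" "separated w X" by blast
  \<comment> \<open>Inserting 0 gives \<open>Min\<close> a nonempty argument even if
    \<open>X\<close> is empty.\<close>
  obtain a where a: "a \<le> Min (insert 0 X) - w" "a \<in> S" using assms(1) by blast
  have *: "a + w \<le> y" if "y \<in> X" for y
  proof -
    have "Min (insert 0 X) \<le> y" using X(2) that by (intro Min_le) auto
    then show ?thesis using a by linarith
  qed
  then have "a \<notin> X" using assms(2) by fastforce
  then show ?case using X a * assms(2)
    by (intro exI[of _ "insert a X"]) (auto intro: separated_insert_left)
qed

lemma separated_disjoint: 
  "separated w X \<Longrightarrow> x \<in> X \<Longrightarrow> y \<in> X \<Longrightarrow> x \<noteq> y \<Longrightarrow> {x..<x + w} \<inter> {y..<y + w} = {}"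
  unfolding separated_def by (metis (no_types, lifting) atLeastLessThan_iff disjoint_iff linorder_neqE_linordered_idom not_less order_less_le_trans)

lemma separated_card_bound:
  assumes X: "finite X" "separated w X" "0 < w"
    and sub: "\<And>x. x \<in> X \<Longrightarrow> {x..<x + w} \<subseteq> G" and G: "G \<in> sets borel"
  shows "ennreal (real (card X) * w) \<le> emeasure lborel G"
proof -
  have "ennreal (real (card X) * w) = (\<Sum>x\<in>X. emeasure lborel {x..<x + w})"
    using X(3) by (simp add: ennreal_mult ennreal_of_nat_eq_real_of_nat)
  also have "\<dots> = emeasure lborel (\<Union>x\<in>X. {x..<x + w})"
    using X separated_disjoint by (intro sum_emeasure) (auto simp: disjoint_family_on_def)
  also have "\<dots> \<le> emeasure lborel G" using sub G by (intro emeasure_mono) auto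
  finally show ?thesis .
qed

text \<open>
  A heavy interval \<open>[a, a + h)\<close> lies in every \<open>\<Delta>\<^sub>y(d)\<close> with \<open>y\<close> close to \<open>a\<close> and \<open>d > 2h\<close>, so the
  short interval starting at \<open>a\<close> is contained in the superlevel set of the Otelbaev function.
\<close>

lemma heavy_subset_superlevel:
  assumes sets: "sets \<mu> = sets borel" and "0 < h" "e \<le> h" "\<not> light \<mu> h a"
  shows "{a..<a + e} \<subseteq> {x. ereal (1 / (2 * h)\<^sup>2) \<le> otelbaev 2 \<mu> x}"
proof
  fix y assume y: "y \<in> {a..<a + e}"
  have "0 < 2 * h" using assms by simp
  then have "ereal (1 / (2 * h)\<^sup>2) \<le> otelbaev 2 \<mu> y"
    unfolding otelbaev_ge_iff[OF \<open>0 < 2 * h\<close>]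
  proof (intro allI impI)
    fix d assume d: "2 * h < d"
    have "ennreal (1 / (2 * d)) \<le> ennreal (1 / (2 * h))"
      using assms d by (intro ennreal_leI divide_left_mono) auto
    also have "\<dots> \<le> emeasure \<mu> {a..<a + h}" using assms by (simp add: light_def)
    also have "\<dots> \<le> emeasure \<mu> {y - d/2..y + d/2}"
      using y d assms by (intro emeasure_mono) auto
    finally show "ennreal (1 / (2 * d)) \<le> emeasure \<mu> {y - d/2..y + d/2}" .
  qed
  then show "y \<in> {x. ereal (1 / (2 * h)\<^sup>2) \<le> otelbaev 2 \<mu> x}" by simp
qed

lemma mu_form_finite_codimension_bound:
  assumes sets: "sets \<mu> = sets borel" and Q: "0 < Q" "\<And>x. otelbaev 2 \<mu> x \<le> ereal Q"
    and l: "0 < l" and n: "1 \<le> n"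
    and small: "emeasure lborel {x. ereal (l / 4) \<le> otelbaev 2 \<mu> x} \<le> ennreal ((real n - 1) / sqrt Q)"
  shows "\<exists>X. finite X \<and> card X < n \<and>
    (\<forall>f\<in>form_domain \<mu>. (\<forall>x\<in>X. f x = 0) \<longrightarrow> - l * L2_sq f \<le> Re (mu_form \<mu> f f))"
proof -
  define h where "h = 1 / sqrt l"
  \<comment> \<open>Strictly below \<open>1 / sqrt Q\<close>, since lightness is known only there,
    yet so close that \<open>n * e\<close> exceeds \<open>(n - 1) / sqrt Q\<close>; any factor
    strictly between \<open>1 - 1/n\<close> and 1 would do.\<close>
  define e where "e = (1 - 1 / (2 * real n)) / sqrt Q"
  have h: "0 < h" using l by (simp add: h_def)
  have hl: "1 / h\<^sup>2 = l" using l by (simp add: h_def power_divide)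
  have h4: "l / 4 = 1 / (2 * h)\<^sup>2" using hl by (simp add: power_mult_distrib)
  have rn: "1 \<le> real n" using n by simp
  have e: "0 < e" "e < 1 / sqrt Q"
  proof -
    have "1 / (2 * real n) < 1" "0 < 1 / (2 * real n)" using rn by simp_all
    then show "0 < e" "e < 1 / sqrt Q" using Q by (simp_all add: e_def divide_strict_right_mono)
  qed
  have ne: "(real n - 1) / sqrt Q < real n * e"
  proof -
    have "real n * (1 - 1 / (2 * real n)) = real n - 1 / 2" using rn by (simp add: right_diff_distrib)
    then have "real n * e = (real n - 1 / 2) / sqrt Q" by (simp add: e_def)
    then show ?thesis using Q by (simp add: divide_strict_right_mono)
  qed
  define G where "G = {x. ereal (1 / (2 * h)\<^sup>2) \<le> otelbaev 2 \<mu> x}"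
  have G: "G \<in> sets borel" unfolding G_def using h by (intro otelbaev_superlevel_borel[OF sets]) auto
  have Gsmall: "emeasure lborel G \<le> ennreal ((real n - 1) / sqrt Q)" using small by (simp add: G_def h4)
  have short: "light \<mu> d a" if "0 < d" "d < 1 / sqrt Q" for d a
  proof -
    have "emeasure \<mu> {a..<a + d} \<le> emeasure \<mu> {(a + d/2) - d/2..(a + d/2) + d/2}"
      using sets by (intro emeasure_mono) auto
    also have "\<dots> < ennreal (1 / (2 * d))"
      by (rule otelbaev_le_imp[OF sets _ Q(2,1) that]) simp
    finally show ?thesis by (simp add: light_def)
  qed
  define S where "S = {a. \<not> light \<mu> h a}"
  have Ssub: "{a..<a + e} \<subseteq> G" if "a \<in> S" for a
  proof -
    \<comment> \<open>A heavy interval can exist only if \<open>h\<close> is at least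
      \<open>1 / sqrt Q\<close>; then \<open>e <= h\<close>, as the inclusion in the superlevel set
      demands.\<close>
    have "\<not> h < 1 / sqrt Q" using short[OF h] that by (auto simp: S_def)
    then have "e \<le> h" using e by linarith
    then show ?thesis using heavy_subset_superlevel[OF sets h] that by (simp add: S_def G_def)
  qed
  have count: "card X < n" if X: "finite X" "X \<subseteq> S" "separated e X" for X
  proof (rule ccontr)
    assume "\<not> card X < n"
    then have "real n * e \<le> real (card X) * e" using e by (intro mult_right_mono) auto
    then have "ennreal (real n * e) \<le> ennreal (real (card X) * e)" by (rule ennreal_leI)
    also have "\<dots> \<le> emeasure lborel G"
      using X Ssub by (intro separated_card_bound e G) auto
    also have "\<dots> \<le> ennreal ((real n - 1) / sqrt Q)" by (rule Gsmall)
    finally have "real n * e \<le> (real n - 1) / sqrt Q"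
      using rn Q by (subst (asm) ennreal_le_iff) auto
    then show False using ne by simp
  qed
  \<comment> \<open>Heavy positions unbounded to the left would include \<open>n\<close> separated
    ones, too many for the measure of \<open>G\<close>; so the tiling has a starting point
    \<open>A\<close>.\<close>
  have "\<exists>A. \<forall>a\<le>A. a \<notin> S"
  proof (rule ccontr)
    assume "\<not> ?thesis"
    then have "\<And>A. \<exists>a\<le>A. a \<in> S" by blast
    from unbounded_separated[OF this e(1), of n] obtain X
      where "X \<subseteq> S" "finite X" "card X = n" "separated e X" by blast
    then show False using count[of X] by simp
  qed
  then obtain A where A: "\<And>a. a \<le> A \<Longrightarrow> light \<mu> h a" by (auto simp: S_def)
  define p where "p = endpoint \<mu> h e A"
  define X where "X = {x \<in> range p. x \<in> S}"
  \<comment> \<open>The step taken from a heavy partition point has length \<open>e\<close>, so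
    later partition points are at least that far away.\<close>
  have "x + e \<le> y" if xy: "x \<in> X" "y \<in> X" "x < y" for x y
  proof -
    obtain j k where jk: "x = p j" "y = p k" "\<not> light \<mu> h (p j)" using xy by (auto simp: X_def S_def)
    have "\<not> k \<le> j" using endpoint_mono[OF h e(1), of k j \<mu> A] jk xy(3) by (auto simp: p_def)
    then have "p (Suc j) \<le> p k" unfolding p_def by (intro endpoint_mono h e) auto
    then show ?thesis using jk by (simp add: p_def)
  qed
  then have sep: "separated e X" by (simp add: separated_def)
  have sepsub: "separated e Y" if "Y \<subseteq> X" for Y using sep that unfolding separated_def by blast
  have XS: "X \<subseteq> S" by (auto simp: X_def)
  have fin: "finite X"
  proof (rule ccontr)
    assume "infinite X"
    then obtain Y where "Y \<subseteq> X" "finite Y" "card Y = n" using infinite_arbitrarily_large by blast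
    then show False using count[of Y] sepsub XS by auto
  qed
  have "- l * L2_sq f \<le> Re (mu_form \<mu> f f)" if f: "f \<in> form_domain \<mu>" "\<And>x. x \<in> X \<Longrightarrow> f x = 0" for f
    unfolding hl[symmetric]
  proof (rule mu_form_lower_bound[OF f(1) sets h e(1) A])
    show "light \<mu> e a" for a by (rule short[OF e])
    show "f (endpoint \<mu> h e A k) = 0" if "\<not> light \<mu> h (endpoint \<mu> h e A k)" for k
      using that by (intro f(2)) (auto simp: X_def S_def p_def)
  qed
  then show ?thesis using fin count[OF fin XS sep] by blast
qed

text \<open>Greedy choice from the left: take a point \<open>x\<close> within
  \<open>\<delta>\<close> of the infimum and drop everything left of \<open>x + w\<close>, at a cost
  of at most \<open>\<delta> + w\<close> in measure. Strict excess over \<open>m * w\<close> leaves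
  a point after \<open>m\<close> such rounds.\<close>

lemma bounded_below_separated:
  assumes "S \<in> sets borel" "0 < w" "bdd_below S" "ennreal (real m * w) < emeasure lborel S"
  shows "\<exists>X\<subseteq>S. finite X \<and> card X = Suc m \<and> separated w X"
  using assms(1,3,4)
proof (induction m arbitrary: S)
  case 0
  then obtain x where "x \<in> S" by fastforce
  then show ?case by (intro exI[of _ "{x}"]) (simp add: separated_def)
next
  case (Suc m)
  \<comment> \<open>A finite \<open>r\<close> in between is taken since the measure may be infinite;
    its excess \<open>\<delta>\<close> pays for an infimum that is not attained.\<close>
  obtain r where r: "real (Suc m) * w < r" "ennreal r < emeasure lborel S"
  proof -
    obtain z where z: "ennreal (real (Suc m) * w) < z" "z < emeasure lborel S" using dense[OF Suc.prems(3)] by blast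
    then obtain r where "z = ennreal r" "0 \<le> r" by (cases z) auto
    then show ?thesis using z that[of r] assms(2) by (simp add: ennreal_less_iff)
  qed
  define \<delta> where "\<delta> = r - real (Suc m) * w"
  have \<delta>: "0 < \<delta>" using r by (simp add: \<delta>_def)
  have "S \<noteq> {}" using Suc.prems(3) by auto
  then obtain x where x: "x \<in> S" "x < Inf S + \<delta>" using cInf_lessD[of S "Inf S + \<delta>"] \<delta> by auto
  define T where "T = S \<inter> {x + w..}"
  have "T \<in> sets borel" using Suc.prems(1) by (simp add: T_def)
  have low: "Inf S \<le> y" if "y \<in> S" for y using that Suc.prems(2) by (rule cInf_lower)
  have "ennreal (real m * w) < emeasure lborel T"
  proof (rule ccontr)
    assume "\<not> ?thesis"
    then have T: "emeasure lborel T \<le> ennreal (real m * w)" by simp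
    have "S \<subseteq> {Inf S..Inf S + (\<delta> + w)} \<union> T"
    proof
      fix y assume y: "y \<in> S"
      show "y \<in> {Inf S..Inf S + (\<delta> + w)} \<union> T"
        using low[OF y] x y by (cases "x + w \<le> y") (auto simp: T_def)
    qed
    then have "emeasure lborel S \<le> emeasure lborel ({Inf S..Inf S + (\<delta> + w)} \<union> T)"
      using \<open>T \<in> sets borel\<close> by (intro emeasure_mono) auto
    also have "\<dots> \<le> emeasure lborel {Inf S..Inf S + (\<delta> + w)} + emeasure lborel T"
      using \<open>T \<in> sets borel\<close> by (intro emeasure_subadditive) auto
    also have "\<dots> \<le> ennreal (\<delta> + w) + ennreal (real m * w)"
      using T \<delta> assms(2) by (intro add_mono) auto
    also have "\<dots> = ennreal r"
      using \<delta> assms(2) by (simp add: \<delta>_def algebra_simps flip: ennreal_plus)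
    finally show False using r by simp
  qed
  moreover have "bdd_below T" using Suc.prems(2) by (auto simp: T_def intro: bdd_below_mono)
  ultimately obtain X where X: "X \<subseteq> T" "finite X" "card X = Suc m" "separated w X"
    using Suc.IH[OF \<open>T \<in> sets borel\<close>] by blast
  have "x + w \<le> y" if "y \<in> X" for y using X(1) that by (auto simp: T_def)
  moreover from this have "x \<notin> X" using assms(2) by fastforce
  ultimately show ?case using X x(1) assms(2)
    by (intro exI[of _ "insert x X"]) (auto simp: T_def intro: separated_insert_left)
qed

lemma large_measure_separated:
  assumes "S \<in> sets borel" "0 < w" "ennreal (real m * w) < emeasure lborel S"
  shows "\<exists>X\<subseteq>S. finite X \<and> card X = Suc m \<and> separated w X"
proof (cases "bdd_below S")
  case True
  then show ?thesis using bounded_below_separated assms by blast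
next
  case False
  then have "\<exists>a\<le>A. a \<in> S" for A
    unfolding bdd_below_def by (meson linear not_le)
  then show ?thesis using unbounded_separated assms(2) by blast
qed

section \<open>Trapezoidal test functions\<close>

text \<open>Stated for an abstract sesquilinear \<open>\<psi>\<close> because it serves both the
  form and the inner product.\<close>

lemma lin_comb_quadratic:
  fixes \<psi> :: "(real \<Rightarrow> complex) \<Rightarrow> (real \<Rightarrow> complex) \<Rightarrow> complex"
  assumes J: "finite J" and V: "(\<lambda>_. 0) \<in> V" "\<And>f c g. f \<in> V \<Longrightarrow> g \<in> V \<Longrightarrow> axpy f c g \<in> V"
    and e: "\<And>j. j \<in> J \<Longrightarrow> e j \<in> V"
    and lin: "\<And>f c g h. f \<in> V \<Longrightarrow> g \<in> V \<Longrightarrow> h \<in> V \<Longrightarrow> \<psi> (axpy f c g) h = \<psi> f h + c * \<psi> g h"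
    and comm: "\<And>f g. f \<in> V \<Longrightarrow> g \<in> V \<Longrightarrow> \<psi> g f = cnj (\<psi> f g)"
    and orthog: "\<And>i j. i \<in> J \<Longrightarrow> j \<in> J \<Longrightarrow> i \<noteq> j \<Longrightarrow> \<psi> (e i) (e j) = 0"
  shows "\<psi> (lin_comb J c e) (lin_comb J c e) = (\<Sum>j\<in>J. of_real ((cmod (c j))\<^sup>2) * \<psi> (e j) (e j))"
proof -
  define f where "f = lin_comb J c e"
  have f: "f \<in> V" unfolding f_def by (rule lin_comb_closed[OF J V e])
  have first: "\<psi> f h = (\<Sum>j\<in>J. c j * \<psi> (e j) h)" if "h \<in> V" for h
    unfolding f_def by (rule lin_comb_linear[OF J V e, where \<phi> = "\<lambda>f. \<psi> f h"]) (use lin that in auto)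
  have "\<psi> (e j) f = cnj (c j) * \<psi> (e j) (e j)" if j: "j \<in> J" for j
  proof -
    have "\<psi> f (e j) = (\<Sum>i\<in>J. if i = j then c j * \<psi> (e j) (e j) else 0)"
      unfolding first[OF e[OF j]] using orthog j by (intro sum.cong) auto
    then have "\<psi> f (e j) = c j * \<psi> (e j) (e j)" using J j by simp
    then show ?thesis using comm[OF f e[OF j]] comm[OF e[OF j] e[OF j]] by simp
  qed
  then have "\<psi> f f = (\<Sum>j\<in>J. c j * cnj (c j) * \<psi> (e j) (e j))"
    unfolding first[OF f] by (simp add: mult.assoc)
  then show ?thesis by (simp add: f_def complex_norm_square del: of_real_power)
qed

text \<open>Here \<open>r\<close> is half the length of the support and \<open>q\<close> the width
  of each ramp; the plateau is \<open>[c - (r - q), c + (r - q)]\<close>.\<close>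

definition trapezoid :: "real \<Rightarrow> real \<Rightarrow> real \<Rightarrow> real \<Rightarrow> real" where
  "trapezoid r q c x = max 0 (min 1 ((r - \<bar>x - c\<bar>) / q))"

definition trapezoid_deriv :: "real \<Rightarrow> real \<Rightarrow> real \<Rightarrow> real \<Rightarrow> real" where
  "trapezoid_deriv r q c x = (indicator {c - r<..<c - r + q} x - indicator {c + r - q<..<c + r} x) / q"

context
  fixes r q :: real
  assumes q: "0 < q" and qr: "q < r"
begin

lemma trapezoid_bounds: "0 \<le> trapezoid r q c x" "trapezoid r q c x \<le> 1"
  by (auto simp: trapezoid_def)

lemma trapezoid_eq_0: "r \<le> \<bar>x - c\<bar> \<Longrightarrow> trapezoid r q c x = 0"
  using q by (simp add: trapezoid_def divide_nonpos_pos)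

lemma trapezoid_eq_1: "\<bar>x - c\<bar> \<le> r - q \<Longrightarrow> trapezoid r q c x = 1"
  using q by (simp add: trapezoid_def)

lemma trapezoid_continuous: "continuous_on A (trapezoid r q c)"
  unfolding trapezoid_def using q by (intro continuous_intros) auto

lemma trapezoid_has_derivative:
  assumes "x \<notin> {c - r, c - r + q, c + r - q, c + r}"
  shows "(trapezoid r q c has_real_derivative trapezoid_deriv r q c x) (at x)"
proof -
  have local: "(trapezoid r q c has_real_derivative D) (at x)"
    if "(F has_real_derivative D) (at x)" "x \<in> {a<..<b}" "\<And>y. y \<in> {a<..<b} \<Longrightarrow> F y = trapezoid r q c y"
    for F D a b
    by (rule has_field_derivative_transform_within_open[of F D x "{a<..<b}"]) (use that in auto)
  consider "x < c - r" | "c - r < x" "x < c - r + q" | "c - r + q < x" "x < c + r - q"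
    | "c + r - q < x" "x < c + r" | "c + r < x"
    using assms by force
  then show ?thesis
  proof cases
    case 1
    then have "trapezoid_deriv r q c x = 0" using q qr by (simp add: trapezoid_deriv_def)
    then show ?thesis
      using 1 q by (intro local[of "\<lambda>_. 0" _ "x - 1" "c - r"]) (auto simp: abs_if intro!: trapezoid_eq_0)
  next
    case 2
    then have eq: "trapezoid_deriv r q c x = 1 / q" using q qr by (simp add: trapezoid_deriv_def)
    have "((\<lambda>y. (y - (c - r)) / q) has_real_derivative 1 / q) (at x)"
      using q by (auto intro!: derivative_eq_intros)
    then show ?thesis unfolding eq
      by (rule local[of _ _ "c - r" "c - r + q"])
        (use 2 q qr in \<open>auto simp: trapezoid_def min_def max_def field_simps\<close>)
  next
    case 3
    then have "trapezoid_deriv r q c x = 0" using q qr by (simp add: trapezoid_deriv_def)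
    then show ?thesis
      using 3 q by (intro local[of "\<lambda>_. 1" _ "c - r + q" "c + r - q"]) (auto simp: abs_if intro!: trapezoid_eq_1)
  next
    case 4
    then have eq: "trapezoid_deriv r q c x = - 1 / q" using q qr by (simp add: trapezoid_deriv_def)
    have "((\<lambda>y. (c + r - y) / q) has_real_derivative - 1 / q) (at x)"
      using q by (auto intro!: derivative_eq_intros)
    then show ?thesis unfolding eq
      by (rule local[of _ _ "c + r - q" "c + r"])
        (use 4 q qr in \<open>auto simp: trapezoid_def min_def max_def field_simps\<close>)
  next
    case 5
    then have "trapezoid_deriv r q c x = 0" using q qr by (simp add: trapezoid_deriv_def)
    then show ?thesis
      using 5 q by (intro local[of "\<lambda>_. 0" _ "c + r" "x + 1"]) (auto simp: abs_if intro!: trapezoid_eq_0)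
  qed
qed

lemma trapezoid_deriv_sq:
  "(trapezoid_deriv r q c x)\<^sup>2 =
    (indicator {c - r<..<c - r + q} x + indicator {c + r - q<..<c + r} x) / q\<^sup>2"
  using q qr by (auto simp: trapezoid_deriv_def indicator_def power_divide)

lemma trapezoid_deriv_L2: "(\<lambda>x. complex_of_real (trapezoid_deriv r q c x)) \<in> L2"
  and trapezoid_deriv_L2_sq: "L2_sq (\<lambda>x. complex_of_real (trapezoid_deriv r q c x)) = 2 / q"
proof -
  have int: "integrable lborel (indicat_real {a<..<b})" for a b :: real
    by (cases "a \<le> b") (auto intro: integrable_real_indicator)
  have "(\<lambda>x. trapezoid_deriv r q c x) \<in> borel_measurable borel"
    unfolding trapezoid_deriv_def by measurable
  then show "(\<lambda>x. complex_of_real (trapezoid_deriv r q c x)) \<in> L2"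
    by (auto simp: L2_def trapezoid_deriv_sq intro!: int)
  have "L2_sq (\<lambda>x. complex_of_real (trapezoid_deriv r q c x)) = (q + q) / q\<^sup>2"
    unfolding L2_sq_def norm_of_real power2_abs trapezoid_deriv_sq
    using q qr by (simp add: int)
  then show "L2_sq (\<lambda>x. complex_of_real (trapezoid_deriv r q c x)) = 2 / q"
    using q by (simp add: power2_eq_square)
qed

text \<open>The fundamental theorem of calculus tolerates finitely many exceptional points of a
  continuous function, here the four kinks.\<close>

lemma trapezoid_has_L2_derivative:
  "has_L2_derivative (\<lambda>x. complex_of_real (trapezoid r q c x)) (\<lambda>x. complex_of_real (trapezoid_deriv r q c x))"
  unfolding has_L2_derivative_def
proof (intro conjI allI impI)
  fix a b :: real assume ab: "a \<le> b"
  have si: "set_integrable lborel {a..b} (trapezoid_deriv r q c)"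
    using L2_set_integrable[OF trapezoid_deriv_L2, of a b c] 
    by (subst (asm) set_integrable_def) (simp add: set_integrable_def scaleR_conv_of_real
        complex_of_real_integrable_eq flip: of_real_mult)
  have "(trapezoid_deriv r q c has_integral (trapezoid r q c b - trapezoid r q c a)) {a..b}"
  proof (rule fundamental_theorem_of_calculus_interior_strong[of "{c - r, c - r + q, c + r - q, c + r}"])
    show "(trapezoid r q c has_vector_derivative trapezoid_deriv r q c x) (at x)"
      if "x \<in> {a<..<b} - {c - r, c - r + q, c + r - q, c + r}" for x
      using trapezoid_has_derivative[of x c] that by (simp add: has_real_derivative_iff_has_vector_derivative)
  qed (use ab trapezoid_continuous in auto)
  then have "(LINT x:{a..b}|lborel. trapezoid_deriv r q c x) = trapezoid r q c b - trapezoid r q c a"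
    using set_borel_integral_eq_integral(2)[OF si] integral_unique by metis
  then show "complex_of_real (trapezoid r q c b) - complex_of_real (trapezoid r q c a)
      = (CLINT x:{a..b}|lborel. complex_of_real (trapezoid_deriv r q c x))"
    by (simp add: set_integral_complex_of_real flip: of_real_diff)
qed (rule trapezoid_deriv_L2)

lemma trapezoid_sq_le: "(trapezoid r q c x)\<^sup>2 \<le> indicator {c - r..c + r} x"
proof (cases "x \<in> {c - r..c + r}")
  case True
  then show ?thesis using trapezoid_bounds[of c x] by (simp add: power_le_one)
next
  case False
  then have "r \<le> \<bar>x - c\<bar>" by auto
  then show ?thesis using trapezoid_eq_0 by simp
qed

lemma trapezoid_sq_integrable:
  assumes "sets M = sets borel" "emeasure M {c - r..c + r} < \<infinity>"
  shows "integrable M (\<lambda>x. (trapezoid r q c x)\<^sup>2)"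
proof (rule Bochner_Integration.integrable_bound)
  show "integrable M (indicat_real {c - r..c + r})"
    using assms by (intro integrable_real_indicator) auto
  have "trapezoid r q c \<in> borel_measurable borel"
    by (intro borel_measurable_continuous_onI trapezoid_continuous)
  then show "(\<lambda>x. (trapezoid r q c x)\<^sup>2) \<in> borel_measurable M"
    using assms(1) by (simp cong: measurable_cong_sets)
qed (use trapezoid_sq_le in auto)

lemma trapezoid_L2: "(\<lambda>x. complex_of_real (trapezoid r q c x)) \<in> L2"
  and trapezoid_L2_sq: "L2_sq (\<lambda>x. complex_of_real (trapezoid r q c x)) \<le> 2 * r"
proof -
  have int: "integrable lborel (\<lambda>x. (trapezoid r q c x)\<^sup>2)"
    by (rule trapezoid_sq_integrable) (auto simp: emeasure_lborel_Icc_eq)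
  have "trapezoid r q c \<in> borel_measurable borel"
    by (intro borel_measurable_continuous_onI trapezoid_continuous)
  then show "(\<lambda>x. complex_of_real (trapezoid r q c x)) \<in> L2" using int by (simp add: L2_def)
  have "(LINT x|lborel. (trapezoid r q c x)\<^sup>2) \<le> (LINT x|lborel. indicat_real {c - r..c + r} x)"
    by (intro integral_mono int trapezoid_sq_le integrable_real_indicator) (auto simp: emeasure_lborel_Icc_eq)
  also have "\<dots> = 2 * r" using q qr by simp
  finally show "L2_sq (\<lambda>x. complex_of_real (trapezoid r q c x)) \<le> 2 * r" by (simp add: L2_sq_def)
qed

lemma trapezoid_form_domain:
  assumes "radon_measure \<mu>"
  shows "(\<lambda>x. complex_of_real (trapezoid r q c x)) \<in> form_domain \<mu>"
proof -
  have "integrable \<mu> (\<lambda>x. (trapezoid r q c x)\<^sup>2)"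
    using assms by (intro trapezoid_sq_integrable) (auto simp: radon_measure_def)
  then show ?thesis
    using trapezoid_has_L2_derivative trapezoid_L2 by (auto simp: form_domain_def H1_def)
qed

text \<open>Two ramps of slope \<open>1 / q\<close> and width \<open>q\<close> cost
  \<open>2 / q\<close>; of the \<open>\<mu>\<close>-integral only the plateau, where the function is
  1, is retained.\<close>

lemma trapezoid_form_le:
  assumes "radon_measure \<mu>"
  shows "Re (mu_form \<mu> (\<lambda>x. complex_of_real (trapezoid r q c x)) (\<lambda>x. complex_of_real (trapezoid r q c x)))
    \<le> 2 / q - measure \<mu> {c - (r - q)..c + (r - q)}"
proof -
  have sets: "sets \<mu> = sets borel" and fin: "emeasure \<mu> {a..b} < \<infinity>" for a b
    using assms by (auto simp: radon_measure_def)
  have sp: "space \<mu> = UNIV" using sets_eq_imp_space_eq[OF sets] by simp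
  have "(LINT x|\<mu>. indicat_real {c - (r - q)..c + (r - q)} x) \<le> (LINT x|\<mu>. (trapezoid r q c x)\<^sup>2)"
  proof (rule integral_mono)
    show "integrable \<mu> (indicat_real {c - (r - q)..c + (r - q)})"
      using sets fin by (intro integrable_real_indicator) auto
    show "integrable \<mu> (\<lambda>x. (trapezoid r q c x)\<^sup>2)" by (rule trapezoid_sq_integrable[OF sets fin])
    show "indicat_real {c - (r - q)..c + (r - q)} x \<le> (trapezoid r q c x)\<^sup>2" for x
      using trapezoid_eq_1[of x c] by (auto simp: indicator_def abs_le_iff)
  qed
  then have "measure \<mu> {c - (r - q)..c + (r - q)} \<le> (LINT x|\<mu>. (trapezoid r q c x)\<^sup>2)"
    by (simp add: sp)
  then show ?thesis
    by (simp add: Re_mu_form_self[OF trapezoid_has_L2_derivative] trapezoid_deriv_L2_sq)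
qed

lemma trapezoid_disjoint:
  assumes "2 * r \<le> \<bar>c - c'\<bar>"
  shows "trapezoid r q c x * trapezoid r q c' x = 0" "trapezoid_deriv r q c x * trapezoid_deriv r q c' x = 0"
proof -
  have "r \<le> \<bar>x - c\<bar> \<or> r \<le> \<bar>x - c'\<bar>" using assms by linarith
  moreover have "trapezoid_deriv r q c x = 0" if "r \<le> \<bar>x - c\<bar>" for c
    using that q qr by (auto simp: trapezoid_deriv_def indicator_def)
  ultimately show "trapezoid r q c x * trapezoid r q c' x = 0" "trapezoid_deriv r q c x * trapezoid_deriv r q c' x = 0"
    using trapezoid_eq_0[of x c] trapezoid_eq_0[of x c'] by auto
qed

lemma trapezoid_mu_form_disjoint:
  assumes "2 * r \<le> \<bar>c - c'\<bar>"
  shows "mu_form \<mu> (\<lambda>x. complex_of_real (trapezoid r q c x)) (\<lambda>x. complex_of_real (trapezoid r q c' x)) = 0"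
    and "L2_inner (\<lambda>x. complex_of_real (trapezoid r q c x)) (\<lambda>x. complex_of_real (trapezoid r q c' x)) = 0"
  unfolding mu_form_eq[OF trapezoid_has_L2_derivative trapezoid_has_L2_derivative] L2_inner_def
  by (simp_all add: trapezoid_disjoint[OF assms] flip: of_real_mult)

end

text \<open>The mass pays for the ramps, \<open>2 / q\<close>, and for \<open>l\<close> times the
  squared norm, which is at most the support length \<open>2 * r\<close>. Separation by
  \<open>2 * r\<close> lets supports meet at most in end points, so form and norm are diagonal;
  values at the centres give independence.\<close>

lemma negative_test_functions:
  assumes radon: "radon_measure \<mu>" and sf: "semibounded_form (form_domain \<mu>) (mu_form \<mu>)"
    and q: "0 < q" "q < r" and l: "0 < l"
    and X: "finite X" "card X = n" "separated (2 * r) X"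
    and mass: "\<And>c. c \<in> X \<Longrightarrow> 2 / q + 2 * r * l \<le> measure \<mu> {c - (r - q)..c + (r - q)}"
  shows "\<exists>F. (\<forall>i<n. F i \<in> form_domain \<mu>) \<and>
    (\<forall>c. Re (mu_form \<mu> (lin_comb {..<n} c F) (lin_comb {..<n} c F)) \<le> - l * L2_sq (lin_comb {..<n} c F)) \<and>
    (\<forall>c. lin_comb {..<n} c F = (\<lambda>_. 0) \<longrightarrow> (\<forall>i<n. c i = 0))"
proof -
  interpret semibounded_form "form_domain \<mu>" "mu_form \<mu>" by (rule sf)
  obtain \<xi> where "bij_betw \<xi> {0..<n} X" using ex_bij_betw_nat_finite[OF X(1)] X(2) by blast
  then have \<xi>: "inj_on \<xi> {..<n}" "\<xi> ` {..<n} = X" by (auto simp: bij_betw_def atLeast0LessThan)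
  have \<xi>X: "\<xi> i \<in> X" if "i < n" for i using \<xi>(2) that by auto
  define F where "F i = (\<lambda>x. complex_of_real (trapezoid r q (\<xi> i) x))" for i
  have FD: "F i \<in> form_domain \<mu>" for i unfolding F_def by (rule trapezoid_form_domain[OF q radon])
  have far: "2 * r \<le> \<bar>\<xi> i - \<xi> j\<bar>" if "i < n" "j < n" "i \<noteq> j" for i j
  proof -
    have "\<xi> i \<noteq> \<xi> j" using \<xi>(1) that by (auto simp: inj_on_def)
    then consider "\<xi> i < \<xi> j" | "\<xi> j < \<xi> i" by linarith
    then show ?thesis
      using X(3) \<xi>X[OF that(1)] \<xi>X[OF that(2)] by cases (fastforce simp: separated_def)+
  qed
  have neg: "Re (mu_form \<mu> (F i) (F i)) \<le> - l * L2_sq (F i)" if "i < n" for i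
  proof -
    have "Re (mu_form \<mu> (F i) (F i)) \<le> - (2 * r * l)"
      using trapezoid_form_le[OF q radon, of "\<xi> i"] mass[OF \<xi>X[OF that]] by (simp add: F_def)
    also have "\<dots> \<le> - l * L2_sq (F i)"
      using trapezoid_L2_sq[OF q, of "\<xi> i"] l by (simp add: F_def mult.commute)
    finally show ?thesis .
  qed
  have "Re (mu_form \<mu> (lin_comb {..<n} c F) (lin_comb {..<n} c F)) \<le> - l * L2_sq (lin_comb {..<n} c F)" for c
  proof -
    have "mu_form \<mu> (lin_comb {..<n} c F) (lin_comb {..<n} c F)
        = (\<Sum>j<n. of_real ((cmod (c j))\<^sup>2) * mu_form \<mu> (F j) (F j))"
      using FD trapezoid_mu_form_disjoint(1)[OF q far]
      by (intro lin_comb_quadratic[OF _ zero_D axpy_D _ a_axpy a_commute]) (auto simp: F_def)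
    moreover have "L2_inner (lin_comb {..<n} c F) (lin_comb {..<n} c F)
        = (\<Sum>j<n. of_real ((cmod (c j))\<^sup>2) * L2_inner (F j) (F j))"
      using D_L2[OF FD] trapezoid_mu_form_disjoint(2)[OF q far]
      by (intro lin_comb_quadratic[OF _ zero_L2 L2_axpy _ L2_inner_axpy L2_inner_commute]) (auto simp: F_def)
    then have "of_real (L2_sq (lin_comb {..<n} c F)) = complex_of_real (\<Sum>j<n. (cmod (c j))\<^sup>2 * L2_sq (F j))"
      by (simp add: L2_inner_self)
    then have "L2_sq (lin_comb {..<n} c F) = (\<Sum>j<n. (cmod (c j))\<^sup>2 * L2_sq (F j))"
      by (simp only: of_real_eq_iff)
    moreover have "(\<Sum>j<n. (cmod (c j))\<^sup>2 * Re (mu_form \<mu> (F j) (F j)))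
        \<le> (\<Sum>j<n. (cmod (c j))\<^sup>2 * (- l * L2_sq (F j)))"
      using neg by (intro sum_mono mult_left_mono) auto
    ultimately show ?thesis by (simp add: sum_distrib_left algebra_simps del: of_real_power)
  qed
  moreover have "c i = 0" if zero: "lin_comb {..<n} c F = (\<lambda>_. 0)" and i: "i < n" for c i
  proof -
    have "F j (\<xi> i) = (if j = i then 1 else 0)" if j: "j < n" for j
    proof (cases "j = i")
      case True
      then show ?thesis using trapezoid_eq_1[OF q, of "\<xi> i" "\<xi> i"] q by (simp add: F_def)
    next
      case False
      then show ?thesis
        using far[OF i j] trapezoid_eq_0[OF q, of "\<xi> i" "\<xi> j"] q by (auto simp: F_def)
    qed
    then have "lin_comb {..<n} c F (\<xi> i) = (\<Sum>j<n. if j = i then c i else 0)"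
      unfolding lin_comb_def by (intro sum.cong) auto
    then show ?thesis using zero i by simp
  qed
  ultimately show ?thesis using FD by (intro exI[of _ F]) blast
qed

lemma otelbaev_test_functions:
  assumes radon: "radon_measure \<mu>" and sf: "semibounded_form (form_domain \<mu>) (mu_form \<mu>)"
    and \<alpha>: "\<alpha> = inverse (pi\<^sup>2 + 3 / 4)" and l: "0 < l" and n: "1 \<le> n"
    and large: "ennreal (real n / sqrt l) \<le> emeasure lborel {x. ereal (4 * l) \<le> otelbaev \<alpha> \<mu> x}"
  shows "\<exists>F. (\<forall>i<n. F i \<in> form_domain \<mu>) \<and>
    (\<forall>c. Re (mu_form \<mu> (lin_comb {..<n} c F) (lin_comb {..<n} c F)) \<le> - l * L2_sq (lin_comb {..<n} c F)) \<and>
    (\<forall>c. lin_comb {..<n} c F = (\<lambda>_. 0) \<longrightarrow> (\<forall>i<n. c i = 0))"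
proof -
  have sets: "sets \<mu> = sets borel" using radon by (simp add: radon_measure_def)
  \<comment> \<open>Then \<open>4 * l = 1 / r^2\<close>, so membership in \<open>S\<close> controls
    the mass of intervals longer than \<open>r\<close>, and the separation \<open>2 * r\<close> is
    \<open>1 / sqrt l\<close>.\<close>
  define r where "r = 1 / (2 * sqrt l)"
  define S where "S = {x. ereal (1 / r\<^sup>2) \<le> otelbaev \<alpha> \<mu> x}"
  have r: "0 < r" using l by (simp add: r_def)
  have lr: "4 * l = 1 / r\<^sup>2" using l by (simp add: r_def power_divide power_mult_distrib)
  have p: "9 + 3 / 4 \<le> pi\<^sup>2 + 3 / 4" using power_mono[of 3 pi 2] pi_gt3 by simp
  have \<alpha>0: "0 < \<alpha>" using p by (simp add: \<alpha>)
  have S: "S \<in> sets borel" unfolding S_def by (rule otelbaev_superlevel_borel[OF sets \<alpha>0 r])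
  \<comment> \<open>The selection of separated points needs a strict excess over
    \<open>n - 1\<close> lengths and returns one point more.\<close>
  have "ennreal (real (n - 1) * (2 * r)) < ennreal (real n / sqrt l)"
    using n l by (intro ennreal_lessI) (auto simp: r_def field_simps of_nat_diff)
  also have "\<dots> \<le> emeasure lborel S" using large by (simp add: S_def lr)
  finally have "\<exists>X\<subseteq>S. finite X \<and> card X = Suc (n - 1) \<and> separated (2 * r) X"
    using r by (intro large_measure_separated[OF S]) auto
  then obtain X where X: "X \<subseteq> S" "finite X" "card X = n" "separated (2 * r) X" using n by auto
  show ?thesis
  \<comment> \<open>Ramps of width \<open>3/8 * r\<close> leave a plateau of length
    \<open>5/4 * r\<close>, longer than \<open>r\<close>, so that the Otelbaev condition applies to
    it.\<close>
  proof (rule negative_test_functions[OF radon sf _ _ l X(2,3,4), of "3 / 8 * r"])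
    fix c assume "c \<in> X"
    then have "ereal (1 / r\<^sup>2) \<le> otelbaev \<alpha> \<mu> c" using X(1) by (auto simp: S_def)
    moreover have "r < 5 / 4 * r" using r by simp
    ultimately have "ennreal (1 / (\<alpha> * (5 / 4 * r))) \<le> emeasure \<mu> {c - (5 / 4 * r) / 2..c + (5 / 4 * r) / 2}"
      unfolding otelbaev_ge_iff[OF r] by blast
    also have "(5 / 4 * r) / 2 = r - 3 / 8 * r" by simp
    also have "emeasure \<mu> {c - (r - 3 / 8 * r)..c + (r - 3 / 8 * r)} 
        = ennreal (measure \<mu> {c - (r - 3 / 8 * r)..c + (r - 3 / 8 * r)})"
      using radon by (intro emeasure_eq_ennreal_measure) (auto simp: radon_measure_def less_top)
    finally have "1 / (\<alpha> * (5 / 4 * r)) \<le> measure \<mu> {c - (r - 3 / 8 * r)..c + (r - 3 / 8 * r)}"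
      by simp
    \<comment> \<open>In units of \<open>1 / r\<close> the cost is \<open>16/3 + 1/2 = 35/6\<close>,
      and the available mass is \<open>4/5 * (pi^2 + 3/4)\<close>, at least
      \<open>39/5\<close>.\<close>
    moreover have "2 / (3 / 8 * r) + 2 * r * l \<le> 1 / (\<alpha> * (5 / 4 * r))"
    proof -
      have "2 * r * l = 1 / (2 * r)" using lr r by (simp add: power2_eq_square field_simps)
      then have "2 / (3 / 8 * r) + 2 * r * l = (35 / 6) / r" using r by (simp add: field_simps)
      also have "\<dots> \<le> (4 / 5 * (pi\<^sup>2 + 3 / 4)) / r" using p r by (intro divide_right_mono) auto
      also have "\<dots> = 1 / (\<alpha> * (5 / 4 * r))" by (simp add: \<alpha> inverse_eq_divide)
      finally show ?thesis .
    qed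
    ultimately show "2 / (3 / 8 * r) + 2 * r * l \<le> measure \<mu> {c - (r - 3 / 8 * r)..c + (r - 3 / 8 * r)}"
      by linarith
  qed (use r in auto)
qed

theorem theorem4p10:
  fixes \<mu> :: "real measure" and \<alpha> \<beta> :: real and lam :: "nat \<Rightarrow> ereal" and n :: nat
  assumes "radon_measure \<mu>"
    and "emeasure \<mu> UNIV \<noteq> 0"
    and "brinck \<mu>"
    and "negative_spectrum_discrete (H_op \<mu>)"
    and "negative_eigenvalue_sequence (H_op \<mu>) lam"
    and "\<alpha> = inverse (pi\<^sup>2 + 3 / 4)"
    and "\<beta> = 2"
    and "1 \<le> n"
  shows "Sup {ereal (- l) | l. 0 < l \<and>
             emeasure lborel {x. otelbaev \<beta> \<mu> x \<ge> ereal (l / 4)}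
               \<le> ennreal ((real n - 1) / sqrt (real_of_ereal (sup_norm (otelbaev \<beta> \<mu>))))} \<le> lam n
    \<and> lam n \<le> Inf {ereal (- l) | l. 0 < l \<and>
             emeasure lborel {x. otelbaev \<alpha> \<mu> x \<ge> ereal (4 * l)} \<ge> ennreal (real n / sqrt l)}"
proof (intro conjI Sup_least Inf_greatest)
  note sf = mu_form_semibounded[OF assms(1,3)]
  interpret semibounded_form "form_domain \<mu>" "mu_form \<mu>" by (rule sf)
  have sets: "sets \<mu> = sets borel" using assms(1) by (simp add: radon_measure_def)
  note disc = assms(4)[unfolded H_op_def] and seq = assms(5)[unfolded H_op_def]
  fix z
  {
    assume "z \<in> {ereal (- l) | l. 0 < l \<and>
             emeasure lborel {x. otelbaev \<beta> \<mu> x \<ge> ereal (l / 4)}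
               \<le> ennreal ((real n - 1) / sqrt (real_of_ereal (sup_norm (otelbaev \<beta> \<mu>))))}"
    then obtain l where l: "z = ereal (- l)" "0 < l"
      "emeasure lborel {x. otelbaev 2 \<mu> x \<ge> ereal (l / 4)}
               \<le> ennreal ((real n - 1) / sqrt (real_of_ereal (sup_norm (otelbaev 2 \<mu>))))"
      unfolding assms(7) by blast
    obtain Q where Q: "0 < Q" "sup_norm (otelbaev 2 \<mu>) = ereal Q" "\<And>x. otelbaev 2 \<mu> x \<le> ereal Q"
      using sup_norm_otelbaev[OF assms(1,2,3), of 2] by auto
    obtain X where X: "finite X" "card X < n"
      "\<And>f. f \<in> form_domain \<mu> \<Longrightarrow> (\<And>x. x \<in> X \<Longrightarrow> f x = 0) \<Longrightarrow> - l * L2_sq f \<le> Re (mu_form \<mu> f f)"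
      using mu_form_finite_codimension_bound[OF sets Q(1,3) l(2) assms(8)] l(3) by (auto simp: Q(2))
    \<comment> \<open>The constraints are the evaluations at the points of \<open>X\<close>, indexed
      by the points themselves.\<close>
    show "z \<le> lam n"
      unfolding l(1)
      by (rule eigenvalue_sequence_ge[OF disc seq l(2) assms(8) X(1,2), of "\<lambda>x f. f x"])
        (use X(3) in \<open>auto simp: axpy_def\<close>)
  }
  assume "z \<in> {ereal (- l) | l. 0 < l \<and>
             emeasure lborel {x. otelbaev \<alpha> \<mu> x \<ge> ereal (4 * l)} \<ge> ennreal (real n / sqrt l)}"
  then obtain l where l: "z = ereal (- l)" "0 < l"
    "ennreal (real n / sqrt l) \<le> emeasure lborel {x. otelbaev \<alpha> \<mu> x \<ge> ereal (4 * l)}" by blast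
  obtain F where F: "\<And>i. i < n \<Longrightarrow> F i \<in> form_domain \<mu>"
    "\<And>c. Re (mu_form \<mu> (lin_comb {..<n} c F) (lin_comb {..<n} c F)) \<le> - l * L2_sq (lin_comb {..<n} c F)"
    "\<And>c i. lin_comb {..<n} c F = (\<lambda>_. 0) \<Longrightarrow> i < n \<Longrightarrow> c i = 0"
    using otelbaev_test_functions[OF assms(1) sf assms(6) l(2) assms(8) l(3)] by blast
  show "lam n \<le> z"
    unfolding l(1) by (rule eigenvalue_sequence_le[where F = F, OF disc seq l(2) assms(8)]) (fact F)+
qed

end
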